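(* Let $A$ be a fixed subset of $\mathbb C^+$ that contains an accumulation point in $\mathbb C^+$. For each $n\in\mathbb N$, let $(\mathfrak f^n_{s,t})_{s\le t}$ be the $\boxplus$-convolution hemigroup having generator $(\gamma^n_t,\eta^n_t)_{t\in I}$. Similarly, let $(\mathfrak f_{s,t})_{s\le t}$ be the $\boxplus$-convolution hemigroup with generator $(\gamma_t,\eta_t)_{t\in I}$. Then the following conditions are equivalent (as $n\to\infty$): (1) $(\mathfrak f^n_{s,t})$ converges weakly to $(\mathfrak f_{s,t})$ locally uniformly on $I^2_\le$; (2) $\phi[\mathfrak f^n_{0,t}](z)$ converges to $\phi[\mathfrak f_{0,t}](z)$ locally uniformly on $\mathbb C^+\times I$; (3) $\phi[\mathfrak f^n_{0,t}](z)$ converges to $\phi[\mathfrak f_{0,t}](z)$ locally uniformly in $t\in I$ for each $z\in A$; (4) $(\gamma^n_t)_t$ converges to $(\gamma_t)_t$ locally uniformly on $I$, and the following mutually equivalent conditions are fulfilled: (i) $(\eta^n_t)_t$ converges weakly to $(\eta_t)_t$ locally uniformly on $I$; (ii) $\eta^n_t$ converges weakly to $\eta_t$ for each $t\in I$; (iii) $\mathcal H^n|_{\mathbb R\times[0,T]}$ converges weakly to $\mathcal H|_{\mathbb R\times[0,T]}$ for each $T\in I$.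
   Context: $I$ is a fixed interval $[0,T_0)$ ($0<T_0\le+\infty$) or $[0,T_0]$ ($0<T_0<+\infty$), and $I^2_\le=\{(s,t)\in I^2:s\le t\}$. $\mathbb C^+$ is the open upper half-plane; $\mathbf P(\mathbb R)$, $\mathbf M(\mathbb R)$ are the sets of Borel probability measures and of finite nonnegative Borel measures on $\mathbb R$. For $\mu\in\mathbf P(\mathbb R)$: $G_\mu(z)=\int\frac1{z-x}\mu(dx)$, $F_\mu=1/G_\mu$ on $\mathbb C^+$. For $a,b>0$ let $\Gamma_{a,b}=\{x+iy\in\mathbb C^+: a|x|<y,\ y>b\}$. For any $a>a'>0$ there exist $b,b'>0$ such that $F_\mu$ is univalent in $\Gamma_{a',b'}$ and $F_\mu(\Gamma_{a',b'})\supset\Gamma_{a,b}$; the Voiculescu transform is $\phi_\mu(z)=\phi[\mu](z)=F_\mu^{-1}(z)-z$, $z\in\Gamma_{a,b}$. Free convolution $\boxplus$ on $\mathbf P(\mathbb R)$ is characterized by $\phi_{\mu\boxplus\nu}=\phi_\mu+\phi_\nu$ on the intersection of the domains. A $\boxplus$-convolution hemigroup is a family $(\mu_{s,t})_{(s,t)\in I^2_\le}$ in $\mathbf P(\mathbb R)$ with $\mu_{s,s}=\delta_0$, $\mu_{s,t}\boxplus\mu_{t,u}=\mu_{s,u}$ for $s\le t\le u$, and $(s,t)\mapsto\mu_{s,t}$ weakly continuous. Here generators are families $(\gamma_t,\eta_t)_{t\in I}$ in $\mathbb R\times\mathbf M(\mathbb R)$ such that $\gamma_0=0$, $t\mapsto\gamma_t$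 is continuous, $\eta_0=0$, and $t\mapsto\eta_t(B)$ is nondecreasing and continuous for every Borel $B\subset\mathbb R$. The $\boxplus$-convolution hemigroup with generator $(\gamma_t,\eta_t)_t$ is the unique one with $\phi[\mathfrak f_{0,t}](z)=\gamma_t+\int_{\mathbb R}\frac{1+xz}{z-x}\,\eta_t(dx)$ for all $t\in I$; every $\boxplus$-convolution hemigroup has a unique generator, and this formula is used to extend $\phi[\mathfrak f_{0,t}]$ to all of $\mathbb C^+$. $\mathcal H$ is the Borel measure on $\mathbb R\times I$ with $\mathcal H(B\times(s,t])=\eta_t(B)-\eta_s(B)$ and $\mathcal H(\mathbb R\times\{0\})=0$; $\mathcal H^n$ is defined likewise from $\eta^n$; $\mathcal H|_{\mathbb R\times[0,T]}$ is the restriction to Borel subsets of $\mathbb R\times[0,T]$. For $\mathbb I=I$ or $I^2_\le$, $(\mu^n_\tau)_{\tau\in\mathbb I}$ converges weakly to $(\mu_\tau)_{\tau\in\mathbb I}$ locally uniformly on $\mathbb I$ if $\lim_n\sup_{\tau\in K}|\int f\,d\mu^n_\tau-\int f\,d\mu_\tau|=0$ for every compact $K\subset\mathbb I$ and every bounded continuous $f:\mathbb R\to\mathbb R$. *)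

theory Defs
  imports "HOL-Probability.Probability"
begin

subsection \<open>Parameter sets\<close>

definition time_interval :: "real set \<Rightarrow> bool" where
  "time_interval I \<longleftrightarrow> I = {0..} \<or> (\<exists>T>0. I = {0..<T} \<or> I = {0..T})"

definition ordered_pairs :: "real set \<Rightarrow> (real \<times> real) set" where
  "ordered_pairs I = {(s, t). s \<in> I \<and> t \<in> I \<and> s \<le> t}"

definition upper_half_plane :: "complex set" where
  "upper_half_plane = {z. Im z > 0}"

subsection \<open>Modes of convergence\<close>

definition loc_uniform_limit ::
    "'t::topological_space set \<Rightarrow> (nat \<Rightarrow> 't \<Rightarrow> 'b::metric_space) \<Rightarrow> ('t \<Rightarrow> 'b) \<Rightarrow> bool" where
  "loc_uniform_limit S h l \<longleftrightarrow>
     (\<forall>K. compact K \<and> K \<subseteq> S \<longrightarrow> uniform_limit K h l sequentially)"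

text \<open>
  Weak convergence of finite Borel measures on the space \<open>S\<close>, tested against bounded continuous
  functions on \<open>S\<close>. The library's \<open>weak_conv_m\<close> compares distribution functions and
  would, for finite measures of varying total mass, allow mass to escape to infinity.
\<close>

definition weakly_converges ::
    "'a::topological_space set \<Rightarrow> (nat \<Rightarrow> 'a measure) \<Rightarrow> 'a measure \<Rightarrow> bool" where
  "weakly_converges S M N \<longleftrightarrow>
     (\<forall>g :: 'a \<Rightarrow> real. continuous_on S g \<and> bounded (g ` S) \<longrightarrow>
        (\<lambda>n. \<integral>x. g x \<partial>M n) \<longlonglongrightarrow> (\<integral>x. g x \<partial>N))"

definition weakly_converges_loc_uniformly ::
    "'t::topological_space set \<Rightarrow> (nat \<Rightarrow> 't \<Rightarrow> real measure) \<Rightarrow> ('t \<Rightarrow> real measure) \<Rightarrow> bool" where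
  "weakly_converges_loc_uniformly S M N \<longleftrightarrow>
     (\<forall>g :: real \<Rightarrow> real. continuous_on UNIV g \<and> bounded (range g) \<longrightarrow>
        loc_uniform_limit S (\<lambda>n \<tau>. \<integral>x. g x \<partial>M n \<tau>) (\<lambda>\<tau>. \<integral>x. g x \<partial>N \<tau>))"

definition weakly_continuous_on ::
    "'t::topological_space set \<Rightarrow> ('t \<Rightarrow> real measure) \<Rightarrow> bool" where
  "weakly_continuous_on S M \<longleftrightarrow>
     (\<forall>g :: real \<Rightarrow> real. continuous_on UNIV g \<and> bounded (range g) \<longrightarrow>
        continuous_on S (\<lambda>\<tau>. \<integral>x. g x \<partial>M \<tau>))"

subsection \<open>The Voiculescu transform and free convolution\<close>

definition cauchy_transform :: "real measure \<Rightarrow> complex \<Rightarrow> complex" where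
  "cauchy_transform \<mu> z = (\<integral>x. 1 / (z - complex_of_real x) \<partial>\<mu>)"

definition recip_cauchy_transform :: "real measure \<Rightarrow> complex \<Rightarrow> complex" where
  "recip_cauchy_transform \<mu> z = 1 / cauchy_transform \<mu> z"

definition trunc_cone :: "real \<Rightarrow> real \<Rightarrow> complex set" where
  "trunc_cone a b = {z \<in> upper_half_plane. a * \<bar>Re z\<bar> < Im z \<and> Im z > b}"

definition voiculescu_cones :: "real measure \<Rightarrow> real \<Rightarrow> real \<Rightarrow> real \<Rightarrow> real \<Rightarrow> bool" where
  "voiculescu_cones \<mu> a b a' b' \<longleftrightarrow>
     0 < a' \<and> a' < a \<and> 0 < b \<and> 0 < b' \<and>
     inj_on (recip_cauchy_transform \<mu>) (trunc_cone a' b') \<and>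
     trunc_cone a b \<subseteq> recip_cauchy_transform \<mu> ` trunc_cone a' b'"

definition voiculescu_domain :: "real measure \<Rightarrow> complex set" where
  "voiculescu_domain \<mu> = \<Union> {trunc_cone a b | a b. \<exists>a' b'. voiculescu_cones \<mu> a b a' b'}"

text \<open>
  The value does not depend on the chosen cones: as \<open>z\<close> tends to infinity along the
  imaginary axis, two local inverses take values in the same cone of injectivity and hence
  coincide there, and the identity theorem gives equality on the (convex) intersection of
  their domains.
\<close>

definition voiculescu :: "real measure \<Rightarrow> complex \<Rightarrow> complex" where
  "voiculescu \<mu> z =
     (THE w. \<exists>a b a' b'. voiculescu_cones \<mu> a b a' b' \<and> z \<in> trunc_cone a b \<and>
        w = inv_into (trunc_cone a' b') (recip_cauchy_transform \<mu>) z - z)"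

text \<open>\<open>is_free_convolution \<mu> \<nu> \<rho>\<close> renders \<open>\<mu> \<boxplus> \<nu> = \<rho>\<close> for probability measures.\<close>

definition is_free_convolution :: "real measure \<Rightarrow> real measure \<Rightarrow> real measure \<Rightarrow> bool" where
  "is_free_convolution \<mu> \<nu> \<rho> \<longleftrightarrow>
     (\<forall>z \<in> voiculescu_domain \<mu> \<inter> voiculescu_domain \<nu> \<inter> voiculescu_domain \<rho>.
        voiculescu \<rho> z = voiculescu \<mu> z + voiculescu \<nu> z)"

definition free_hemigroup :: "real set \<Rightarrow> (real \<Rightarrow> real \<Rightarrow> real measure) \<Rightarrow> bool" where
  "free_hemigroup I \<mu> \<longleftrightarrow>
     (\<forall>s\<in>I. \<forall>t\<in>I. s \<le> t \<longrightarrow> real_distribution (\<mu> s t)) \<and>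
     (\<forall>s\<in>I. \<mu> s s = return borel 0) \<and>
     (\<forall>s\<in>I. \<forall>t\<in>I. \<forall>u\<in>I. s \<le> t \<and> t \<le> u \<longrightarrow> is_free_convolution (\<mu> s t) (\<mu> t u) (\<mu> s u)) \<and>
     weakly_continuous_on (ordered_pairs I) (\<lambda>(s, t). \<mu> s t)"

subsection \<open>Generators\<close>

definition generating_family :: "real set \<Rightarrow> (real \<Rightarrow> real) \<Rightarrow> (real \<Rightarrow> real measure) \<Rightarrow> bool" where
  "generating_family I \<gamma> \<eta> \<longleftrightarrow>
     \<gamma> 0 = 0 \<and> continuous_on I \<gamma> \<and>
     (\<forall>t\<in>I. finite_borel_measure (\<eta> t)) \<and> \<eta> 0 = null_measure borel \<and>
     (\<forall>B\<in>sets borel. mono_on I (\<lambda>t. measure (\<eta> t) B) \<and> continuous_on I (\<lambda>t. measure (\<eta> t) B))"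

definition pick_function :: "real \<Rightarrow> real measure \<Rightarrow> complex \<Rightarrow> complex" where
  "pick_function \<gamma> \<eta> z =
     complex_of_real \<gamma> +
     (\<integral>x. (1 + complex_of_real x * z) / (z - complex_of_real x) \<partial>\<eta>)"

definition free_generating_pair :: "real measure \<Rightarrow> real \<Rightarrow> real measure \<Rightarrow> bool" where
  "free_generating_pair \<mu> \<gamma> \<eta> \<longleftrightarrow>
     finite_borel_measure \<eta> \<and>
     (\<forall>z\<in>voiculescu_domain \<mu>. voiculescu \<mu> z = pick_function \<gamma> \<eta> z)"

definition free_hemigroup_with_generator ::
    "real set \<Rightarrow> (real \<Rightarrow> real \<Rightarrow> real measure) \<Rightarrow> (real \<Rightarrow> real) \<Rightarrow> (real \<Rightarrow> real measure) \<Rightarrow> bool" where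
  "free_hemigroup_with_generator I \<mu> \<gamma> \<eta> \<longleftrightarrow>
     free_hemigroup I \<mu> \<and> generating_family I \<gamma> \<eta> \<and>
     (\<forall>t\<in>I. free_generating_pair (\<mu> 0 t) (\<gamma> t) (\<eta> t))"

text \<open>
  The extension of the Voiculescu transform of \<open>\<mu>\<close> to the whole upper half-plane by the
  integral formula; meaningful only if \<open>\<mu>\<close> possesses a generating pair.
\<close>

definition voiculescu_ext :: "real measure \<Rightarrow> complex \<Rightarrow> complex" where
  "voiculescu_ext \<mu> z =
     (THE w. \<exists>\<gamma> \<eta>. free_generating_pair \<mu> \<gamma> \<eta> \<and> w = pick_function \<gamma> \<eta> z)"

subsection \<open>The space-time measure of a generator\<close>

definition is_space_time_measure ::
    "real set \<Rightarrow> (real \<Rightarrow> real measure) \<Rightarrow> (real \<times> real) measure \<Rightarrow> bool" where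
  "is_space_time_measure I \<eta> H \<longleftrightarrow>
     sets H = sets (restrict_space borel (UNIV \<times> I)) \<and>
     (\<forall>B\<in>sets borel. \<forall>s\<in>I. \<forall>t\<in>I. s \<le> t \<longrightarrow>
        emeasure H (B \<times> {s<..t}) = ennreal (measure (\<eta> t) B - measure (\<eta> s) B)) \<and>
     emeasure H (UNIV \<times> {0}) = 0"

definition space_time_measure ::
    "real set \<Rightarrow> (real \<Rightarrow> real measure) \<Rightarrow> (real \<times> real) measure" where
  "space_time_measure I \<eta> = (THE H. is_space_time_measure I \<eta> H)"

end

theory Submission
  imports Defs "HOL-Complex_Analysis.Great_Picard"
begin

text \<open>
  The theorem reduces to a continuity theorem for single measures. Let \<open>\<mu>\<^sub>n, \<mu>\<close> be probability
  measures whose Voiculescu transforms are the pick functions \<open>\<phi>\<^sub>n, \<phi>\<close> of the pairs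
  \<open>(\<gamma>\<^sub>n, \<eta>\<^sub>n), (\<gamma>, \<eta>)\<close>. Then \<open>\<mu>\<^sub>n \<rightarrow> \<mu>\<close> weakly if and only if \<open>\<gamma>\<^sub>n \<rightarrow> \<gamma>\<close> and \<open>\<eta>\<^sub>n \<rightarrow> \<eta>\<close> weakly
  (\<open>measures_converge_if_generating_pairs_converge\<close> and
  \<open>generating_pairs_converge_if_measures_converge\<close>).

  The domain on which a reciprocal Cauchy transform \<open>F\<^sub>\<mu>\<close> has a local inverse depends on \<open>\<mu>\<close>.
  Therefore the identity \<open>F\<^sub>\<mu>\<^sup>-\<^sup>1 = id + \<phi>\<close>, valid high up in some cone, is converted once and
  for all into the equation \<open>F\<^sub>\<mu> + \<phi> \<circ> F\<^sub>\<mu> = id\<close> on the whole upper half-plane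
  (\<open>subordination_equation\<close>). The inequality of arithmetic and geometric means shows that for
  \<open>Im z > 0\<close> the equation \<open>w + \<phi>(w) = z\<close> has at most one solution \<open>w\<close> in the half-plane
  (\<open>subordination_unique\<close>). So for \<open>w = F\<^sub>\<mu>(z)\<close> and \<open>z\<^sub>n = w + \<phi>\<^sub>n(w) \<rightarrow> z\<close> one has
  \<open>F\<^bsub>\<mu>\<^sub>n\<^esub>(z\<^sub>n) = w\<close>, and equicontinuity of Cauchy transforms gives \<open>G\<^bsub>\<mu>\<^sub>n\<^esub>(z) \<rightarrow> G\<^sub>\<mu>(z)\<close>. In the
  other direction \<open>\<phi>\<^sub>n(F\<^bsub>\<mu>\<^sub>n\<^esub>(z)) = z - F\<^bsub>\<mu>\<^sub>n\<^esub>(z)\<close> converges, which bounds the masses of \<open>\<eta>\<^sub>n\<close> and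
  gives \<open>\<phi>\<^sub>n \<rightarrow> \<phi>\<close> on the range of \<open>F\<^sub>\<mu>\<close>.

  Two facts pass between transforms and measures. Pick functions of bounded mass form a normal
  family, so that convergence on a set with an accumulation point spreads to the half-plane
  (\<open>Vitali_convergence\<close>). Convergence of Cauchy transforms together with convergence of masses
  implies weak convergence, by smoothing test functions with the Poisson kernel
  (\<open>weakly_converges_if_cauchy_transform_converges\<close>).

  The passage to hemigroups uses that locally uniform convergence to a continuous limit means
  convergence along every convergent sequence of parameters. All conditions on the
  hemigroups and their transforms are compared with one condition of this kind on the
  generators. For the increments \<open>f s t\<close> the generating pair is the difference of those at
  \<open>t\<close> and \<open>s\<close>.

  The conditions on \<open>\<eta>\<close> alone are equivalent for other reasons. Integrals of nonnegative
  functions against \<open>\<eta>\<^sub>t\<close> are monotone and continuous in \<open>t\<close>, so Polya's theorem turns pointwise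
  into uniform convergence. An integral against the space-time measure is approximated by a
  sum over time cells of integrals against increments of \<open>\<eta>\<close>.
\<close>

section \<open>Cauchy transforms of finite Borel measures\<close>

lemma open_upper_half_plane: "open upper_half_plane"
  unfolding upper_half_plane_def by (rule open_halfspace_Im_gt)

lemma connected_upper_half_plane: "connected upper_half_plane"
  unfolding upper_half_plane_def by (intro convex_connected convex_halfspace_Im_gt)

lemma Im_pos_imp_ne_of_real: "0 < Im z \<Longrightarrow> z - complex_of_real x \<noteq> 0"
  by (auto simp: complex_eq_iff)

lemma Im_le_norm_diff_of_real: "Im z \<le> norm (z - complex_of_real x)"
  using abs_Im_le_cmod[of "z - complex_of_real x"] by simp

lemma norm_resolvent_le: "0 < Im z \<Longrightarrow> norm (1 / (z - complex_of_real x)) \<le> 1 / Im z"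
  using Im_le_norm_diff_of_real[of z x] by (simp add: norm_divide frac_le)

lemma Im_resolvent: "Im (1 / (z - complex_of_real x)) = - Im z / (norm (z - complex_of_real x))\<^sup>2"
  by (simp add: Im_divide cmod_def)

lemma resolvent_product_diff:
  fixes a b :: complex
  assumes "a \<noteq> 0" "b \<noteq> 0"
  shows "1 / (a * b) - 1 / (b * b) = (b - a) * (1 / (a * b) * (1 / b))"
proof -
  have "(b - a) * (1 / (a * b)) = 1 / a - 1 / b" using assms by (simp add: field_simps)
  then have "(b - a) * (1 / (a * b) * (1 / b)) = (1 / a - 1 / b) * (1 / b)"
    by (simp only: mult.assoc[symmetric])
  also have "\<dots> = 1 / (a * b) - 1 / (b * b)"
    by (simp only: left_diff_distrib times_divide_times_eq mult_1_left)
  finally show ?thesis ..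
qed

context finite_borel_measure
begin

lemma space_M_UNIV: "space M = UNIV"
  using sets_eq_imp_space_eq[OF M_is_borel] by simp

lemma borel_measurable_M: "f \<in> borel_measurable borel \<Longrightarrow> f \<in> borel_measurable M"
  using measurable_cong_sets[OF M_is_borel refl] by blast

lemma integrable_bounded:
  fixes f :: "real \<Rightarrow> 'b::{banach, second_countable_topology}"
  assumes "f \<in> borel_measurable borel" "\<And>x. norm (f x) \<le> B"
  shows "integrable M f"
  by (rule integrable_const_bound[of f B]) (use assms borel_measurable_M in auto)

lemma norm_integral_le_mass:
  fixes f :: "real \<Rightarrow> 'b::{banach, second_countable_topology}"
  assumes "f \<in> borel_measurable borel" "\<And>x. norm (f x) \<le> B"
  shows "norm (\<integral>x. f x \<partial>M) \<le> B * measure M UNIV"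
proof -
  have "norm (\<integral>x. f x \<partial>M) \<le> (\<integral>x. norm (f x) \<partial>M)"
    by (rule integral_norm_bound)
  also have "\<dots> \<le> (\<integral>x. B \<partial>M)"
    by (intro integral_mono integrable_bounded[where B=B] integrable_const)
       (use assms in auto)
  finally show ?thesis by (simp add: space_M_UNIV mult.commute)
qed

lemma integrable_resolvent: "0 < Im z \<Longrightarrow> integrable M (\<lambda>x. 1 / (z - complex_of_real x))"
  by (rule integrable_bounded[OF _ norm_resolvent_le]) auto

lemma norm_resolvent_product_le:
  assumes "0 < Im z" "0 < Im w"
  shows "norm (1 / ((z - complex_of_real x) * (w - complex_of_real x))) \<le> 1 / (Im z * Im w)"
proof -
  have "norm (1 / ((z - complex_of_real x) * (w - complex_of_real x))) =
        norm (1 / (z - complex_of_real x)) * norm (1 / (w - complex_of_real x))"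
    by (simp add: norm_mult norm_divide)
  also have "\<dots> \<le> (1 / Im z) * (1 / Im w)"
    by (intro mult_mono norm_resolvent_le) (use assms in auto)
  finally show ?thesis by simp
qed

lemma norm_cauchy_transform_le:
  "0 < Im z \<Longrightarrow> norm (cauchy_transform M z) \<le> measure M UNIV / Im z"
  using norm_integral_le_mass[OF _ norm_resolvent_le, of z] unfolding cauchy_transform_def by simp

lemma cauchy_transform_diff:
  assumes "0 < Im z" "0 < Im w"
  shows "cauchy_transform M z - cauchy_transform M w =
           (w - z) * (\<integral>x. 1 / ((z - complex_of_real x) * (w - complex_of_real x)) \<partial>M)"
proof -
  have "cauchy_transform M z - cauchy_transform M w =
        (\<integral>x. 1 / (z - complex_of_real x) - 1 / (w - complex_of_real x) \<partial>M)"
    unfolding cauchy_transform_def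
    by (simp add: Bochner_Integration.integral_diff integrable_resolvent assms)
  also have "\<dots> = (\<integral>x. (w - z) * (1 / ((z - complex_of_real x) * (w - complex_of_real x))) \<partial>M)"
    by (rule Bochner_Integration.integral_cong)
       (use Im_pos_imp_ne_of_real assms in \<open>auto simp: field_simps\<close>)
  also have "\<dots> = (w - z) * (\<integral>x. 1 / ((z - complex_of_real x) * (w - complex_of_real x)) \<partial>M)"
    by (rule integral_mult_right_zero)
  finally show ?thesis .
qed

lemma norm_cauchy_transform_diff_le:
  assumes "0 < Im z" "0 < Im w"
  shows "norm (cauchy_transform M z - cauchy_transform M w) \<le>
           norm (z - w) * measure M UNIV / (Im z * Im w)"
proof -
  have "norm (\<integral>x. 1 / ((z - complex_of_real x) * (w - complex_of_real x)) \<partial>M) \<le>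
        1 / (Im z * Im w) * measure M UNIV"
    by (rule norm_integral_le_mass[OF _ norm_resolvent_product_le]) (use assms in auto)
  then have "norm (z - w) * norm (\<integral>x. 1 / ((z - complex_of_real x) * (w - complex_of_real x)) \<partial>M)
        \<le> norm (z - w) * (1 / (Im z * Im w) * measure M UNIV)"
    by (intro mult_left_mono) auto
  then show ?thesis
    by (simp add: cauchy_transform_diff[OF assms] norm_mult norm_minus_commute)
qed

text \<open>
  The difference quotient is again an integral of a product of resolvents, and such integrals
  depend continuously on the point.
\<close>

lemma has_field_derivative_cauchy_transform:
  assumes z: "0 < Im z"
  shows "(cauchy_transform M has_field_derivative
            - (\<integral>x. 1 / ((z - complex_of_real x) * (z - complex_of_real x)) \<partial>M)) (at z)"
proof -
  define D where "D = (\<lambda>w. \<integral>x. 1 / ((w - complex_of_real x) * (z - complex_of_real x)) \<partial>M)"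
  have int: "integrable M (\<lambda>x. 1 / ((w - complex_of_real x) * (z - complex_of_real x)))"
    if "0 < Im w" for w
    by (rule integrable_bounded[OF _ norm_resolvent_product_le]) (use that z in auto)
  \<comment> \<open>\<open>- D w\<close> is the difference quotient at \<open>z\<close>.\<close>
  have D_diff: "norm (D w - D z) \<le> norm (w - z) * (measure M UNIV / (Im w * Im z * Im z))"
    if w: "0 < Im w" for w
  proof -
    have "D w - D z = (\<integral>x. 1 / ((w - complex_of_real x) * (z - complex_of_real x)) -
                           1 / ((z - complex_of_real x) * (z - complex_of_real x)) \<partial>M)"
      unfolding D_def by (simp add: Bochner_Integration.integral_diff int w z)
    also have "\<dots> = (\<integral>x. (z - w) * (1 / ((w - complex_of_real x) * (z - complex_of_real x)) *
                           (1 / (z - complex_of_real x))) \<partial>M)"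
    proof (rule Bochner_Integration.integral_cong)
      fix x
      show "1 / ((w - complex_of_real x) * (z - complex_of_real x)) -
              1 / ((z - complex_of_real x) * (z - complex_of_real x)) =
            (z - w) * (1 / ((w - complex_of_real x) * (z - complex_of_real x)) * (1 / (z - complex_of_real x)))"
        using resolvent_product_diff[OF Im_pos_imp_ne_of_real[OF w] Im_pos_imp_ne_of_real[OF z]]
        by simp
    qed simp
    also have "\<dots> = (z - w) * (\<integral>x. 1 / ((w - complex_of_real x) * (z - complex_of_real x)) *
                           (1 / (z - complex_of_real x)) \<partial>M)"
      by (rule integral_mult_right_zero)
    finally have eq: "norm (D w - D z) = norm (w - z) * norm (\<integral>x. 1 / ((w - complex_of_real x) * (z - complex_of_real x)) *
                           (1 / (z - complex_of_real x)) \<partial>M)"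
      by (simp add: norm_mult norm_minus_commute)
    have "norm (\<integral>x. 1 / ((w - complex_of_real x) * (z - complex_of_real x)) *
                           (1 / (z - complex_of_real x)) \<partial>M) \<le> 1 / (Im w * Im z) * (1 / Im z) * measure M UNIV"
    proof (rule norm_integral_le_mass)
      fix x
      have "norm (1 / ((w - complex_of_real x) * (z - complex_of_real x))) *
            norm (1 / (z - complex_of_real x)) \<le> 1 / (Im w * Im z) * (1 / Im z)"
        by (intro mult_mono norm_resolvent_product_le norm_resolvent_le) (use w z in auto)
      then show "norm (1 / ((w - complex_of_real x) * (z - complex_of_real x)) * (1 / (z - complex_of_real x)))
          \<le> 1 / (Im w * Im z) * (1 / Im z)" by (simp only: norm_mult)
    qed auto
    then show ?thesis unfolding eq by (intro mult_left_mono) (auto simp: mult.assoc)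
  qed
  have "(D \<longlongrightarrow> D z) (at z)"
  proof (rule Lim_transform_bound[where g = "\<lambda>w. norm (w - z) * (measure M UNIV / (Im w * Im z * Im z))", THEN Lim_null[THEN iffD2]])
    have "\<forall>\<^sub>F w in at z. w \<in> upper_half_plane"
      using open_upper_half_plane z eventually_at_in_open'[of upper_half_plane z]
      by (auto simp: upper_half_plane_def)
    then show "\<forall>\<^sub>F w in at z. norm (D w - D z) \<le>
        norm (norm (w - z) * (measure M UNIV / (Im w * Im z * Im z)))"
    proof eventually_elim
      case (elim w)
      then have "0 < Im w" by (simp add: upper_half_plane_def)
      from D_diff[OF this] show ?case by (smt (verit) real_norm_def)
    qed
    have "((\<lambda>w. norm (w - z) * (measure M UNIV / (Im w * Im z * Im z))) \<longlongrightarrow>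
            norm (z - z) * (measure M UNIV / (Im z * Im z * Im z))) (at z)"
      by (intro tendsto_intros) (use z in auto)
    then show "((\<lambda>w. norm (w - z) * (measure M UNIV / (Im w * Im z * Im z))) \<longlongrightarrow> 0) (at z)"
      by simp
  qed
  then have "((\<lambda>w. - D w) \<longlongrightarrow> - D z) (at z)"
    by (rule tendsto_minus)
  moreover have "\<forall>\<^sub>F w in at z. - D w = (cauchy_transform M w - cauchy_transform M z) / (w - z)"
  proof -
    have "\<forall>\<^sub>F w in at z. w \<in> upper_half_plane - {z}"
      using open_upper_half_plane z eventually_at_in_open[of upper_half_plane z]
      by (auto simp: upper_half_plane_def)
    then show ?thesis
    proof eventually_elim
      case (elim w)
      then have "0 < Im w" "w \<noteq> z" by (auto simp: upper_half_plane_def)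
      have "cauchy_transform M w - cauchy_transform M z = (z - w) * D w"
        unfolding D_def by (rule cauchy_transform_diff) (fact \<open>0 < Im w\<close>, fact z)
      then show ?case using \<open>w \<noteq> z\<close> by (simp only: eq_divide_eq) (simp add: algebra_simps)
    qed
  qed
  ultimately have "((\<lambda>w. (cauchy_transform M w - cauchy_transform M z) / (w - z)) \<longlongrightarrow> - D z) (at z)"
    by (rule Lim_transform_eventually)
  then show ?thesis unfolding D_def has_field_derivative_iff .
qed

lemma holomorphic_cauchy_transform: "cauchy_transform M holomorphic_on upper_half_plane"
  using has_field_derivative_cauchy_transform
  by (subst holomorphic_on_open[OF open_upper_half_plane]) (auto simp: upper_half_plane_def)

lemma Im_cauchy_transform:
  assumes "0 < Im z"
  shows "Im (cauchy_transform M z) = - Im z * (\<integral>x. 1 / (norm (z - complex_of_real x))\<^sup>2 \<partial>M)"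
proof -
  have "Im (cauchy_transform M z) = (\<integral>x. Im (1 / (z - complex_of_real x)) \<partial>M)"
    unfolding cauchy_transform_def by (rule integral_Im[OF integrable_resolvent[OF assms], symmetric])
  also have "\<dots> = (\<integral>x. - Im z * (1 / (norm (z - complex_of_real x))\<^sup>2) \<partial>M)"
    unfolding Im_resolvent by simp
  also have "\<dots> = - Im z * (\<integral>x. 1 / (norm (z - complex_of_real x))\<^sup>2 \<partial>M)"
    by (rule integral_mult_right_zero)
  finally show ?thesis .
qed

end

text \<open>
  Through this splitting of the kernel every analytic fact about pick functions reduces to one
  about Cauchy transforms.
\<close>

lemma pick_kernel_split:
  "0 < Im z \<Longrightarrow> (1 + complex_of_real x * z) / (z - complex_of_real x) =
     - z + (1 + z\<^sup>2) * (1 / (z - complex_of_real x))"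
  using Im_pos_imp_ne_of_real[of z x] by (simp add: field_simps power2_eq_square)

lemma (in finite_borel_measure) pick_function_eq_cauchy:
  assumes "0 < Im z"
  shows "pick_function \<gamma> M z =
     complex_of_real \<gamma> - z * complex_of_real (measure M UNIV) + (1 + z\<^sup>2) * cauchy_transform M z"
proof -
  have "(\<integral>x. (1 + complex_of_real x * z) / (z - complex_of_real x) \<partial>M) =
        (\<integral>x. - z + (1 + z\<^sup>2) * (1 / (z - complex_of_real x)) \<partial>M)"
    by (rule Bochner_Integration.integral_cong) (use assms pick_kernel_split in auto)
  also have "\<dots> = (\<integral>x. - z \<partial>M) + (\<integral>x. (1 + z\<^sup>2) * (1 / (z - complex_of_real x)) \<partial>M)"
    by (rule Bochner_Integration.integral_add)
       (intro integrable_const integrable_mult_right integrable_resolvent assms)+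
  also have "(\<integral>x. (1 + z\<^sup>2) * (1 / (z - complex_of_real x)) \<partial>M) = (1 + z\<^sup>2) * cauchy_transform M z"
    unfolding cauchy_transform_def by (rule integral_mult_right_zero)
  finally show ?thesis
    unfolding pick_function_def by (simp add: space_M_UNIV scaleR_conv_of_real mult.commute)
qed

lemma (in finite_borel_measure) holomorphic_pick_function:
  "pick_function \<gamma> M holomorphic_on upper_half_plane"
proof -
  have "(\<lambda>z. complex_of_real \<gamma> - z * complex_of_real (measure M UNIV) + (1 + z\<^sup>2) * cauchy_transform M z)
    holomorphic_on upper_half_plane"
    by (intro holomorphic_intros holomorphic_cauchy_transform)
  then show ?thesis
    by (rule holomorphic_transform) (use pick_function_eq_cauchy in \<open>auto simp: upper_half_plane_def\<close>)
qed

lemma pick_kernel_Im: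
  "Im ((1 + complex_of_real x * z) / (z - complex_of_real x)) =
           - Im z * ((1 + x\<^sup>2) / (norm (z - complex_of_real x))\<^sup>2)"
proof -
  have "Im ((1 + complex_of_real x * z) / (z - complex_of_real x)) =
        (x * Im z * (Re z - x) - (1 + x * Re z) * Im z) / ((Re z - x)\<^sup>2 + (Im z)\<^sup>2)"
    by (simp add: Im_divide)
  also have "x * Im z * (Re z - x) - (1 + x * Re z) * Im z = - Im z * (1 + x\<^sup>2)"
    by (simp add: algebra_simps power2_eq_square)
  finally show ?thesis by (simp add: cmod_def)
qed

lemma norm_pick_kernel_le:
  assumes "0 < Im z"
  shows "norm ((1 + complex_of_real x * z) / (z - complex_of_real x)) \<le> norm z + (1 + (norm z)\<^sup>2) / Im z"
proof -
  have "norm ((1 + complex_of_real x * z) / (z - complex_of_real x)) \<le>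
        norm (- z) + norm ((1 + z\<^sup>2) * (1 / (z - complex_of_real x)))"
    unfolding pick_kernel_split[OF assms] by (rule norm_triangle_ineq)
  also have "norm ((1 + z\<^sup>2) * (1 / (z - complex_of_real x))) \<le> (1 + (norm z)\<^sup>2) * (1 / Im z)"
    unfolding norm_mult
    by (intro mult_mono norm_resolvent_le assms)
       (use norm_triangle_ineq[of 1 "z\<^sup>2"] in \<open>auto simp: norm_power\<close>)
  finally show ?thesis by simp
qed

lemma (in finite_borel_measure) integrable_pick_kernel:
  "0 < Im z \<Longrightarrow> integrable M (\<lambda>x. (1 + complex_of_real x * z) / (z - complex_of_real x))"
  by (rule integrable_bounded[OF _ norm_pick_kernel_le]) auto

lemma (in finite_borel_measure) Im_pick_function:
  assumes "0 < Im z"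
  shows "Im (pick_function \<gamma> M z) =
     - Im z * (\<integral>x. (1 + x\<^sup>2) / (norm (z - complex_of_real x))\<^sup>2 \<partial>M)"
proof -
  have "Im (pick_function \<gamma> M z) =
        (\<integral>x. Im ((1 + complex_of_real x * z) / (z - complex_of_real x)) \<partial>M)"
    unfolding pick_function_def
    by (simp add: integral_Im[OF integrable_pick_kernel[OF assms]])
  then show ?thesis by (simp only: pick_kernel_Im integral_mult_right_zero)
qed

lemma (in finite_borel_measure) integrable_weighted_poisson:
  assumes z: "0 < Im z"
  shows "integrable M (\<lambda>x. (1 + x\<^sup>2) / (norm (z - complex_of_real x))\<^sup>2)"
proof -
  have *: "integrable M (\<lambda>x. - (1 / Im z) * Im ((1 + complex_of_real x * z) / (z - complex_of_real x)))"
    by (intro integrable_mult_right integrable_Im integrable_pick_kernel z)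
  have inv: "- (1 / Im z) * (- Im z * k) = k" for k using z by simp
  from * show ?thesis by (simp only: pick_kernel_Im inv)
qed

text \<open>
  A single value of the transform controls the mass of the representing measure: the Poisson
  kernel, weighted by \<open>1 + x\<^sup>2\<close>, is bounded below.
\<close>

lemma (in finite_borel_measure) mass_le_Im_pick_function:
  assumes z: "0 < Im z"
  shows "Im z * measure M UNIV \<le> 2 * (1 + (norm z)\<^sup>2) * - Im (pick_function \<gamma> M z)"
proof -
  let ?k = "\<lambda>x. (1 + x\<^sup>2) / (norm (z - complex_of_real x))\<^sup>2"
  define c where "c = 2 * (1 + (norm z)\<^sup>2)"
  have c: "c > 0" unfolding c_def by (smt (verit) zero_le_power2)
  have k_ge: "1 / c \<le> ?k x" for x
  proof -
    have "(norm (z - complex_of_real x))\<^sup>2 \<le> (norm z + \<bar>x\<bar>)\<^sup>2"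
      using norm_triangle_ineq4[of z "complex_of_real x"] by (intro power_mono) auto
    also have "\<dots> \<le> 2 * ((norm z)\<^sup>2 + x\<^sup>2)"
      using sum_squares_bound[of "norm z" "\<bar>x\<bar>"] by (simp add: power2_sum)
    also have "\<dots> \<le> c * (1 + x\<^sup>2)" unfolding c_def by (simp add: field_simps)
    finally show ?thesis using c Im_pos_imp_ne_of_real[OF z, of x]
      by (simp add: field_simps)
  qed
  have "(\<integral>x. 1 / c \<partial>M) \<le> (\<integral>x. ?k x \<partial>M)"
    by (rule integral_mono[OF integrable_const integrable_weighted_poisson[OF z]]) (rule k_ge)
  then have "measure M UNIV \<le> c * (\<integral>x. ?k x \<partial>M)"
    using c by (simp add: space_M_UNIV field_simps)
  then have "Im z * measure M UNIV \<le> Im z * (c * (\<integral>x. ?k x \<partial>M))"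
    by (rule mult_left_mono) (use z in simp)
  then show ?thesis unfolding Im_pick_function[OF z] c_def by (simp add: algebra_simps)
qed

section \<open>Weak convergence from convergence of Cauchy transforms\<close>

definition cutoff :: "real \<Rightarrow> real \<Rightarrow> real" where
  "cutoff R x = max 0 (min 1 (R + 1 - \<bar>x\<bar>))"

lemma cutoff_nonneg: "0 \<le> cutoff R x" and cutoff_le_1: "cutoff R x \<le> 1"
  by (auto simp: cutoff_def)

lemma continuous_on_cutoff: "continuous_on S (cutoff R)"
  unfolding cutoff_def by (intro continuous_intros)

lemma cutoff_eq_0: "R + 1 \<le> \<bar>x\<bar> \<Longrightarrow> cutoff R x = 0"
  by (auto simp: cutoff_def)

lemma cutoff_eq_1: "\<bar>x\<bar> \<le> R \<Longrightarrow> cutoff R x = 1"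
  by (auto simp: cutoff_def)

lemma borel_measurable_cutoff[measurable]: "cutoff R \<in> borel_measurable borel"
  by (intro borel_measurable_continuous_onI continuous_on_cutoff)

lemma (in finite_borel_measure) integrable_continuous_bounded:
  fixes g :: "real \<Rightarrow> 'b::{banach, second_countable_topology}"
  assumes "continuous_on UNIV g" "\<And>x. norm (g x) \<le> B"
  shows "integrable M g"
  by (rule integrable_bounded[OF _ assms(2)])
     (intro borel_measurable_continuous_onI assms(1))

lemma (in finite_borel_measure) cutoff_tail_less:
  assumes "0 < e"
  obtains R where "0 \<le> R" "(\<integral>x. 1 - cutoff R x \<partial>M) < e"
proof -
  have "(\<lambda>n. \<integral>x. 1 - cutoff (real n) x \<partial>M) \<longlonglongrightarrow> (\<integral>x. 0 \<partial>M)"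
  proof (rule integral_dominated_convergence[where w = "\<lambda>_. 1"])
    show "AE x in M. (\<lambda>n. 1 - cutoff (real n) x) \<longlonglongrightarrow> 0"
    proof (rule AE_I2)
      fix x
      have "\<forall>\<^sub>F n in sequentially. 1 - cutoff (real n) x = 0"
        using eventually_ge_at_top[of "nat \<lceil>\<bar>x\<bar>\<rceil>"]
        by eventually_elim (subst cutoff_eq_1; linarith)
      then show "(\<lambda>n. 1 - cutoff (real n) x) \<longlonglongrightarrow> 0" by (rule tendsto_eventually)
    qed
    show "AE x in M. norm (1 - cutoff (real n) x) \<le> 1" for n
      using cutoff_nonneg[of "real n"] cutoff_le_1[of "real n"] by (intro AE_I2) (auto simp: abs_le_iff add_increasing2)
    show "(\<lambda>x. 1 - cutoff (real n) x) \<in> borel_measurable M" for n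
      by (intro borel_measurable_M) measurable
  qed auto
  then have "\<forall>\<^sub>F n in sequentially. (\<integral>x. 1 - cutoff (real n) x \<partial>M) < e"
    using assms by (intro order_tendstoD(2)[where y=0]) auto
  then obtain n where "(\<integral>x. 1 - cutoff (real n) x \<partial>M) < e"
    using eventually_happens'[OF sequentially_bot] by blast
  then show thesis using that[of "real n"] by simp
qed

text \<open>
  Vague convergence together with convergence of the total masses is weak convergence: no mass
  can escape to infinity, because the mass outside a large interval is the total mass minus an
  integral of a compactly supported function.
\<close>

lemma weakly_converges_of_compact_support:
  assumes M: "\<And>n. finite_borel_measure (M n)" and N: "finite_borel_measure N"
    and mass: "(\<lambda>n. measure (M n) UNIV) \<longlonglongrightarrow> measure N UNIV"
    and conv: "\<And>g R. \<lbrakk>continuous_on UNIV g; \<And>x. R \<le> \<bar>x\<bar> \<Longrightarrow> g x = 0\<rbrakk> \<Longrightarrow>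
                  (\<lambda>n. \<integral>x. g x \<partial>M n) \<longlonglongrightarrow> (\<integral>x. (g x :: real) \<partial>N)"
  shows "weakly_converges UNIV M N"
  unfolding weakly_converges_def
proof (intro allI impI, elim conjE)
  fix g :: "real \<Rightarrow> real" assume g: "continuous_on UNIV g" and "bounded (range g)"
  then obtain B where B: "\<And>x. \<bar>g x\<bar> \<le> B" and B0: "0 < B"
    unfolding bounded_pos by auto
  have tail_eq: "(\<integral>x. 1 - cutoff R x \<partial>L) = measure L UNIV - (\<integral>x. cutoff R x \<partial>L)"
    if "finite_borel_measure L" for L R
  proof -
    interpret finite_borel_measure L by fact
    have "integrable L (cutoff R)"
      by (rule integrable_continuous_bounded[OF continuous_on_cutoff, of _ 1])
         (use cutoff_nonneg cutoff_le_1 in auto)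
    then show ?thesis by (simp add: Bochner_Integration.integral_diff space_M_UNIV)
  qed
  have split: "\<bar>(\<integral>x. g x \<partial>L) - (\<integral>x. g x * cutoff R x \<partial>L)\<bar> \<le> B * (\<integral>x. 1 - cutoff R x \<partial>L)"
    if "finite_borel_measure L" for L R
  proof -
    interpret finite_borel_measure L by fact
    have gc: "\<bar>g x * cutoff R x\<bar> \<le> B" for x
      using mult_mono[OF B[of x] cutoff_le_1[of R x]] B0 cutoff_nonneg[of R x]
      by (simp add: abs_mult)
    have i1: "integrable L g" by (rule integrable_continuous_bounded[OF g, of B]) (use B in auto)
    have i2: "integrable L (\<lambda>x. g x * cutoff R x)"
      by (rule integrable_continuous_bounded[of _ B])
         (use gc in \<open>auto intro!: continuous_intros g continuous_on_cutoff\<close>)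
    have i3: "integrable L (\<lambda>x. 1 - cutoff R x)"
      by (rule integrable_continuous_bounded[of _ 1])
         (use cutoff_nonneg[of R] cutoff_le_1[of R] in
           \<open>auto intro!: continuous_intros continuous_on_cutoff simp: abs_le_iff add_increasing2\<close>)
    have "\<bar>(\<integral>x. g x \<partial>L) - (\<integral>x. g x * cutoff R x \<partial>L)\<bar> = \<bar>\<integral>x. g x - g x * cutoff R x \<partial>L\<bar>"
      by (simp add: Bochner_Integration.integral_diff i1 i2)
    also have "\<dots> \<le> (\<integral>x. \<bar>g x - g x * cutoff R x\<bar> \<partial>L)"
      by (rule integral_abs_bound)
    also have "\<dots> \<le> (\<integral>x. B * (1 - cutoff R x) \<partial>L)"
    proof (rule integral_mono)
      fix x
      have "\<bar>g x - g x * cutoff R x\<bar> = \<bar>g x\<bar> * (1 - cutoff R x)"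
        using cutoff_le_1[of R x]
        by (metis abs_mult abs_of_nonneg diff_ge_0_iff_ge mult.right_neutral right_diff_distrib)
      then show "\<bar>g x - g x * cutoff R x\<bar> \<le> B * (1 - cutoff R x)"
        using B[of x] cutoff_le_1[of R x] by (simp add: mult_right_mono)
    qed (use i1 i2 i3 in \<open>auto intro!: integrable_abs Bochner_Integration.integrable_diff\<close>)
    finally show ?thesis by simp
  qed
  show "(\<lambda>n. \<integral>x. g x \<partial>M n) \<longlonglongrightarrow> (\<integral>x. g x \<partial>N)"
  proof (rule LIMSEQ_I)
    fix e :: real assume "0 < e"
    define d where "d = e / (4 * B)"
    have d: "d > 0" using \<open>0 < e\<close> B0 by (simp add: d_def)
    have Bd: "B * d = e / 4" using B0 by (simp add: d_def)
    obtain R where R: "0 \<le> R" "(\<integral>x. 1 - cutoff R x \<partial>N) < d"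
      using finite_borel_measure.cutoff_tail_less[OF N d] by blast
    have "(\<lambda>n. \<integral>x. cutoff R x \<partial>M n) \<longlonglongrightarrow> (\<integral>x. cutoff R x \<partial>N)"
      by (rule conv[of _ "R + 1"]) (use continuous_on_cutoff cutoff_eq_0 in auto)
    then have "(\<lambda>n. measure (M n) UNIV - (\<integral>x. cutoff R x \<partial>M n)) \<longlonglongrightarrow> measure N UNIV - (\<integral>x. cutoff R x \<partial>N)"
      by (intro tendsto_diff mass)
    then have tail: "\<forall>\<^sub>F n in sequentially. (\<integral>x. 1 - cutoff R x \<partial>M n) < d"
      unfolding tail_eq[OF M] tail_eq[OF N, symmetric] using R(2) by (rule order_tendstoD)
    have "(\<lambda>n. \<integral>x. g x * cutoff R x \<partial>M n) \<longlonglongrightarrow> (\<integral>x. g x * cutoff R x \<partial>N)"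
      by (rule conv[of _ "R + 1"])
         (use continuous_on_cutoff[of UNIV R] cutoff_eq_0 g in \<open>auto intro!: continuous_intros\<close>)
    then have "\<forall>\<^sub>F n in sequentially. \<bar>(\<integral>x. g x * cutoff R x \<partial>M n) - (\<integral>x. g x * cutoff R x \<partial>N)\<bar> < e / 4"
      using tendstoD[of _ _ _ "e/4"] \<open>0 < e\<close> by (fastforce simp: dist_real_def)
    with tail have "\<forall>\<^sub>F n in sequentially. norm ((\<integral>x. g x \<partial>M n) - (\<integral>x. g x \<partial>N)) < e"
    proof eventually_elim
      case (elim n)
      have "B * (\<integral>x. 1 - cutoff R x \<partial>M n) \<le> e / 4" "B * (\<integral>x. 1 - cutoff R x \<partial>N) \<le> e / 4"
        unfolding Bd[symmetric] using B0 elim(1) R(2) by auto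
      then show ?case using split[OF M, of n R] split[OF N, of R] elim(2) \<open>0 < e\<close>
        unfolding real_norm_def by linarith
    qed
    then show "\<exists>no. \<forall>n\<ge>no. norm ((\<integral>x. g x \<partial>M n) - (\<integral>x. g x \<partial>N)) < e"
      by (simp add: eventually_sequentially)
  qed
qed

text \<open>
  Test functions are smoothed with the Poisson kernel \<open>y / (\<pi> ((x - u)\<^sup>2 + y\<^sup>2))\<close>, which the
  substitution \<open>x = u + y s\<close> turns into the Cauchy density.
\<close>

lemma cauchy_density:
  "integrable lborel (\<lambda>s::real. 1 / (1 + s\<^sup>2))" "(\<integral>s. 1 / (1 + s\<^sup>2) \<partial>lborel) = pi"
  using integrable_inverse_1_plus_square LBINT_inverse_1_plus_square
  by (simp_all add: set_integrable_def set_lebesgue_integral_def interval_lebesgue_integral_def inverse_eq_divide)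

lemma poisson_integral_rescale:
  fixes g :: "real \<Rightarrow> real"
  assumes "0 < y"
  shows "(\<integral>x. g x * (y / ((x - u)\<^sup>2 + y\<^sup>2)) \<partial>lborel) = (\<integral>s. g (u + y * s) * (1 / (1 + s\<^sup>2)) \<partial>lborel)"
proof -
  have "(\<integral>x. g x * (y / ((x - u)\<^sup>2 + y\<^sup>2)) \<partial>lborel) =
        \<bar>y\<bar> *\<^sub>R (\<integral>s. g (u + y * s) * (y / ((u + y * s - u)\<^sup>2 + y\<^sup>2)) \<partial>lborel)"
    by (rule lborel_integral_real_affine) (use assms in auto)
  also have "\<dots> = (\<integral>s. y * (g (u + y * s) * (y / ((u + y * s - u)\<^sup>2 + y\<^sup>2))) \<partial>lborel)"
    using assms by (simp only: integral_mult_right_zero real_scaleR_def abs_of_pos)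
  also have "\<dots> = (\<integral>s. g (u + y * s) * (1 / (1 + s\<^sup>2)) \<partial>lborel)"
  proof (rule Bochner_Integration.integral_cong)
    fix s
    have "(u + y * s - u)\<^sup>2 + y\<^sup>2 = y * y * (1 + s\<^sup>2)" by (simp add: power2_eq_square algebra_simps)
    then show "y * (g (u + y * s) * (y / ((u + y * s - u)\<^sup>2 + y\<^sup>2))) = g (u + y * s) * (1 / (1 + s\<^sup>2))"
      using assms by simp
  qed simp
  finally show ?thesis .
qed

text \<open>
  After rescaling, the error is the mean of \<open>g(u + y s) - g(u)\<close> against a fixed density:
  uniform continuity handles \<open>\<bar>y s\<bar> < d\<close>, and the remaining \<open>s\<close> carry little mass for small \<open>y\<close>.
\<close>

lemma poisson_approximation:
  fixes g :: "real \<Rightarrow> real"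
  assumes g: "uniformly_continuous_on UNIV g" and B: "\<And>x. \<bar>g x\<bar> \<le> B" and "0 < e"
  obtains y where "0 < y" "y < 1"
    "\<And>u. \<bar>(\<integral>x. g x * (y / ((x - u)\<^sup>2 + y\<^sup>2)) \<partial>lborel) / pi - g u\<bar> \<le> e"
proof -
  have g_osc: "\<bar>g a - g b\<bar> \<le> 2 * B" for a b using B[of a] B[of b] by linarith
  have g_meas[measurable]: "g \<in> borel_measurable borel"
    by (intro borel_measurable_continuous_onI uniformly_continuous_imp_continuous g)
  obtain d where d: "d > 0" "\<And>x x'. dist x' x < d \<Longrightarrow> dist (g x') (g x) < e / 2"
    using g[unfolded uniformly_continuous_on_def, rule_format, of "e/2"] \<open>0 < e\<close> by auto
  define T where "T = (\<lambda>n::nat. \<integral>s. indicator {s. d * real n \<le> \<bar>s\<bar>} s * (1 / (1 + s\<^sup>2)) \<partial>lborel)"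
  have "T \<longlonglongrightarrow> (\<integral>(s::real). 0 \<partial>lborel)"
    unfolding T_def
  proof (rule integral_dominated_convergence[where w = "\<lambda>s. 1 / (1 + s\<^sup>2)"])
    show "AE s in lborel. (\<lambda>n. indicator {s. d * real n \<le> \<bar>s\<bar>} s * (1 / (1 + s\<^sup>2))) \<longlonglongrightarrow> 0"
    proof (rule AE_I2)
      fix s :: real
      have "\<forall>\<^sub>F n in sequentially. real n > \<bar>s\<bar> / d"
        using filterlim_real_sequentially by (simp add: filterlim_at_top_dense)
      then have "\<forall>\<^sub>F n in sequentially. indicator {s. d * real n \<le> \<bar>s\<bar>} s * (1 / (1 + s\<^sup>2)) = 0"
        by eventually_elim (use d(1) in \<open>auto simp: field_simps split: split_indicator\<close>)
      then show "(\<lambda>n. indicator {s. d * real n \<le> \<bar>s\<bar>} s * (1 / (1 + s\<^sup>2))) \<longlonglongrightarrow> 0"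
        by (rule tendsto_eventually)
    qed
  qed (auto simp: cauchy_density intro!: AE_I2 split: split_indicator)
  then have "\<forall>\<^sub>F n in sequentially. 2 * B * T n < e / 2 * pi"
    using \<open>0 < e\<close> by (intro order_tendstoD(2)[where y = "2 * B * 0"] tendsto_intros) auto
  moreover have "\<forall>\<^sub>F n in sequentially. n > (1::nat)"
    by (rule eventually_gt_at_top)
  ultimately have "\<forall>\<^sub>F n in sequentially. 2 * B * T n < e / 2 * pi \<and> n > (1::nat)"
    by (rule eventually_conj)
  then obtain n where n: "2 * B * T n < e / 2 * pi" "n > (1::nat)"
    using eventually_happens'[OF sequentially_bot] by blast
  \<comment> \<open>With \<open>y = 1 / n\<close> the condition \<open>\<bar>y s\<bar> < d\<close> reads \<open>\<bar>s\<bar> < d n\<close>, so \<open>T n\<close> is the mass it leaves out.\<close>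
  define y where "y = 1 / real n"
  have y: "0 < y" "y < 1" using n(2) by (auto simp: y_def)
  have "\<bar>(\<integral>x. g x * (y / ((x - u)\<^sup>2 + y\<^sup>2)) \<partial>lborel) / pi - g u\<bar> \<le> e" for u
  proof -
    have int: "integrable lborel (\<lambda>s. h s * (1 / (1 + s\<^sup>2)))"
      if "h \<in> borel_measurable borel" "\<And>s. \<bar>h s\<bar> \<le> C" for h :: "real \<Rightarrow> real" and C
    proof (rule Bochner_Integration.integrable_bound[of _ "\<lambda>s. C * (1 / (1 + s\<^sup>2))"])
      show "AE s in lborel. norm (h s * (1 / (1 + s\<^sup>2))) \<le> norm (C * (1 / (1 + s\<^sup>2)))"
      proof (rule AE_I2)
        fix s :: real
        have "\<bar>h s\<bar> * (1 / (1 + s\<^sup>2)) \<le> \<bar>C\<bar> * (1 / (1 + s\<^sup>2))"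
          using that(2)[of s] by (intro mult_right_mono) auto
        then show "norm (h s * (1 / (1 + s\<^sup>2))) \<le> norm (C * (1 / (1 + s\<^sup>2)))"
          by (simp add: abs_mult)
      qed
      show "integrable lborel (\<lambda>s. C * (1 / (1 + s\<^sup>2)))"
        by (intro integrable_mult_right cauchy_density)
    qed (use that(1) in measurable)
    have i1: "integrable lborel (\<lambda>s. g (u + y * s) * (1 / (1 + s\<^sup>2)))"
      by (rule int[of _ B]) (use B in auto)
    have i2: "integrable lborel (\<lambda>s. g u * (1 / (1 + s\<^sup>2)))"
      by (rule int[of _ B]) (use B in auto)
    have i3: "integrable lborel (\<lambda>s. indicator {s. d * real n \<le> \<bar>s\<bar>} s * (1 / (1 + s\<^sup>2)))"
      by (rule int[of _ 1]) (auto split: split_indicator)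
    have "(\<integral>x. g x * (y / ((x - u)\<^sup>2 + y\<^sup>2)) \<partial>lborel) - g u * pi =
          (\<integral>s. g (u + y * s) * (1 / (1 + s\<^sup>2)) \<partial>lborel) - (\<integral>s. g u * (1 / (1 + s\<^sup>2)) \<partial>lborel)"
      unfolding poisson_integral_rescale[OF y(1)] using cauchy_density(2)
      by (simp only: integral_mult_right_zero)
    also have "\<dots> = (\<integral>s. g (u + y * s) * (1 / (1 + s\<^sup>2)) - g u * (1 / (1 + s\<^sup>2)) \<partial>lborel)"
      by (rule Bochner_Integration.integral_diff[OF i1 i2, symmetric])
    also have "\<dots> = (\<integral>s. (g (u + y * s) - g u) * (1 / (1 + s\<^sup>2)) \<partial>lborel)"
      by (simp only: left_diff_distrib)
    finally have "\<bar>(\<integral>x. g x * (y / ((x - u)\<^sup>2 + y\<^sup>2)) \<partial>lborel) - g u * pi\<bar> \<le>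
        (\<integral>s. \<bar>(g (u + y * s) - g u) * (1 / (1 + s\<^sup>2))\<bar> \<partial>lborel)"
      by (simp only: integral_abs_bound)
    also have "\<dots> \<le> (\<integral>s. e / 2 * (1 / (1 + s\<^sup>2)) + 2 * B * (indicator {s. d * real n \<le> \<bar>s\<bar>} s * (1 / (1 + s\<^sup>2))) \<partial>lborel)"
    proof (rule integral_mono)
      show "integrable lborel (\<lambda>s. \<bar>(g (u + y * s) - g u) * (1 / (1 + s\<^sup>2))\<bar>)"
        by (rule integrable_abs, rule int[of _ "2 * B", OF _ g_osc]) measurable
      show "integrable lborel (\<lambda>s. e / 2 * (1 / (1 + s\<^sup>2)) + 2 * B * (indicator {s. d * real n \<le> \<bar>s\<bar>} s * (1 / (1 + s\<^sup>2))))"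
        by (rule Bochner_Integration.integrable_add[OF integrable_mult_right integrable_mult_right,
                   OF cauchy_density(1) i3])
      fix s
      have "\<bar>g (u + y * s) - g u\<bar> \<le> e / 2 + 2 * B * indicator {s. d * real n \<le> \<bar>s\<bar>} s"
      proof (cases "d * real n \<le> \<bar>s\<bar>")
        case True
        then show ?thesis using B[of "u + y * s"] B[of u] \<open>0 < e\<close> by auto
      next
        case False
        then have "\<bar>y * s\<bar> < d" using n(2) by (simp add: y_def abs_mult field_simps)
        then show ?thesis using d(2)[of "u + y * s" u] False by (simp add: dist_real_def)
      qed
      moreover have dens: "\<bar>1 / (1 + s\<^sup>2)\<bar> = 1 / (1 + s\<^sup>2)" by simp
      ultimately have "\<bar>g (u + y * s) - g u\<bar> * (1 / (1 + s\<^sup>2)) \<le>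
          (e / 2 + 2 * B * indicator {s. d * real n \<le> \<bar>s\<bar>} s) * (1 / (1 + s\<^sup>2))"
        by (intro mult_right_mono) auto
      then show "\<bar>(g (u + y * s) - g u) * (1 / (1 + s\<^sup>2))\<bar> \<le>
          e / 2 * (1 / (1 + s\<^sup>2)) + 2 * B * (indicator {s. d * real n \<le> \<bar>s\<bar>} s * (1 / (1 + s\<^sup>2)))"
        by (simp only: abs_mult dens distrib_right mult.assoc)
    qed
    also have "\<dots> = e / 2 * pi + 2 * B * T n"
      unfolding T_def
      by (subst Bochner_Integration.integral_add[OF integrable_mult_right integrable_mult_right, OF cauchy_density(1) i3])
         (simp only: integral_mult_right_zero cauchy_density(2))
    also have "\<dots> \<le> e * pi" using n(1) by simp
    finally have "\<bar>(\<integral>x. g x * (y / ((x - u)\<^sup>2 + y\<^sup>2)) \<partial>lborel) - g u * pi\<bar> / pi \<le> e"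
      by (simp add: pos_divide_le_eq)
    moreover have "(\<integral>x. g x * (y / ((x - u)\<^sup>2 + y\<^sup>2)) \<partial>lborel) / pi - g u =
       ((\<integral>x. g x * (y / ((x - u)\<^sup>2 + y\<^sup>2)) \<partial>lborel) - g u * pi) / pi"
      by (simp add: diff_divide_distrib)
    ultimately show ?thesis by (simp only: abs_divide) simp
  qed
  then show thesis using that y by blast
qed

text \<open>
  The smoothed integral \<open>\<integral> P\<^sub>y g dM\<close> is, by Fubini, an integral of \<open>Im G\<close> along the
  horizontal line at height \<open>y\<close>.
\<close>

lemma (in finite_borel_measure) integral_poisson_eq:
  fixes g :: "real \<Rightarrow> real"
  assumes g: "continuous_on UNIV g" and B: "\<And>x. \<bar>g x\<bar> \<le> B" and supp: "\<And>x. R \<le> \<bar>x\<bar> \<Longrightarrow> g x = 0"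
    and y: "0 < y"
  shows "(\<integral>u. (\<integral>x. g x * (y / ((x - u)\<^sup>2 + y\<^sup>2)) \<partial>lborel) \<partial>M) =
         (\<integral>x. g x * - Im (cauchy_transform M (Complex x y)) \<partial>lborel)"
    (is ?eq)
    and "integrable M (\<lambda>u. \<integral>x. g x * (y / ((x - u)\<^sup>2 + y\<^sup>2)) \<partial>lborel)" (is ?int)
proof -
  have [measurable]: "g \<in> borel_measurable borel"
    by (intro borel_measurable_continuous_onI g)
  have [measurable_cong]: "sets M = sets borel" by (rule M_is_borel)
  interpret P: pair_sigma_finite lborel M
    by (intro pair_sigma_finite.intro sigma_finite_measure_axioms lborel.sigma_finite_measure_axioms)
  have k_le: "y / ((x - u)\<^sup>2 + y\<^sup>2) \<le> 1 / y" for x u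
  proof -
    have "y / ((x - u)\<^sup>2 + y\<^sup>2) \<le> y / y\<^sup>2"
      using y by (intro divide_left_mono) (auto intro!: mult_pos_pos add_nonneg_pos)
    then show ?thesis using y by (simp add: power2_eq_square)
  qed
  have k_nn: "0 \<le> y / ((x - u)\<^sup>2 + y\<^sup>2)" for x u using y by simp
  have "integrable (lborel \<Otimes>\<^sub>M M) (\<lambda>(x, u). g x * (y / ((x - u)\<^sup>2 + y\<^sup>2)))"
  proof (rule Bochner_Integration.integrable_bound)
    show "integrable (lborel \<Otimes>\<^sub>M M) (\<lambda>p. (B / y) * indicator ({- \<bar>R\<bar>..\<bar>R\<bar>} \<times> UNIV) p :: real)"
    proof (intro integrable_mult_right integrable_real_indicator)
      show "{- \<bar>R\<bar>..\<bar>R\<bar>} \<times> UNIV \<in> sets (lborel \<Otimes>\<^sub>M M)" by measurable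
      have "emeasure (lborel \<Otimes>\<^sub>M M) ({- \<bar>R\<bar>..\<bar>R\<bar>} \<times> UNIV) = emeasure lborel {- \<bar>R\<bar>..\<bar>R\<bar>} * emeasure M UNIV"
        by (rule emeasure_pair_measure_Times) (auto simp: M_is_borel)
      also have "\<dots> < \<infinity>"
        using emeasure_finite[of UNIV] by (simp add: less_top[symmetric] ennreal_mult_eq_top_iff)
      finally show "emeasure (lborel \<Otimes>\<^sub>M M) ({- \<bar>R\<bar>..\<bar>R\<bar>} \<times> UNIV) < \<infinity>" .
    qed
    have "\<bar>g x * (y / ((x - u)\<^sup>2 + y\<^sup>2))\<bar> \<le> B / y * indicator ({- \<bar>R\<bar>..\<bar>R\<bar>} \<times> UNIV) (x, u)" for x u
    proof (cases "\<bar>x\<bar> \<le> \<bar>R\<bar>")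
      case True
      have "\<bar>g x\<bar> * (y / ((x - u)\<^sup>2 + y\<^sup>2)) \<le> B * (1 / y)"
        using B[of x] k_le k_nn by (intro mult_mono) auto
      then show ?thesis using True k_nn[of x u] by (simp only: abs_mult abs_of_nonneg) (auto simp: indicator_def)
    next
      case False
      then show ?thesis using supp[of x] by (auto simp: indicator_def)
    qed
    note bd = this[of "fst p" "snd p" for p]
    show "AE p in lborel \<Otimes>\<^sub>M M. norm (case p of (x, u) \<Rightarrow> g x * (y / ((x - u)\<^sup>2 + y\<^sup>2))) \<le>
        norm (B / y * indicator ({- \<bar>R\<bar>..\<bar>R\<bar>} \<times> UNIV) p :: real)"
      using order_trans[OF bd abs_ge_self]
      by (intro AE_I2) (simp only: real_norm_def split_beta prod.collapse)
  qed measurable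
  note int = this
  have "(\<integral>u. (\<integral>x. g x * (y / ((x - u)\<^sup>2 + y\<^sup>2)) \<partial>lborel) \<partial>M) =
        (\<integral>x. (\<integral>u. g x * (y / ((x - u)\<^sup>2 + y\<^sup>2)) \<partial>M) \<partial>lborel)"
    by (rule P.Fubini_integral[OF int])
  also have "\<dots> = (\<integral>x. g x * - Im (cauchy_transform M (Complex x y)) \<partial>lborel)"
  proof (rule Bochner_Integration.integral_cong)
    fix x
    have "- Im (cauchy_transform M (Complex x y)) =
        y * (\<integral>u. 1 / (norm (Complex x y - complex_of_real u))\<^sup>2 \<partial>M)"
      using y by (subst Im_cauchy_transform) auto
    also have "\<dots> = (\<integral>u. y * (1 / (norm (Complex x y - complex_of_real u))\<^sup>2) \<partial>M)"
      by (rule integral_mult_right_zero[symmetric])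
    also have "\<dots> = (\<integral>u. y / ((x - u)\<^sup>2 + y\<^sup>2) \<partial>M)"
      by (simp add: cmod_def)
    finally show "(\<integral>u. g x * (y / ((x - u)\<^sup>2 + y\<^sup>2)) \<partial>M) = g x * - Im (cauchy_transform M (Complex x y))"
      by (simp only: integral_mult_right_zero)
  qed simp
  finally show ?eq .
  show ?int using P.integrable_snd[OF int] by simp
qed

text \<open>
  A compactly supported test function is uniformly close to its Poisson smoothing, and the
  integral of the smoothing is one of \<open>Im G\<close> along a horizontal segment, where dominated
  convergence applies. Bounded masses make the first error uniform in \<open>n\<close>.
\<close>

theorem weakly_converges_if_cauchy_transform_converges:
  assumes M: "\<And>n. finite_borel_measure (M n)" and N: "finite_borel_measure N"
    and mass: "(\<lambda>n. measure (M n) UNIV) \<longlonglongrightarrow> measure N UNIV"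
    and conv: "\<And>z. 0 < Im z \<Longrightarrow> Im z < 1 \<Longrightarrow>
                 (\<lambda>n. cauchy_transform (M n) z) \<longlonglongrightarrow> cauchy_transform N z"
  shows "weakly_converges UNIV M N"
proof (rule weakly_converges_of_compact_support[OF M N mass])
  fix g :: "real \<Rightarrow> real" and R
  assume g: "continuous_on UNIV g" and supp: "\<And>x. R \<le> \<bar>x\<bar> \<Longrightarrow> g x = 0"
  \<comment> \<open>A margin of \<open>1\<close> around the support: of two points at distance less than \<open>1\<close>, one of them
    outside \<open>K\<close>, both lie outside the support.\<close>
  define K where "K = {- \<bar>R\<bar> - 1..\<bar>R\<bar> + 1}"
  have ucK: "uniformly_continuous_on K g"
    unfolding K_def by (intro compact_uniformly_continuous compact_Icc continuous_on_subset[OF g]) auto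
  have uc: "uniformly_continuous_on UNIV g"
    unfolding uniformly_continuous_on_def
  proof (intro allI impI)
    fix e :: real assume "0 < e"
    with ucK obtain d where d: "d > 0" "\<And>x x'. x \<in> K \<Longrightarrow> x' \<in> K \<Longrightarrow> dist x' x < d \<Longrightarrow> dist (g x') (g x) < e"
      unfolding uniformly_continuous_on_def by meson
    have "dist (g x') (g x) < e" if "dist x' x < min d 1" for x x'
    proof (cases "x \<in> K \<and> x' \<in> K")
      case True then show ?thesis using d that by auto
    next
      case False
      then have "\<not> (\<bar>x\<bar> \<le> \<bar>R\<bar> + 1 \<and> \<bar>x'\<bar> \<le> \<bar>R\<bar> + 1)"
        unfolding K_def by (simp add: abs_le_iff) linarith
      moreover have "\<bar>\<bar>x'\<bar> - \<bar>x\<bar>\<bar> < 1"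
        using that abs_triangle_ineq3[of x' x] by (simp add: dist_real_def)
      ultimately have "R \<le> \<bar>x\<bar>" "R \<le> \<bar>x'\<bar>" by linarith+
      then show ?thesis using supp[of x] supp[of x'] \<open>0 < e\<close> by simp
    qed
    then show "\<exists>d>0. \<forall>x\<in>UNIV. \<forall>x'\<in>UNIV. dist x' x < d \<longrightarrow> dist (g x') (g x) < e"
      using d(1) by (intro exI[of _ "min d 1"]) auto
  qed
  have "bounded (g ` K)"
    unfolding K_def by (intro compact_imp_bounded compact_continuous_image continuous_on_subset[OF g]) auto
  then obtain B where B: "\<And>x. x \<in> K \<Longrightarrow> \<bar>g x\<bar> \<le> B" "0 < B"
    unfolding bounded_pos by auto
  have B: "\<bar>g x\<bar> \<le> B" for x
  proof (cases "x \<in> K")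
    case False
    then have "R \<le> \<bar>x\<bar>" unfolding K_def by (auto simp: abs_if split: if_splits)
    then show ?thesis using supp[of x] B(2) by simp
  qed (use B in auto)
  have [measurable]: "g \<in> borel_measurable borel"
    by (intro borel_measurable_continuous_onI g)
  obtain C where C: "\<And>n. measure (M n) UNIV \<le> C"
  proof -
    have "Bseq (\<lambda>n. measure (M n) UNIV)"
      using mass by (intro convergent_imp_Bseq convergentI)
    then show thesis using that unfolding Bseq_def by fastforce
  qed
  have C0: "0 \<le> C" using C[of 0] measure_nonneg order_trans by blast
  define P where "P = (\<lambda>y u. (\<integral>x. g x * (y / ((x - u)\<^sup>2 + y\<^sup>2)) \<partial>lborel) / pi)"
  have P_close: "\<bar>(\<integral>u. P y u \<partial>L) - (\<integral>u. g u \<partial>L)\<bar> \<le> e * measure L UNIV"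
    if "finite_borel_measure L" "0 < y" "\<And>u. \<bar>P y u - g u\<bar> \<le> e" for L y e
  proof -
    interpret finite_borel_measure L by fact
    have i1: "integrable L (P y)" unfolding P_def
      by (intro integrable_divide_zero integral_poisson_eq(2)[OF g B supp]) (use that in auto)
    have i2: "integrable L g" by (rule integrable_bounded[of _ B]) (use B in auto)
    have "(\<integral>u. P y u \<partial>L) - (\<integral>u. g u \<partial>L) = (\<integral>u. P y u - g u \<partial>L)"
      by (rule Bochner_Integration.integral_diff[symmetric]) fact+
    then have "\<bar>(\<integral>u. P y u \<partial>L) - (\<integral>u. g u \<partial>L)\<bar> \<le> (\<integral>u. \<bar>P y u - g u\<bar> \<partial>L)"
      by (simp only: integral_abs_bound)
    also have "\<dots> \<le> (\<integral>u. e \<partial>L)"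
      by (intro integral_mono integrable_abs Bochner_Integration.integrable_diff i1 i2 integrable_const that(3))
    finally show ?thesis by (simp add: space_M_UNIV mult.commute)
  qed
  have P_conv: "(\<lambda>n. \<integral>u. P y u \<partial>M n) \<longlonglongrightarrow> (\<integral>u. P y u \<partial>N)" if y: "0 < y" "y < 1" for y
  proof -
    have eq: "(\<integral>u. P y u \<partial>L) = (\<integral>x. g x * - Im (cauchy_transform L (Complex x y)) \<partial>lborel) / pi"
      if "finite_borel_measure L" for L
      unfolding P_def
      by (simp only: integral_divide_zero finite_borel_measure.integral_poisson_eq(1)[OF that g B supp y(1)])
    have meas: "(\<lambda>x. g x * - Im (cauchy_transform L (Complex x y))) \<in> borel_measurable lborel" if "finite_borel_measure L" for L
    proof -
      have c: "continuous_on upper_half_plane (cauchy_transform L)"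
        by (intro holomorphic_on_imp_continuous_on finite_borel_measure.holomorphic_cauchy_transform that)
      have "continuous_on UNIV (\<lambda>x. Complex x y)"
        unfolding Complex_eq by (intro continuous_intros)
      from continuous_on_compose2[OF c this] have "continuous_on UNIV (\<lambda>x. cauchy_transform L (Complex x y))"
        using y by (auto simp: upper_half_plane_def image_subset_iff)
      then have "continuous_on UNIV (\<lambda>x. g x * - Im (cauchy_transform L (Complex x y)))"
        by (intro continuous_intros g)
      from borel_measurable_continuous_onI[OF this] show ?thesis by simp
    qed
    have "(\<lambda>n. \<integral>x. g x * - Im (cauchy_transform (M n) (Complex x y)) \<partial>lborel) \<longlonglongrightarrow>
          (\<integral>x. g x * - Im (cauchy_transform N (Complex x y)) \<partial>lborel)"
    proof (rule integral_dominated_convergence[where w = "\<lambda>x. B * (C / y) * indicator K x"])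
      show "integrable lborel (\<lambda>x. B * (C / y) * indicator K x)"
        unfolding K_def by (intro integrable_mult_right integrable_real_indicator) auto
      show "AE x in lborel. (\<lambda>n. g x * - Im (cauchy_transform (M n) (Complex x y))) \<longlonglongrightarrow>
          g x * - Im (cauchy_transform N (Complex x y))"
        using y by (intro AE_I2 tendsto_intros conv) auto
      have "\<bar>g x * - Im (cauchy_transform (M n) (Complex x y))\<bar> \<le> B * (C / y) * indicator K x" for x n
      proof (cases "x \<in> K")
        case True
        have "\<bar>Im (cauchy_transform (M n) (Complex x y))\<bar> \<le> norm (cauchy_transform (M n) (Complex x y))"
          by (rule abs_Im_le_cmod)
        also have "\<dots> \<le> measure (M n) UNIV / y"
          using finite_borel_measure.norm_cauchy_transform_le[OF M, of "Complex x y" n] y by simp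
        also have "\<dots> \<le> C / y" using C y by (intro divide_right_mono) auto
        finally have "\<bar>g x\<bar> * \<bar>Im (cauchy_transform (M n) (Complex x y))\<bar> \<le> B * (C / y)"
          using B[of x] by (intro mult_mono) auto
        then show ?thesis using True by (simp add: abs_mult)
      next
        case False
        then have "R \<le> \<bar>x\<bar>" unfolding K_def by (auto simp: abs_if split: if_splits)
        then show ?thesis using supp[of x] False by simp
      qed
      then show "AE x in lborel. norm (g x * - Im (cauchy_transform (M n) (Complex x y))) \<le> B * (C / y) * indicator K x" for n
        by (intro AE_I2) simp
    qed (fact meas[OF N], fact meas[OF M])
    then show ?thesis unfolding eq[OF M] eq[OF N] by (intro tendsto_intros) auto
  qed
  show "(\<lambda>n. \<integral>x. g x \<partial>M n) \<longlonglongrightarrow> (\<integral>x. g x \<partial>N)"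
  proof (rule LIMSEQ_I)
    fix e :: real assume e: "0 < e"
    define D where "D = max C (measure N UNIV) + 1"
    have D: "D > 0" "C \<le> D" "measure N UNIV \<le> D" using C0 unfolding D_def by auto
    define e' where "e' = e / (4 * D)"
    have e': "e' > 0" and e'D: "e' * D = e / 4" using D e by (auto simp: e'_def)
    obtain y where y: "0 < y" "y < 1" "\<And>u. \<bar>P y u - g u\<bar> \<le> e'"
      using poisson_approximation[OF uc B e'] unfolding P_def by blast
    have "\<forall>\<^sub>F n in sequentially. \<bar>(\<integral>u. P y u \<partial>M n) - (\<integral>u. P y u \<partial>N)\<bar> < e / 4"
      using tendstoD[OF P_conv[OF y(1,2)], of "e/4"] e by (simp add: dist_real_def)
    then have "\<forall>\<^sub>F n in sequentially. norm ((\<integral>x. g x \<partial>M n) - (\<integral>x. g x \<partial>N)) < e"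
    proof eventually_elim
      case (elim n)
      have "e' * measure (M n) UNIV \<le> e / 4" "e' * measure N UNIV \<le> e / 4"
        unfolding e'D[symmetric] using e' C[of n] D by (auto intro!: mult_left_mono)
      then show ?case using P_close[OF M y(1,3), of n] P_close[OF N y(1,3)] elim e
        unfolding real_norm_def by linarith
    qed
    then show "\<exists>no. \<forall>n\<ge>no. norm ((\<integral>x. g x \<partial>M n) - (\<integral>x. g x \<partial>N)) < e"
      by (simp add: eventually_sequentially)
  qed
qed

section \<open>Pick functions and generating pairs\<close>

lemma not_tendsto_subseq:
  fixes f :: "nat \<Rightarrow> 'a::metric_space"
  assumes "\<not> f \<longlonglongrightarrow> l"
  obtains e and r :: "nat \<Rightarrow> nat" where "0 < e" "strict_mono r" "\<And>n. e \<le> dist (f (r n)) l"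
proof -
  from assms obtain e where e: "0 < e" "\<not> (\<forall>\<^sub>F n in sequentially. dist (f n) l < e)"
    unfolding tendsto_iff by blast
  then have "\<forall>m. \<exists>n\<ge>m. \<not> dist (f n) l < e"
    unfolding eventually_sequentially by blast
  then have "infinite {n. \<not> dist (f n) l < e}"
    unfolding infinite_nat_iff_unbounded_le by simp
  then obtain r :: "nat \<Rightarrow> nat" where "strict_mono r" "\<And>n. r n \<in> {n. \<not> dist (f n) l < e}"
    using infinite_enumerate by blast
  then show thesis using that[of e r] e(1) by (auto simp: not_less)
qed

text \<open>
  By Montel's theorem every subsequence has a further subsequence converging on all of \<open>S\<close>;
  its limit agrees with \<open>g\<close> on \<open>A\<close>, hence on \<open>S\<close>.
\<close>

lemma Vitali_convergence:
  assumes S: "open S" "connected S"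
    and f: "\<And>n. f n holomorphic_on S" and g: "g holomorphic_on S"
    and bounded: "\<And>K. compact K \<Longrightarrow> K \<subseteq> S \<Longrightarrow> \<exists>B. \<forall>n. \<forall>z\<in>K. norm (f n z) \<le> B"
    and A: "A \<subseteq> S" "\<xi> \<in> S" "\<xi> islimpt A"
    and conv: "\<And>z. z \<in> A \<Longrightarrow> (\<lambda>n. f n z) \<longlonglongrightarrow> g z"
    and z: "z \<in> S"
  shows "(\<lambda>n. f n z) \<longlonglongrightarrow> (g z :: complex)"
proof (rule ccontr)
  assume "\<not> (\<lambda>n. f n z) \<longlonglongrightarrow> g z"
  then obtain e r where e: "0 < e" and r: "strict_mono (r :: nat \<Rightarrow> nat)"
    and far: "\<And>n. e \<le> dist (f (r n) z) (g z)"
    by (rule not_tendsto_subseq) blast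
  obtain h k where h: "h holomorphic_on S" and k: "strict_mono (k :: nat \<Rightarrow> nat)"
    and lim: "\<And>x. x \<in> S \<Longrightarrow> (\<lambda>n. (f \<circ> r) (k n) x) \<longlonglongrightarrow> h x"
  proof (rule Montel[where S = S and \<H> = "range f" and \<F> = "f \<circ> r"])
    show "open S" by (rule S)
    show "\<And>h. h \<in> range f \<Longrightarrow> h holomorphic_on S" using f by blast
    show "\<exists>B. \<forall>h\<in>range f. \<forall>z\<in>K. cmod (h z) \<le> B" if "compact K" "K \<subseteq> S" for K
      using bounded[OF that] by simp
    show "range (f \<circ> r) \<subseteq> range f" by auto
  qed blast
  have rk: "strict_mono (r \<circ> k)" using r k by (rule strict_mono_o)
  have "h z - g z = 0"
  proof (rule analytic_continuation[of "\<lambda>w. h w - g w" S A \<xi>])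
    show "(\<lambda>w. h w - g w) holomorphic_on S" by (intro holomorphic_intros h g)
    fix w assume w: "w \<in> A"
    then have "(\<lambda>n. f (r (k n)) w) \<longlonglongrightarrow> g w"
      using LIMSEQ_subseq_LIMSEQ[OF conv rk] by (simp add: o_def)
    moreover have "(\<lambda>n. f (r (k n)) w) \<longlonglongrightarrow> h w" using lim[of w] w A(1) by auto
    ultimately have "g w = h w" by (rule LIMSEQ_unique)
    then show "h w - g w = 0" by simp
  qed (use S A z in auto)
  then have "(\<lambda>n. f (r (k n)) z) \<longlonglongrightarrow> g z" using lim[OF z] by simp
  then have "\<forall>\<^sub>F n in sequentially. dist (f (r (k n)) z) (g z) < e"
    using e by (rule tendstoD)
  then obtain n where "dist (f (r (k n)) z) (g z) < e"
    using eventually_happens'[OF sequentially_bot] by blast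
  with far[of "k n"] show False by simp
qed

lemma weakly_converges_mass:
  assumes "weakly_converges UNIV M N" "\<And>n. finite_borel_measure (M n)" "finite_borel_measure N"
  shows "(\<lambda>n. measure (M n) UNIV) \<longlonglongrightarrow> measure N UNIV"
proof -
  have "(\<lambda>n. \<integral>x. 1 \<partial>M n) \<longlonglongrightarrow> (\<integral>x. (1::real) \<partial>N)"
    using assms(1) unfolding weakly_converges_def by (auto intro!: continuous_intros)
  then show ?thesis
    using assms(2,3) finite_borel_measure.space_M_UNIV by simp
qed

lemma Re_cauchy_transform_integral:
  assumes "finite_borel_measure L" "0 < Im z"
  shows "Re (cauchy_transform L z) = (\<integral>x. Re (1 / (z - complex_of_real x)) \<partial>L)"
  unfolding cauchy_transform_def
  by (rule integral_Re[symmetric]) (rule finite_borel_measure.integrable_resolvent[OF assms])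

lemma Im_cauchy_transform_integral:
  assumes "finite_borel_measure L" "0 < Im z"
  shows "Im (cauchy_transform L z) = (\<integral>x. Im (1 / (z - complex_of_real x)) \<partial>L)"
  unfolding cauchy_transform_def
  by (rule integral_Im[symmetric]) (rule finite_borel_measure.integrable_resolvent[OF assms])

lemma weakly_converges_cauchy_transform:
  assumes wc: "weakly_converges UNIV M N"
    and M: "\<And>n. finite_borel_measure (M n)" and N: "finite_borel_measure N" and z: "0 < Im z"
  shows "(\<lambda>n. cauchy_transform (M n) z) \<longlonglongrightarrow> cauchy_transform N z"
proof -
  have cont: "continuous_on UNIV (\<lambda>x. 1 / (z - complex_of_real x))"
    by (intro continuous_intros) (use Im_pos_imp_ne_of_real[OF z] in auto)
  have "bounded (range (\<lambda>x. Re (1 / (z - complex_of_real x))))"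
    unfolding bounded_iff
    using order_trans[OF abs_Re_le_cmod norm_resolvent_le[OF z]] by auto
  then have "(\<lambda>n. \<integral>x. Re (1 / (z - complex_of_real x)) \<partial>M n) \<longlonglongrightarrow>
                (\<integral>x. Re (1 / (z - complex_of_real x)) \<partial>N)"
    using wc continuous_on_Re[OF cont] unfolding weakly_converges_def by simp
  moreover have "bounded (range (\<lambda>x. Im (1 / (z - complex_of_real x))))"
    unfolding bounded_iff
    using order_trans[OF abs_Im_le_cmod norm_resolvent_le[OF z]] by auto
  then have "(\<lambda>n. \<integral>x. Im (1 / (z - complex_of_real x)) \<partial>M n) \<longlonglongrightarrow>
                (\<integral>x. Im (1 / (z - complex_of_real x)) \<partial>N)"
    using wc continuous_on_Im[OF cont] unfolding weakly_converges_def by simp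
  ultimately show ?thesis
    unfolding tendsto_complex_iff Re_cauchy_transform_integral[OF M z] Re_cauchy_transform_integral[OF N z]
      Im_cauchy_transform_integral[OF M z] Im_cauchy_transform_integral[OF N z] by blast
qed

text \<open>
  Measures of bounded mass have equicontinuous transforms, so that the argument may move along
  with the measure.
\<close>

lemma cauchy_transform_equicontinuous:
  assumes M: "\<And>n. finite_borel_measure (M n)" and C: "\<And>n. measure (M n) UNIV \<le> C"
    and w: "\<And>n. 0 < Im (w n)" and z: "0 < Im z" and lim: "w \<longlonglongrightarrow> z"
  shows "(\<lambda>n. cauchy_transform (M n) (w n) - cauchy_transform (M n) z) \<longlonglongrightarrow> 0"
proof (rule Lim_null_comparison)
  show "\<forall>\<^sub>F n in sequentially. norm (cauchy_transform (M n) (w n) - cauchy_transform (M n) z)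
          \<le> norm (w n - z) * C / (Im (w n) * Im z)"
  proof (intro always_eventually allI)
    fix n
    have "norm (cauchy_transform (M n) (w n) - cauchy_transform (M n) z) \<le>
            norm (w n - z) * measure (M n) UNIV / (Im (w n) * Im z)"
      by (rule finite_borel_measure.norm_cauchy_transform_diff_le[OF M w z])
    also have "\<dots> \<le> norm (w n - z) * C / (Im (w n) * Im z)"
      using C w[of n] z by (intro divide_right_mono mult_left_mono) auto
    finally show "norm (cauchy_transform (M n) (w n) - cauchy_transform (M n) z) \<le>
            norm (w n - z) * C / (Im (w n) * Im z)" .
  qed
  have "(\<lambda>n. norm (w n - z) * C / (Im (w n) * Im z)) \<longlonglongrightarrow> norm (z - z) * C / (Im z * Im z)"
    by (intro tendsto_intros lim) (use z in auto)
  then show "(\<lambda>n. norm (w n - z) * C / (Im (w n) * Im z)) \<longlonglongrightarrow> 0" by simp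
qed

lemma pick_function_equicontinuous:
  assumes M: "\<And>n. finite_borel_measure (M n)" and C: "\<And>n. measure (M n) UNIV \<le> C"
    and w: "\<And>n. 0 < Im (w n)" and z: "0 < Im z" and lim: "w \<longlonglongrightarrow> z"
  shows "(\<lambda>n. pick_function (\<gamma> n) (M n) (w n) - pick_function (\<gamma> n) (M n) z) \<longlonglongrightarrow> 0"
proof -
  have eq: "pick_function (\<gamma> n) (M n) (w n) - pick_function (\<gamma> n) (M n) z =
      (z - w n) * complex_of_real (measure (M n) UNIV) +
      (1 + (w n)\<^sup>2) * (cauchy_transform (M n) (w n) - cauchy_transform (M n) z) +
      ((w n)\<^sup>2 - z\<^sup>2) * cauchy_transform (M n) z" for n
    unfolding finite_borel_measure.pick_function_eq_cauchy[OF M w]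
      finite_borel_measure.pick_function_eq_cauchy[OF M z]
    by (simp add: algebra_simps)
  have 1: "(\<lambda>n. (z - w n) * complex_of_real (measure (M n) UNIV)) \<longlonglongrightarrow> 0"
  proof (rule Lim_null_comparison)
    show "\<forall>\<^sub>F n in sequentially. norm ((z - w n) * complex_of_real (measure (M n) UNIV)) \<le> norm (z - w n) * C"
      using C by (intro always_eventually allI) (auto simp: norm_mult intro!: mult_left_mono)
    have "(\<lambda>n. norm (z - w n) * C) \<longlonglongrightarrow> norm (z - z) * C"
      by (intro tendsto_intros lim)
    then show "(\<lambda>n. norm (z - w n) * C) \<longlonglongrightarrow> 0" by simp
  qed
  have 2: "(\<lambda>n. (1 + (w n)\<^sup>2) * (cauchy_transform (M n) (w n) - cauchy_transform (M n) z))
      \<longlonglongrightarrow> (1 + z\<^sup>2) * 0"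
    by (intro tendsto_mult cauchy_transform_equicontinuous[OF M C w z lim] tendsto_intros lim)
  have 3: "(\<lambda>n. ((w n)\<^sup>2 - z\<^sup>2) * cauchy_transform (M n) z) \<longlonglongrightarrow> 0"
  proof (rule Lim_null_comparison)
    have "norm (cauchy_transform (M n) z) \<le> C / Im z" for n
      by (rule order_trans[OF finite_borel_measure.norm_cauchy_transform_le[OF M z] divide_right_mono])
         (use C z in auto)
    then show "\<forall>\<^sub>F n in sequentially. norm (((w n)\<^sup>2 - z\<^sup>2) * cauchy_transform (M n) z) \<le>
        norm ((w n)\<^sup>2 - z\<^sup>2) * (C / Im z)"
      by (intro always_eventually allI) (auto simp only: norm_mult intro!: mult_left_mono norm_ge_zero)
    have "(\<lambda>n. norm ((w n)\<^sup>2 - z\<^sup>2) * (C / Im z)) \<longlonglongrightarrow> norm (z\<^sup>2 - z\<^sup>2) * (C / Im z)"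
      by (intro tendsto_intros lim) (use z in auto)
    then show "(\<lambda>n. norm ((w n)\<^sup>2 - z\<^sup>2) * (C / Im z)) \<longlonglongrightarrow> 0" by simp
  qed
  show ?thesis unfolding eq using tendsto_add[OF tendsto_add[OF 1 2] 3] by simp
qed

lemma convergent_bounded_above:
  fixes m :: "nat \<Rightarrow> real"
  assumes "m \<longlonglongrightarrow> l"
  obtains C where "0 < C" "\<And>n. \<bar>m n\<bar> \<le> C"
proof -
  have "Bseq m" using assms by (intro convergent_imp_Bseq convergentI)
  then show thesis using that unfolding Bseq_def by auto
qed

lemma pick_function_tendsto:
  assumes wc: "weakly_converges UNIV M N" and \<gamma>: "\<gamma> \<longlonglongrightarrow> \<gamma>'"
    and M: "\<And>n. finite_borel_measure (M n)" and N: "finite_borel_measure N"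
    and w: "\<And>n. 0 < Im (w n)" and z: "0 < Im z" and lim: "w \<longlonglongrightarrow> z"
  shows "(\<lambda>n. pick_function (\<gamma> n) (M n) (w n)) \<longlonglongrightarrow> pick_function \<gamma>' N z"
proof -
  note mass = weakly_converges_mass[OF wc M N]
  obtain C where C: "\<And>n. \<bar>measure (M n) UNIV\<bar> \<le> C"
    using convergent_bounded_above[OF mass] by blast
  have "(\<lambda>n. pick_function (\<gamma> n) (M n) z) \<longlonglongrightarrow> pick_function \<gamma>' N z"
    unfolding finite_borel_measure.pick_function_eq_cauchy[OF M z]
      finite_borel_measure.pick_function_eq_cauchy[OF N z]
    by (intro tendsto_intros \<gamma> mass weakly_converges_cauchy_transform[OF wc M N z])
  moreover have "(\<lambda>n. pick_function (\<gamma> n) (M n) (w n) - pick_function (\<gamma> n) (M n) z) \<longlonglongrightarrow> 0"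
    by (rule pick_function_equicontinuous[OF M _ w z lim, where C = C]) (use C in simp)
  ultimately show ?thesis by (rule Lim_transform)
qed

lemma pick_function_ii:
  assumes "finite_borel_measure N"
  shows "pick_function \<gamma> N \<i> = Complex \<gamma> (- measure N UNIV)"
  by (subst finite_borel_measure.pick_function_eq_cauchy[OF assms]) (auto simp: complex_eq_iff)

text \<open>
  Convergence at a single point bounds the masses and then the shifts, so Vitali's theorem
  spreads the convergence over the half-plane. The value at \<open>\<i>\<close> is \<open>\<gamma> - \<i> \<eta>(\<real>)\<close>, which yields
  the shift and the total mass, and the remaining part is a Cauchy transform.
\<close>

theorem generating_pair_converges_if_pick_function_converges:
  assumes M: "\<And>n. finite_borel_measure (M n)" and N: "finite_borel_measure N"
    and A: "A \<subseteq> upper_half_plane" "\<xi> \<in> upper_half_plane" "\<xi> islimpt A"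
    and conv: "\<And>z. z \<in> A \<Longrightarrow> (\<lambda>n. pick_function (\<gamma> n) (M n) z) \<longlonglongrightarrow> pick_function \<gamma>' N z"
  shows "\<gamma> \<longlonglongrightarrow> \<gamma>'" "weakly_converges UNIV M N"
proof -
  obtain z0 where "z0 \<in> A" using A(3) islimptE[of \<xi> A UNIV] by auto
  then have z0: "0 < Im z0" using A(1) by (auto simp: upper_half_plane_def)
  have "convergent (\<lambda>n. pick_function (\<gamma> n) (M n) z0)"
    using conv[OF \<open>z0 \<in> A\<close>] by (rule convergentI)
  then have "Bseq (\<lambda>n. pick_function (\<gamma> n) (M n) z0)"
    by (rule convergent_imp_Bseq)
  then obtain B where B: "0 < B" "\<And>n. norm (pick_function (\<gamma> n) (M n) z0) \<le> B"
    unfolding Bseq_def by blast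
  define C where "C = 2 * (1 + (norm z0)\<^sup>2) * B / Im z0"
  have C: "measure (M n) UNIV \<le> C" for n
  proof -
    have "Im z0 * measure (M n) UNIV \<le> 2 * (1 + (norm z0)\<^sup>2) * - Im (pick_function (\<gamma> n) (M n) z0)"
      by (rule finite_borel_measure.mass_le_Im_pick_function[OF M z0])
    also have "\<dots> \<le> 2 * (1 + (norm z0)\<^sup>2) * B"
      using B(2)[of n] abs_Im_le_cmod[of "pick_function (\<gamma> n) (M n) z0"]
      by (intro mult_left_mono) auto
    finally show ?thesis using z0 unfolding C_def by (simp add: field_simps)
  qed
  have shifted_bound: "norm (pick_function c (M n) z - complex_of_real c) \<le> norm z * C + (1 + (norm z)\<^sup>2) * (C / Im z)"
    if z: "0 < Im z" for c n z
  proof -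
    have "pick_function c (M n) z - complex_of_real c =
        - z * complex_of_real (measure (M n) UNIV) + (1 + z\<^sup>2) * cauchy_transform (M n) z"
      unfolding finite_borel_measure.pick_function_eq_cauchy[OF M z] by simp
    also have "norm \<dots> \<le> norm (- z * complex_of_real (measure (M n) UNIV)) + norm ((1 + z\<^sup>2) * cauchy_transform (M n) z)"
      by (rule norm_triangle_ineq)
    also have "norm (- z * complex_of_real (measure (M n) UNIV)) \<le> norm z * C"
      using C[of n] by (simp add: norm_mult mult_left_mono)
    also have "norm ((1 + z\<^sup>2) * cauchy_transform (M n) z) \<le> (1 + (norm z)\<^sup>2) * (C / Im z)"
      unfolding norm_mult
    proof (intro mult_mono)
      show "norm (1 + z\<^sup>2) \<le> 1 + (norm z)\<^sup>2"
        using norm_triangle_ineq[of 1 "z\<^sup>2"] by (simp add: norm_power)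
      have "norm (cauchy_transform (M n) z) \<le> measure (M n) UNIV / Im z"
        by (rule finite_borel_measure.norm_cauchy_transform_le[OF M z])
      also have "\<dots> \<le> C / Im z" using C[of n] z by (intro divide_right_mono) auto
      finally show "norm (cauchy_transform (M n) z) \<le> C / Im z" .
    qed auto
    finally show ?thesis by simp
  qed
  define B' where "B' = B + (norm z0 * C + (1 + (norm z0)\<^sup>2) * (C / Im z0))"
  have \<gamma>_bound: "\<bar>\<gamma> n\<bar> \<le> B'" for n
  proof -
    have "norm (complex_of_real (\<gamma> n)) \<le> norm (pick_function (\<gamma> n) (M n) z0) +
            norm (pick_function (\<gamma> n) (M n) z0 - complex_of_real (\<gamma> n))"
      using norm_triangle_sub[of "complex_of_real (\<gamma> n)" "pick_function (\<gamma> n) (M n) z0"]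
      by (simp only: norm_minus_commute)
    then show ?thesis using B(2)[of n] shifted_bound[OF z0, of "\<gamma> n" n] unfolding B'_def by simp
  qed
  have all: "(\<lambda>n. pick_function (\<gamma> n) (M n) z) \<longlonglongrightarrow> pick_function \<gamma>' N z" if "0 < Im z" for z
  proof (rule Vitali_convergence[OF open_upper_half_plane connected_upper_half_plane _ _ _ A conv])
    show "pick_function (\<gamma> n) (M n) holomorphic_on upper_half_plane" for n
      by (rule finite_borel_measure.holomorphic_pick_function[OF M])
    show "pick_function \<gamma>' N holomorphic_on upper_half_plane"
      by (rule finite_borel_measure.holomorphic_pick_function[OF N])
    show "z \<in> upper_half_plane" using that by (simp add: upper_half_plane_def)
    fix K :: "complex set" assume K: "compact K" "K \<subseteq> upper_half_plane"
    show "\<exists>b. \<forall>n. \<forall>z\<in>K. norm (pick_function (\<gamma> n) (M n) z) \<le> b"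
    proof -
      have "continuous_on K (\<lambda>z. norm z * C + (1 + (norm z)\<^sup>2) * (C / Im z))"
        by (intro continuous_intros) (use K(2) in \<open>auto simp: upper_half_plane_def\<close>)
      then have "bounded ((\<lambda>z. norm z * C + (1 + (norm z)\<^sup>2) * (C / Im z)) ` K)"
        using K(1) compact_continuous_image compact_imp_bounded by blast
      then obtain b where b: "\<And>z. z \<in> K \<Longrightarrow> \<bar>norm z * C + (1 + (norm z)\<^sup>2) * (C / Im z)\<bar> \<le> b"
        unfolding bounded_iff by auto
      have "norm (pick_function (\<gamma> n) (M n) z) \<le> B' + b" if "z \<in> K" for n z
      proof -
        have "0 < Im z" using that K(2) by (auto simp: upper_half_plane_def)
        from shifted_bound[OF this, of "\<gamma> n" n] b[OF that]
        have "norm (pick_function (\<gamma> n) (M n) z - complex_of_real (\<gamma> n)) \<le> b" by linarith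
        moreover have "norm (pick_function (\<gamma> n) (M n) z) \<le>
            norm (complex_of_real (\<gamma> n)) + norm (pick_function (\<gamma> n) (M n) z - complex_of_real (\<gamma> n))"
          by (rule norm_triangle_sub)
        ultimately show ?thesis using \<gamma>_bound[of n] by simp
      qed
      then show ?thesis by blast
    qed
  qed
  have ii: "(\<lambda>n. Complex (\<gamma> n) (- measure (M n) UNIV)) \<longlonglongrightarrow> Complex \<gamma>' (- measure N UNIV)"
    using all[of \<i>] unfolding pick_function_ii[OF M] pick_function_ii[OF N] by simp
  show \<gamma>: "\<gamma> \<longlonglongrightarrow> \<gamma>'" using tendsto_Re[OF ii] by simp
  have mass: "(\<lambda>n. measure (M n) UNIV) \<longlonglongrightarrow> measure N UNIV"
    using tendsto_minus[OF tendsto_Im[OF ii]] by simp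
  show "weakly_converges UNIV M N"
  proof (rule weakly_converges_if_cauchy_transform_converges[OF M N mass])
    fix z assume z: "0 < Im z" "Im z < 1"
    \<comment> \<open>The bound \<open>Im z < 1\<close> excludes \<open>z = \<i>\<close>, where the pick function loses the Cauchy transform.\<close>
    have ne: "1 + z\<^sup>2 \<noteq> 0"
    proof
      assume "1 + z\<^sup>2 = 0"
      then have "(z - \<i>) * (z + \<i>) = 0" by (simp add: algebra_simps power2_eq_square)
      then have "z = \<i> \<or> z = - \<i>" by (simp add: eq_neg_iff_add_eq_0)
      then show False using z by auto
    qed
    have eq: "cauchy_transform L z =
        (pick_function c L z - complex_of_real c + z * complex_of_real (measure L UNIV)) / (1 + z\<^sup>2)"
      if "finite_borel_measure L" for L c
      unfolding finite_borel_measure.pick_function_eq_cauchy[OF that z(1)] using ne by simp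
    have "(\<lambda>n. cauchy_transform (M n) z) =
        (\<lambda>n. (pick_function (\<gamma> n) (M n) z - complex_of_real (\<gamma> n) +
               z * complex_of_real (measure (M n) UNIV)) / (1 + z\<^sup>2))"
      using eq[OF M] by (intro ext)
    then show "(\<lambda>n. cauchy_transform (M n) z) \<longlonglongrightarrow> cauchy_transform N z"
      unfolding eq[OF N, of \<gamma>'] by (simp only:) (intro tendsto_intros all z(1) \<gamma> mass ne)
  qed
qed

section \<open>The reciprocal Cauchy transform and its local inverses\<close>

lemma trunc_cone_subset_upper_half_plane: "trunc_cone a b \<subseteq> upper_half_plane"
  by (auto simp: trunc_cone_def)

lemma trunc_cone_iff: "z \<in> trunc_cone a b \<longleftrightarrow> 0 < Im z \<and> a * \<bar>Re z\<bar> < Im z \<and> b < Im z"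
  by (auto simp: trunc_cone_def upper_half_plane_def)

lemma trunc_cone_mono: "a' \<le> a \<Longrightarrow> b' \<le> b \<Longrightarrow> trunc_cone a b \<subseteq> trunc_cone a' b'"
  unfolding trunc_cone_iff subset_iff
  by (meson abs_ge_zero mult_right_mono le_less_trans)

lemma open_trunc_cone: "open (trunc_cone a b)"
proof -
  have "trunc_cone a b = {z. 0 < Im z} \<inter> {z. a * \<bar>Re z\<bar> < Im z} \<inter> {z. b < Im z}"
    by (auto simp: trunc_cone_iff)
  moreover have "open {z. a * \<bar>Re z\<bar> < Im z}"
    by (intro open_Collect_less continuous_intros)
  ultimately show ?thesis
    using open_halfspace_Im_gt by (auto intro!: open_Int)
qed

lemma convex_trunc_cone:
  assumes "0 \<le> a"
  shows "convex (trunc_cone a b)"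
proof -
  have "trunc_cone a b = {z. Im z > 0} \<inter> {z. Im z > b} \<inter> {z. a * Re z < Im z} \<inter> {z. - a * Re z < Im z}"
  proof -
    have "a * \<bar>x\<bar> < y \<longleftrightarrow> a * x < y \<and> - a * x < y" for x y :: real
    proof -
      have "a * \<bar>x\<bar> = \<bar>a * x\<bar>" using assms by (simp add: abs_mult)
      then show ?thesis by (simp add: abs_less_iff)
    qed
    then show ?thesis by (auto simp: trunc_cone_iff)
  qed
  moreover have cv: "convex {z. c * Re z < Im z}" for c
  proof -
    have "{z. c * Re z < Im z} = {z. Complex (- c) 1 \<bullet> z > 0}"
      by (auto simp: inner_complex_def)
    then show ?thesis using convex_halfspace_gt by metis
  qed
  ultimately show ?thesis
    by (simp only:) (intro convex_Int convex_halfspace_Im_gt cv)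
qed

lemma imaginary_in_trunc_cone: "b < y \<Longrightarrow> 0 < y \<Longrightarrow> Complex 0 y \<in> trunc_cone a b"
  by (simp add: trunc_cone_iff)

lemma norm_le_in_trunc_cone:
  assumes "0 < a" "z \<in> trunc_cone a b"
  shows "norm z \<le> (1 + 1 / a) * Im z"
proof -
  have "\<bar>Re z\<bar> \<le> Im z / a" using assms by (simp add: trunc_cone_iff field_simps)
  then show ?thesis using cmod_le[of z] assms(2) by (simp add: trunc_cone_iff algebra_simps)
qed

text \<open>
  In a cone the ratio \<open>x / (z - x)\<close> is bounded uniformly in \<open>x\<close>, and it is small for bounded
  \<open>x\<close> when \<open>z\<close> is high up; so the mean of its modulus against a finite measure tends to \<open>0\<close>. This one
  estimate gives both \<open>z G(z) \<rightarrow> 1\<close> and the injectivity of \<open>F\<close> high up in the cone.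
\<close>

lemma norm_ratio_le:
  assumes a: "0 < a" and z: "z \<in> trunc_cone a b"
  shows "norm (complex_of_real x / (z - complex_of_real x)) \<le> 2 + 1 / a"
proof -
  have Im: "0 < Im z" using z by (simp add: trunc_cone_iff)
  have "complex_of_real x / (z - complex_of_real x) = z * (1 / (z - complex_of_real x)) - 1"
    using Im_pos_imp_ne_of_real[OF Im] by (simp add: field_simps)
  also have "norm \<dots> \<le> norm z * norm (1 / (z - complex_of_real x)) + 1"
    using norm_triangle_ineq4[of "z * (1 / (z - complex_of_real x))" 1] by (simp only: norm_mult norm_one)
  also have "norm z * norm (1 / (z - complex_of_real x)) \<le> ((1 + 1 / a) * Im z) * (1 / Im z)"
    by (intro mult_mono norm_le_in_trunc_cone[OF a z] norm_resolvent_le Im) (use a Im in auto)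
  also have "\<dots> = 1 + 1 / a" using Im by simp
  finally show ?thesis by simp
qed

lemma (in finite_borel_measure) integrable_ratio:
  assumes "0 < a" "z \<in> trunc_cone a b"
  shows "integrable M (\<lambda>x. complex_of_real x / (z - complex_of_real x))"
  by (rule integrable_bounded[OF _ norm_ratio_le[OF assms]]) measurable

lemma (in finite_borel_measure) mean_ratio_small:
  assumes a: "0 < a" and e: "0 < e"
  obtains b where "0 < b"
    "\<And>z. z \<in> trunc_cone a b \<Longrightarrow> (\<integral>x. norm (complex_of_real x / (z - complex_of_real x)) \<partial>M) < e"
proof -
  define c where "c = 2 + 1 / a"
  have c: "c > 0" using a by (auto simp: c_def intro!: add_pos_pos)
  obtain R where R: "0 \<le> R" "(\<integral>x. 1 - cutoff R x \<partial>M) < e / (2 * c)"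
    using cutoff_tail_less[of "e / (2 * c)"] e c by auto
  define m where "m = measure M UNIV"
  define b where "b = 2 * (R + 1) * (m + 1) / e"
  have m0: "0 \<le> m" unfolding m_def by simp
  have b: "b > 0" using R(1) e m0 by (auto simp: b_def intro!: divide_pos_pos mult_pos_pos)
  have "(\<integral>x. norm (complex_of_real x / (z - complex_of_real x)) \<partial>M) < e"
    if z: "z \<in> trunc_cone a b" for z
  proof -
    have Im: "0 < Im z" "b < Im z" using z by (auto simp: trunc_cone_iff)
    have int_tail: "integrable M (\<lambda>x. 1 - cutoff R x)"
      by (rule integrable_bounded[of _ 1]) (use cutoff_nonneg[of R] cutoff_le_1[of R] in auto)
    have "(\<integral>x. norm (complex_of_real x / (z - complex_of_real x)) \<partial>M) \<le>
          (\<integral>x. (R + 1) / Im z + c * (1 - cutoff R x) \<partial>M)"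
    proof (rule integral_mono)
      show "integrable M (\<lambda>x. norm (complex_of_real x / (z - complex_of_real x)))"
        by (rule integrable_norm[OF integrable_ratio[OF a z]])
      show "integrable M (\<lambda>x. (R + 1) / Im z + c * (1 - cutoff R x))"
        by (rule Bochner_Integration.integrable_add[OF integrable_const integrable_mult_right[OF int_tail]])
      fix x
      show "norm (complex_of_real x / (z - complex_of_real x)) \<le> (R + 1) / Im z + c * (1 - cutoff R x)"
      proof (cases "\<bar>x\<bar> \<le> R + 1")
        case True
        have "norm (complex_of_real x / (z - complex_of_real x)) \<le> (R + 1) / Im z"
          unfolding norm_divide using True Im_le_norm_diff_of_real[of z x] Im
          by (intro frac_le) auto
        then show ?thesis using cutoff_le_1[of R x] c by (simp add: add_increasing2)
      next
        case False
        then show ?thesis using norm_ratio_le[OF a z, of x] cutoff_eq_0[of R x] R(1) Im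
          unfolding c_def by (simp add: add_increasing)
      qed
    qed
    also have "\<dots> = (\<integral>x. (R + 1) / Im z \<partial>M) + (\<integral>x. c * (1 - cutoff R x) \<partial>M)"
      by (rule Bochner_Integration.integral_add[OF integrable_const integrable_mult_right[OF int_tail]])
    also have "\<dots> = m * ((R + 1) / Im z) + c * (\<integral>x. 1 - cutoff R x \<partial>M)"
      unfolding m_def by (simp only: integral_mult_right_zero) (simp add: space_M_UNIV)
    also have "\<dots> < e / 2 + e / 2"
    proof (rule add_le_less_mono)
      have "m * ((R + 1) / Im z) \<le> (m + 1) * ((R + 1) / b)"
        using m0 R(1) Im b by (intro mult_mono frac_le) auto
      also have "\<dots> = e / 2"
      proof -
        have "q * (p / (2 * p * q / e)) = e / 2" if "0 < p" "0 < q" for p q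
          using that e by (simp add: field_simps)
        from this[of "R + 1" "m + 1"] show ?thesis using R(1) m0 by (simp add: b_def)
      qed
      finally show "m * ((R + 1) / Im z) \<le> e / 2" .
      show "c * (\<integral>x. 1 - cutoff R x \<partial>M) < e / 2" using R(2) c by (simp add: field_simps)
    qed
    finally show ?thesis by simp
  qed
  with b that show thesis by blast
qed

context real_distribution
begin

lemma measure_UNIV_eq_1: "measure M UNIV = 1"
  using prob_space by simp

lemma cauchy_transform_asymptotics:
  assumes a: "0 < a" and e: "0 < e"
  obtains b where "0 < b" "\<And>z. z \<in> trunc_cone a b \<Longrightarrow> norm (z * cauchy_transform M z - 1) < e"
proof -
  obtain b where b: "0 < b"
    "\<And>z. z \<in> trunc_cone a b \<Longrightarrow> (\<integral>x. norm (complex_of_real x / (z - complex_of_real x)) \<partial>M) < e"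
    using mean_ratio_small[OF a e] by blast
  have "norm (z * cauchy_transform M z - 1) < e" if z: "z \<in> trunc_cone a b" for z
  proof -
    have Im: "0 < Im z" using z by (simp add: trunc_cone_iff)
    have "z * cauchy_transform M z - 1 = (\<integral>x. z * (1 / (z - complex_of_real x)) \<partial>M) - (\<integral>x. 1 \<partial>M)"
      unfolding cauchy_transform_def by (simp only: integral_mult_right_zero) (simp add: measure_UNIV_eq_1)
    also have "\<dots> = (\<integral>x. z * (1 / (z - complex_of_real x)) - 1 \<partial>M)"
      by (rule Bochner_Integration.integral_diff[symmetric, OF integrable_mult_right[OF integrable_resolvent[OF Im]] integrable_const])
    also have "\<dots> = (\<integral>x. complex_of_real x / (z - complex_of_real x) \<partial>M)"
      by (rule Bochner_Integration.integral_cong[OF refl])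
         (use Im_pos_imp_ne_of_real[OF Im] in \<open>simp add: field_simps\<close>)
    finally have "norm (z * cauchy_transform M z - 1) \<le> (\<integral>x. norm (complex_of_real x / (z - complex_of_real x)) \<partial>M)"
      by (simp only: integral_norm_bound)
    with b(2)[OF z] show ?thesis by simp
  qed
  with b(1) that show thesis by blast
qed

text \<open>
  Equal values at \<open>z \<noteq> w\<close> force \<open>\<integral> 1 / ((z - x) (w - x)) dM = 0\<close>. Multiplied by \<open>z w\<close> the integrand is
  \<open>(1 + p) (1 + q)\<close> with the ratios \<open>p = x / (z - x)\<close> and \<open>q = x / (w - x)\<close> of small mean modulus, so
  its integral is close to \<open>1\<close>.
\<close>

lemma cauchy_transform_inj_on_cone:
  assumes a: "0 < a"
  obtains b where "0 < b" "inj_on (cauchy_transform M) (trunc_cone a b)"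
proof -
  define c where "c = 4 + 1 / a"
  have c: "c > 0" using a by (auto simp: c_def intro!: add_pos_pos)
  \<comment> \<open>\<open>1 / c\<close> is the bound \<open>d\<close> on the means of \<open>p\<close> and \<open>q\<close> below with \<open>d + (3 + 1 / a) d = 1\<close>.\<close>
  obtain b where b: "0 < b"
    "\<And>z. z \<in> trunc_cone a b \<Longrightarrow> (\<integral>x. norm (complex_of_real x / (z - complex_of_real x)) \<partial>M) < 1 / c"
    using mean_ratio_small[OF a, of "1 / c"] c by auto
  have "z = w" if z: "z \<in> trunc_cone a b" and w: "w \<in> trunc_cone a b"
    and eq: "cauchy_transform M z = cauchy_transform M w" for z w
  proof (rule ccontr)
    assume "z \<noteq> w"
    have Im: "0 < Im z" "0 < Im w" using z w by (auto simp: trunc_cone_iff)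
    define p where "p = (\<lambda>x. complex_of_real x / (z - complex_of_real x))"
    define q where "q = (\<lambda>x. complex_of_real x / (w - complex_of_real x))"
    have p_int: "integrable M p" and q_int: "integrable M q"
      unfolding p_def q_def by (rule integrable_ratio[OF a z], rule integrable_ratio[OF a w])
    have "norm (p x * q x) \<le> (2 + 1 / a) * (2 + 1 / a)" for x
      unfolding p_def q_def norm_mult by (intro mult_mono norm_ratio_le[OF a z] norm_ratio_le[OF a w]) (use a in auto)
    then have pq_int: "integrable M (\<lambda>x. p x * q x)"
      by (rule integrable_bounded[rotated]) (simp add: p_def q_def)
    have "(\<integral>x. 1 / ((z - complex_of_real x) * (w - complex_of_real x)) \<partial>M) = 0"
      using cauchy_transform_diff[OF Im] eq \<open>z \<noteq> w\<close> by simp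
    then have "0 = (\<integral>x. z * w * (1 / ((z - complex_of_real x) * (w - complex_of_real x))) \<partial>M)"
      by (simp only: integral_mult_right_zero mult_zero_right)
    also have "\<dots> = (\<integral>x. 1 + (p x + q x + p x * q x) \<partial>M)"
    proof (rule Bochner_Integration.integral_cong[OF refl])
      fix x
      have 1: "1 + p x = z / (z - complex_of_real x)" "1 + q x = w / (w - complex_of_real x)"
        unfolding p_def q_def using Im_pos_imp_ne_of_real[OF Im(1)] Im_pos_imp_ne_of_real[OF Im(2)]
        by (auto simp: field_simps)
      have "z * w * (1 / ((z - complex_of_real x) * (w - complex_of_real x))) = (1 + p x) * (1 + q x)"
        unfolding 1 by simp
      then show "z * w * (1 / ((z - complex_of_real x) * (w - complex_of_real x))) = 1 + (p x + q x + p x * q x)"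
        by (simp add: algebra_simps)
    qed
    also have "\<dots> = 1 + (\<integral>x. p x + q x + p x * q x \<partial>M)"
      by (subst Bochner_Integration.integral_add[OF integrable_const])
         (auto simp: measure_UNIV_eq_1 intro!: Bochner_Integration.integrable_add p_int q_int pq_int)
    finally have "norm (\<integral>x. p x + q x + p x * q x \<partial>M) = 1"
      by (metis add_eq_0_iff norm_minus_cancel norm_one)
    moreover have "norm (\<integral>x. p x + q x + p x * q x \<partial>M) \<le> (\<integral>x. norm (p x) + (3 + 1 / a) * norm (q x) \<partial>M)"
    proof (rule Bochner_Integration.integral_norm_bound_integral)
      fix x
      have "norm (p x + q x + p x * q x) \<le> norm (p x) + norm (q x) + norm (p x) * norm (q x)"
        by (intro order_trans[OF norm_triangle_ineq] add_mono norm_triangle_ineq) (simp add: norm_mult)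
      also have "norm (p x) * norm (q x) \<le> (2 + 1 / a) * norm (q x)"
        unfolding p_def by (intro mult_right_mono norm_ratio_le[OF a z]) simp
      finally show "norm (p x + q x + p x * q x) \<le> norm (p x) + (3 + 1 / a) * norm (q x)"
        by (simp add: algebra_simps)
    next
      show "integrable M (\<lambda>x. p x + q x + p x * q x)"
        by (intro Bochner_Integration.integrable_add p_int q_int pq_int)
      show "integrable M (\<lambda>x. norm (p x) + (3 + 1 / a) * norm (q x))"
        by (intro Bochner_Integration.integrable_add integrable_mult_right integrable_norm p_int q_int)
    qed
    moreover have "\<dots> = (\<integral>x. norm (p x) \<partial>M) + (3 + 1 / a) * (\<integral>x. norm (q x) \<partial>M)"
      by (subst Bochner_Integration.integral_add[OF integrable_norm[OF p_int] integrable_mult_right[OF integrable_norm[OF q_int]]])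
         (simp only: integral_mult_right_zero)
    moreover have "\<dots> < 1 / c + (3 + 1 / a) * (1 / c)"
      using b(2)[OF z] b(2)[OF w] a unfolding p_def q_def
      by (intro add_strict_mono mult_strict_left_mono) (auto intro!: add_pos_pos)
    moreover have "1 / c + (3 + 1 / a) * (1 / c) = 1"
    proof -
      have "1 / c + (3 + 1 / a) * (1 / c) = (1 + (3 + 1 / a)) * (1 / c)"
        by (simp only: distrib_right mult_1_left)
      also have "1 + (3 + 1 / a) = c" by (simp add: c_def)
      finally show ?thesis using c by simp
    qed
    ultimately show False by linarith
  qed
  then have "inj_on (cauchy_transform M) (trunc_cone a b)" by (rule inj_onI) blast+
  with b(1) that show thesis by blast
qed

lemma Im_cauchy_transform_neg:
  assumes z: "0 < Im z"
  shows "Im (cauchy_transform M z) < 0"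
proof -
  let ?k = "\<lambda>x. 1 / (norm (z - complex_of_real x))\<^sup>2"
  have pos: "0 < norm (z - complex_of_real x)" for x using Im_pos_imp_ne_of_real[OF z, of x] by simp
  have int: "integrable M ?k"
  proof (rule integrable_bounded)
    fix x
    have "(Im z)\<^sup>2 \<le> (norm (z - complex_of_real x))\<^sup>2"
      using Im_le_norm_diff_of_real[of z x] z by (intro power_mono) auto
    then show "norm (?k x) \<le> 1 / (Im z)\<^sup>2" using z by (simp add: frac_le)
  qed measurable
  have "(\<integral>x. 0 \<partial>M) < (\<integral>x. ?k x \<partial>M)"
    by (rule integral_less_AE_space[OF _ int])
       (use pos emeasure_space_1 in \<open>auto intro!: AE_I2\<close>)
  then have "0 < (\<integral>x. ?k x \<partial>M)" by simp
  then show ?thesis unfolding Im_cauchy_transform[OF z] using z by simp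
qed

lemma cauchy_transform_nonzero: "0 < Im z \<Longrightarrow> cauchy_transform M z \<noteq> 0"
  using Im_cauchy_transform_neg[of z] by auto

lemma Im_recip_cauchy_transform_pos:
  assumes "0 < Im z"
  shows "0 < Im (recip_cauchy_transform M z)"
  unfolding recip_cauchy_transform_def
  using Im_cauchy_transform_neg[OF assms]
  by (auto simp: Im_divide intro!: divide_neg_pos add_nonneg_pos zero_less_power2[THEN iffD2])

lemma recip_in_upper_half_plane:
  "z \<in> upper_half_plane \<Longrightarrow> recip_cauchy_transform M z \<in> upper_half_plane"
  using Im_recip_cauchy_transform_pos by (simp add: upper_half_plane_def)

lemma holomorphic_recip_cauchy_transform: "recip_cauchy_transform M holomorphic_on upper_half_plane"
  unfolding recip_cauchy_transform_def
  by (intro holomorphic_intros holomorphic_cauchy_transform)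
     (auto simp: upper_half_plane_def cauchy_transform_nonzero)

text \<open>
  The equation \<open>F(z) = w\<close> is the fixed-point equation \<open>z = w - (F(z) - z)\<close>, and
  \<open>F(z) - z = o(\<bar>z\<bar>)\<close> in a cone; Brouwer's theorem on a disc around \<open>w\<close> solves it.
\<close>

lemma recip_cauchy_transform_covers_cone:
  assumes b': "0 < b'"
  obtains b where "0 < b" "trunc_cone 2 b \<subseteq> recip_cauchy_transform M ` trunc_cone 1 b'"
proof -
  let ?F = "recip_cauchy_transform M"
  obtain B where B: "0 < B" "\<And>z. z \<in> trunc_cone 1 B \<Longrightarrow> norm (z * cauchy_transform M z - 1) < 1 / 32"
    by (rule cauchy_transform_asymptotics[of 1 "1 / 32"]) auto
  \<comment> \<open>The disc of radius \<open>Im w / 8\<close> around a point \<open>w\<close> of the cone of slope \<open>2\<close> above height \<open>b\<close> stays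
    in the cone of slope \<open>1\<close> above \<open>B\<close> and \<open>b'\<close>.\<close>
  define b where "b = 2 * max B b'"
  have b: "0 < b" "2 * B \<le> b" "2 * b' \<le> b" using B(1) by (auto simp: b_def)
  have close: "norm (?F z - z) \<le> norm z / 16" if z: "z \<in> trunc_cone 1 B" for z
  proof -
    define g where "g = z * cauchy_transform M z"
    have g: "norm (g - 1) < 1 / 32" unfolding g_def by (rule B(2)[OF z])
    have "1 \<le> norm g + norm (g - 1)"
      using norm_triangle_ineq4[of g "g - 1"] by simp
    then have g_ge: "1 / 2 \<le> norm g" using g by linarith
    have "z \<noteq> 0" "cauchy_transform M z \<noteq> 0"
      using z cauchy_transform_nonzero by (auto simp: trunc_cone_iff)
    then have "?F z - z = z * ((1 - g) / g)"
      unfolding recip_cauchy_transform_def g_def by (simp add: field_simps)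
    then have "norm (?F z - z) = norm z * (norm (g - 1) / norm g)"
      by (simp only: norm_mult norm_divide norm_minus_commute)
    also have "\<dots> \<le> norm z * ((1 / 32) / (1 / 2))"
      using g g_ge by (intro mult_left_mono frac_le) auto
    finally show ?thesis by simp
  qed
  have "w \<in> ?F ` trunc_cone 1 b'" if w: "w \<in> trunc_cone 2 b" for w
  proof -
    have w': "0 < Im w" "2 * \<bar>Re w\<bar> < Im w" "b < Im w" using w by (auto simp: trunc_cone_iff)
    define r where "r = Im w / 8"
    have disc: "z \<in> trunc_cone 1 B \<inter> trunc_cone 1 b'" if "z \<in> cball w r" for z
    proof -
      have "norm (w - z) \<le> r" using that by (simp add: dist_norm)
      then have "\<bar>Re w - Re z\<bar> \<le> r" "\<bar>Im w - Im z\<bar> \<le> r"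
        using abs_Re_le_cmod[of "w - z"] abs_Im_le_cmod[of "w - z"] by auto
      then have "\<bar>Re z\<bar> \<le> \<bar>Re w\<bar> + r" "Im w - r \<le> Im z" by linarith+
      then show ?thesis using w' b b' B(1) unfolding r_def by (auto simp: trunc_cone_iff)
    qed
    have "\<exists>z\<in>cball w r. w - (?F z - z) = z"
    proof (rule brouwer[of "cball w r" "\<lambda>z. w - (?F z - z)"])
      show "compact (cball w r)" "convex (cball w r)" "cball w r \<noteq> {}"
        using w'(1) by (auto simp: r_def)
      have "continuous_on (cball w r) ?F"
        by (rule continuous_on_subset[OF holomorphic_on_imp_continuous_on[OF holomorphic_recip_cauchy_transform]])
           (use disc trunc_cone_subset_upper_half_plane in blast)
      then show "continuous_on (cball w r) (\<lambda>z. w - (?F z - z))"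
        by (intro continuous_intros)
      show "(\<lambda>z. w - (?F z - z)) \<in> cball w r \<rightarrow> cball w r"
      proof
        fix z assume z: "z \<in> cball w r"
        have "norm w \<le> 3 / 2 * Im w" using cmod_le[of w] w' by linarith
        moreover have "norm z \<le> norm w + norm (w - z)"
          using norm_triangle_sub[of z w] by (simp add: norm_minus_commute)
        ultimately have "norm z / 16 \<le> r"
          using z w'(1) unfolding r_def by (simp add: dist_norm) 
        then show "w - (?F z - z) \<in> cball w r"
          using close[of z] disc[OF z] by (auto simp: dist_norm)
      qed
    qed blast
    then obtain z where "z \<in> cball w r" "w - (?F z - z) = z" by blast
    then have "?F z = w" "z \<in> trunc_cone 1 b'" using disc by (auto simp: algebra_simps)
    then show ?thesis by blast
  qed
  with b(1) that show thesis by blast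
qed

lemma voiculescu_cones_exist:
  obtains b b' where "voiculescu_cones M 2 b 1 b'"
proof -
  obtain b' where b': "0 < b'" "inj_on (cauchy_transform M) (trunc_cone 1 b')"
    by (rule cauchy_transform_inj_on_cone[of 1]) auto
  obtain b where b: "0 < b" "trunc_cone 2 b \<subseteq> recip_cauchy_transform M ` trunc_cone 1 b'"
    by (rule recip_cauchy_transform_covers_cone[OF b'(1)])
  have "inj_on (recip_cauchy_transform M) (trunc_cone 1 b')"
    using b'(2) unfolding inj_on_def recip_cauchy_transform_def by simp
  with b b' that show thesis unfolding voiculescu_cones_def by simp
qed

text \<open>
  Solutions of \<open>F(w) = \<i> y\<close> inside one cone are forced into every other cone as \<open>y\<close> grows: at
  bounded height \<open>G\<close> is bounded away from \<open>0\<close>, and high up \<open>w \<approx> F(w)\<close>.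
\<close>

lemma preimage_of_imaginary_axis_in_cone:
  assumes a': "0 < a'" and b': "0 < b'" and A: "0 < A"
  obtains Y where "0 < Y" "\<And>y w. \<lbrakk>Y < y; w \<in> trunc_cone a' b'; recip_cauchy_transform M w = Complex 0 y\<rbrakk> \<Longrightarrow> w \<in> trunc_cone A B"
proof -
  \<comment> \<open>The disc of radius \<open>e y\<close> around \<open>\<i> y\<close> lies in the cone of slope \<open>A\<close>, since \<open>A e < 1 - e\<close>.\<close>
  define e where "e = 1 / (A + 2)"
  have e: "0 < e" "e \<le> 1 / 2" "A * e < 1 - e" using A by (auto simp: e_def field_simps)
  obtain B1 where B1: "0 < B1" "\<And>z. z \<in> trunc_cone a' B1 \<Longrightarrow> norm (z * cauchy_transform M z - 1) < e"
    using cauchy_transform_asymptotics[OF a' e(1)] by blast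
  define S where "S = {w. b' \<le> Im w \<and> Im w \<le> B1 \<and> a' * \<bar>Re w\<bar> \<le> Im w}"
  have S_sub: "S \<subseteq> upper_half_plane" using b' by (auto simp: S_def upper_half_plane_def)
  have "compact S"
  proof -
    have "closed {w. b' \<le> Im w}" "closed {w. Im w \<le> B1}" "closed {w. a' * \<bar>Re w\<bar> \<le> Im w}"
      by (intro closed_Collect_le continuous_intros)+
    moreover have "S = {w. b' \<le> Im w} \<inter> {w. Im w \<le> B1} \<inter> {w. a' * \<bar>Re w\<bar> \<le> Im w}"
      by (auto simp: S_def)
    ultimately have "closed S" by (simp add: closed_Int)
    moreover have "bounded S"
      unfolding bounded_iff
    proof (intro exI ballI)
      fix w assume w: "w \<in> S"
      then have "\<bar>Re w\<bar> \<le> Im w / a'" using a' by (simp add: S_def field_simps)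
      also have "\<dots> \<le> B1 / a'" using w a' by (intro divide_right_mono) (auto simp: S_def)
      finally show "norm w \<le> B1 / a' + B1" using w b' cmod_le[of w] by (simp add: S_def)
    qed
    ultimately show ?thesis by (simp add: compact_eq_bounded_closed)
  qed
  have "\<exists>c>0. \<forall>w\<in>S. c \<le> norm (cauchy_transform M w)"
  proof (cases "S = {}")
    case False
    have "continuous_on S (cauchy_transform M)"
      using holomorphic_on_imp_continuous_on[OF holomorphic_cauchy_transform] S_sub continuous_on_subset by blast
    then have "continuous_on S (\<lambda>w. norm (cauchy_transform M w))" by (rule continuous_on_norm)
    from continuous_attains_inf[OF \<open>compact S\<close> False this]
    obtain w0 where w0: "w0 \<in> S" "\<And>w. w \<in> S \<Longrightarrow> norm (cauchy_transform M w0) \<le> norm (cauchy_transform M w)"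
      by blast
    have "0 < norm (cauchy_transform M w0)"
      using cauchy_transform_nonzero[of w0] w0(1) S_sub by (auto simp: upper_half_plane_def)
    with w0(2) show ?thesis by blast
  qed (auto intro: exI[of _ 1])
  then obtain c where c: "0 < c" "\<And>w. w \<in> S \<Longrightarrow> c \<le> norm (cauchy_transform M w)" by blast
  define Y where "Y = max (1 / c) (2 * \<bar>B\<bar>)"
  have "0 < Y" using c(1) by (simp add: Y_def less_max_iff_disj)
  moreover have "w \<in> trunc_cone A B"
    if y: "Y < y" and w: "w \<in> trunc_cone a' b'" and Fw: "recip_cauchy_transform M w = Complex 0 y" for y w
  proof -
    have y0: "0 < y" "1 / c < y" "2 * B < y" using y \<open>0 < Y\<close> by (auto simp: Y_def)
    have G: "cauchy_transform M w = 1 / Complex 0 y"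
      using Fw unfolding recip_cauchy_transform_def by (metis div_by_1 divide_divide_eq_right mult_1_left)
    have nI: "norm (Complex 0 y) = y" using y0(1) by (simp add: cmod_def)
    have ne: "Complex 0 y \<noteq> 0" using y0(1) by (simp add: complex_eq_iff)
    have nG: "norm (cauchy_transform M w) = 1 / y"
      unfolding G by (simp add: norm_divide nI)
    have "1 / y < c" using y0 c(1) by (simp add: field_simps)
    then have "w \<notin> S" using c(2)[of w] nG by auto
    then have "w \<in> trunc_cone a' B1" using w by (auto simp: S_def trunc_cone_iff)
    from B1(2)[OF this] have "norm (w / Complex 0 y - 1) < e" unfolding G by simp
    moreover have "w - Complex 0 y = (w / Complex 0 y - 1) * Complex 0 y"
      using ne by (simp add: left_diff_distrib)
    then have "norm (w - Complex 0 y) = norm (w / Complex 0 y - 1) * y"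
      by (simp only: norm_mult nI)
    ultimately have d: "norm (w - Complex 0 y) < e * y" using y0(1) by simp
    have re: "\<bar>Re w\<bar> < e * y" using abs_Re_le_cmod[of "w - Complex 0 y"] d by simp
    have im: "(1 - e) * y < Im w" using abs_Im_le_cmod[of "w - Complex 0 y"] d by (simp add: algebra_simps)
    have "A * \<bar>Re w\<bar> < A * (e * y)" using re A by simp
    also have "\<dots> \<le> (1 - e) * y" using e(3) y0(1) mult_right_mono[of "A * e" "1 - e" y] by (simp add: mult.assoc)
    finally have "A * \<bar>Re w\<bar> < Im w" using im by simp
    moreover have "y / 2 \<le> (1 - e) * y" using e(2) y0(1) mult_right_mono[of "1/2" "1 - e" y] by simp
    ultimately show ?thesis using im y0 unfolding trunc_cone_iff by linarith
  qed
  ultimately show thesis using that by blast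
qed

lemma holomorphic_local_inverse:
  assumes "voiculescu_cones M a b a' b'"
  shows "inv_into (trunc_cone a' b') (recip_cauchy_transform M) holomorphic_on trunc_cone a b"
proof -
  let ?F = "recip_cauchy_transform M" and ?\<Gamma> = "trunc_cone a' b'"
  have inj: "inj_on ?F ?\<Gamma>" and sub: "trunc_cone a b \<subseteq> ?F ` ?\<Gamma>"
    using assms by (auto simp: voiculescu_cones_def)
  have "?F holomorphic_on ?\<Gamma>"
    using holomorphic_recip_cauchy_transform trunc_cone_subset_upper_half_plane by (rule holomorphic_on_subset)
  then obtain g where g: "g holomorphic_on ?F ` ?\<Gamma>" "\<And>z. z \<in> ?\<Gamma> \<Longrightarrow> g (?F z) = z"
    using holomorphic_has_inverse[OF _ open_trunc_cone inj] by metis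
  have "g w = inv_into ?\<Gamma> ?F w" if "w \<in> trunc_cone a b" for w
    using that sub g(2) inj by auto
  then show ?thesis
    using holomorphic_transform[OF holomorphic_on_subset[OF g(1) sub]] by blast
qed

text \<open>
  Both inverses send \<open>\<i> y\<close>, for large \<open>y\<close>, into the intersection of the two cones of injectivity,
  hence to the same point. The common domain is convex, so the identity theorem applies.
\<close>

lemma local_inverses_agree:
  assumes v1: "voiculescu_cones M a1 b1 a1' b1'" and v2: "voiculescu_cones M a2 b2 a2' b2'"
    and z: "z \<in> trunc_cone a1 b1" "z \<in> trunc_cone a2 b2"
  shows "inv_into (trunc_cone a1' b1') (recip_cauchy_transform M) z =
         inv_into (trunc_cone a2' b2') (recip_cauchy_transform M) z"
proof -
  let ?F = "recip_cauchy_transform M"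
  let ?g1 = "inv_into (trunc_cone a1' b1') ?F" and ?g2 = "inv_into (trunc_cone a2' b2') ?F"
  note v = v1[unfolded voiculescu_cones_def] v2[unfolded voiculescu_cones_def]
  define A where "A = max a1' a2'"
  define B where "B = max b1' b2'"
  define U where "U = trunc_cone a1 b1 \<inter> trunc_cone a2 b2"
  have A0: "0 < A" using v by (auto simp: A_def)
  obtain Y1 where Y1: "0 < Y1" "\<And>y w. \<lbrakk>Y1 < y; w \<in> trunc_cone a1' b1'; ?F w = Complex 0 y\<rbrakk> \<Longrightarrow> w \<in> trunc_cone A B"
    using preimage_of_imaginary_axis_in_cone[of a1' b1' A B] v A0 by blast
  obtain Y2 where Y2: "0 < Y2" "\<And>y w. \<lbrakk>Y2 < y; w \<in> trunc_cone a2' b2'; ?F w = Complex 0 y\<rbrakk> \<Longrightarrow> w \<in> trunc_cone A B"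
    using preimage_of_imaginary_axis_in_cone[of a2' b2' A B] v A0 by blast
  define Y where "Y = Max {Y1, Y2, b1, b2}"
  have Y: "Y1 \<le> Y" "Y2 \<le> Y" "b1 \<le> Y" "b2 \<le> Y" "0 < Y" using Y1(1) by (auto simp: Y_def less_max_iff_disj)
  define L where "L = Complex 0 ` {Y<..}"
  have eq: "?g1 w - ?g2 w = 0" if wL: "w \<in> L" for w
  proof -
    obtain y where y: "w = Complex 0 y" "Y < y" using wL unfolding L_def by blast
    have "w \<in> trunc_cone a1 b1" "w \<in> trunc_cone a2 b2"
      using y Y by (auto intro!: imaginary_in_trunc_cone)
    then have "w \<in> ?F ` trunc_cone a1' b1'" "w \<in> ?F ` trunc_cone a2' b2'" using v by auto
    then have 1: "?g1 w \<in> trunc_cone a1' b1'" "?F (?g1 w) = w" and 2: "?g2 w \<in> trunc_cone a2' b2'" "?F (?g2 w) = w"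
      by (auto intro: inv_into_into f_inv_into_f)
    have "?g2 w \<in> trunc_cone A B" using Y2(2)[of y "?g2 w"] 2 y Y by auto
    then have "?g2 w \<in> trunc_cone a1' b1'"
      using trunc_cone_mono[of a1' A b1' B] by (auto simp: A_def B_def)
    then have "?g1 w = ?g2 w" using v 1 2 inj_onD[of ?F "trunc_cone a1' b1'" "?g1 w" "?g2 w"] by auto
    then show ?thesis by simp
  qed
  have "?g1 z - ?g2 z = 0"
  proof (rule analytic_continuation[of "\<lambda>w. ?g1 w - ?g2 w" U L "Complex 0 (Y + 1)"])
    show "(\<lambda>w. ?g1 w - ?g2 w) holomorphic_on U"
      unfolding U_def
      by (intro holomorphic_on_diff holomorphic_on_subset[OF holomorphic_local_inverse[OF v1]]
            holomorphic_on_subset[OF holomorphic_local_inverse[OF v2]]) auto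
    show "open U" unfolding U_def by (intro open_Int open_trunc_cone)
    show "connected U" unfolding U_def
      by (intro convex_connected convex_Int convex_trunc_cone) (use v in auto)
    show "L \<subseteq> U" using Y by (auto simp: L_def U_def intro!: imaginary_in_trunc_cone)
    show "Complex 0 (Y + 1) \<in> U" using Y by (auto simp: U_def intro!: imaginary_in_trunc_cone)
    show "Complex 0 (Y + 1) islimpt L"
    proof (rule connected_imp_perfect)
      have "L = (\<lambda>y. of_real y * \<i>) ` {Y<..}" unfolding L_def by (rule image_cong) (auto simp: complex_eq_iff)
      moreover have "connected ((\<lambda>y. complex_of_real y * \<i>) ` {Y<..})"
        by (intro connected_continuous_image continuous_intros) auto
      ultimately show "connected L" by simp
      show "Complex 0 (Y + 1) \<in> L" by (auto simp: L_def)
      have "Complex 0 (Y + 1) \<in> L" "Complex 0 (Y + 2) \<in> L" by (auto simp: L_def)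
      moreover have "Complex 0 (Y + 1) \<noteq> Complex 0 (Y + 2)" by simp
      ultimately show "L \<noteq> {x}" for x by (metis singletonD)
    qed
    show "z \<in> U" using z by (simp add: U_def)
  qed (use eq in auto)
  then show ?thesis by simp
qed

lemma voiculescu_eq_local_inverse:
  assumes v: "voiculescu_cones M a b a' b'" and z: "z \<in> trunc_cone a b"
  shows "voiculescu M z = inv_into (trunc_cone a' b') (recip_cauchy_transform M) z - z"
  unfolding voiculescu_def
proof (rule the_equality, goal_cases)
  case 1
  show ?case using v z by blast
next
  case (2 w)
  then obtain c d c' d' where *: "voiculescu_cones M c d c' d'" "z \<in> trunc_cone c d"
      "w = inv_into (trunc_cone c' d') (recip_cauchy_transform M) z - z"
    by blast
  from local_inverses_agree[OF *(1) v *(2) z] *(3) show ?case by simp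
qed

lemma voiculescu_domain_contains_cone:
  obtains b where "0 < b" "trunc_cone 2 b \<subseteq> voiculescu_domain M"
proof -
  obtain b b' where v: "voiculescu_cones M 2 b 1 b'" by (rule voiculescu_cones_exist)
  then have "trunc_cone 2 b \<subseteq> voiculescu_domain M" unfolding voiculescu_domain_def by blast
  moreover have "0 < b" using v by (simp add: voiculescu_cones_def)
  ultimately show thesis by (rule that[rotated])
qed

text \<open>
  The analytic form of a generating pair. It involves neither cones nor local inverses: by the
  identity theorem the relation \<open>F\<^sup>-\<^sup>1 = id + \<phi>\<close>, valid high up in a cone, becomes the
  subordination equation \<open>F + \<phi> \<circ> F = id\<close> on the whole half-plane.
\<close>

lemma subordination_equation:
  assumes \<eta>: "finite_borel_measure \<eta>"
    and eq: "\<And>z. z \<in> trunc_cone 2 B \<Longrightarrow> voiculescu M z = pick_function \<gamma> \<eta> z"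
    and z: "0 < Im z"
  shows "recip_cauchy_transform M z + pick_function \<gamma> \<eta> (recip_cauchy_transform M z) = z"
proof -
  let ?F = "recip_cauchy_transform M"
  obtain b b' where v: "voiculescu_cones M 2 b 1 b'" by (rule voiculescu_cones_exist)
  define c where "c = max b (max B 0)"
  define W where "W = trunc_cone 1 b' \<inter> ?F -` trunc_cone 2 c"
  have sub: "trunc_cone 2 c \<subseteq> trunc_cone 2 b" "trunc_cone 2 c \<subseteq> trunc_cone 2 B"
    by (rule trunc_cone_mono; simp add: c_def)+
  have inj: "inj_on ?F (trunc_cone 1 b')" and cov: "trunc_cone 2 b \<subseteq> ?F ` trunc_cone 1 b'"
    using v by (auto simp: voiculescu_cones_def)
  have eqW: "?F w + pick_function \<gamma> \<eta> (?F w) - w = 0" if "w \<in> W" for w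
  proof -
    have w: "w \<in> trunc_cone 1 b'" "?F w \<in> trunc_cone 2 c" using that by (auto simp: W_def)
    have "pick_function \<gamma> \<eta> (?F w) = inv_into (trunc_cone 1 b') ?F (?F w) - ?F w"
      using eq[OF subsetD[OF sub(2) w(2)]] voiculescu_eq_local_inverse[OF v subsetD[OF sub(1) w(2)]]
      by simp
    then show ?thesis using inv_into_f_f[OF inj w(1)] by simp
  qed
  have "continuous_on (trunc_cone 1 b') ?F"
    by (rule continuous_on_subset[OF holomorphic_on_imp_continuous_on[OF holomorphic_recip_cauchy_transform]
          trunc_cone_subset_upper_half_plane])
  then have "open W" unfolding W_def
    by (rule continuous_open_preimage[OF _ open_trunc_cone open_trunc_cone])
  have "Complex 0 (c + 1) \<in> trunc_cone 2 c" by (rule imaginary_in_trunc_cone) (auto simp: c_def)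
  then obtain w0 where w0: "w0 \<in> W" using sub cov unfolding W_def by force
  have W_sub: "W \<subseteq> upper_half_plane" using trunc_cone_subset_upper_half_plane by (auto simp: W_def)
  have "?F z + pick_function \<gamma> \<eta> (?F z) - z = 0"
  proof (rule analytic_continuation[of "\<lambda>w. ?F w + pick_function \<gamma> \<eta> (?F w) - w" upper_half_plane W w0])
    have "(pick_function \<gamma> \<eta> \<circ> ?F) holomorphic_on upper_half_plane"
      by (rule holomorphic_on_compose_gen[OF holomorphic_recip_cauchy_transform
            finite_borel_measure.holomorphic_pick_function[OF \<eta>]])
         (use recip_in_upper_half_plane in auto)
    then show "(\<lambda>w. ?F w + pick_function \<gamma> \<eta> (?F w) - w) holomorphic_on upper_half_plane"
      unfolding o_def by (intro holomorphic_intros holomorphic_recip_cauchy_transform)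
    show "w0 islimpt W" using \<open>open W\<close> w0 by (rule open_imp_islimpt)
  qed (use open_upper_half_plane connected_upper_half_plane W_sub w0 eqW z in \<open>auto simp: upper_half_plane_def\<close>)
  then show ?thesis by simp
qed

end

section \<open>Continuity of the correspondence between measures and generating pairs\<close>

lemma pick_kernel_diff:
  assumes "0 < Im z" "0 < Im w"
  shows "(1 + complex_of_real x * z) / (z - complex_of_real x) -
         (1 + complex_of_real x * w) / (w - complex_of_real x) =
         (w - z) * (complex_of_real (1 + x\<^sup>2) / ((z - complex_of_real x) * (w - complex_of_real x)))"
proof -
  have "z - complex_of_real x \<noteq> 0" "w - complex_of_real x \<noteq> 0"
    using Im_pos_imp_ne_of_real assms by blast+
  then have "(1 + complex_of_real x * z) / (z - complex_of_real x) -
         (1 + complex_of_real x * w) / (w - complex_of_real x) =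
      ((1 + complex_of_real x * z) * (w - complex_of_real x) - (1 + complex_of_real x * w) * (z - complex_of_real x)) /
      ((z - complex_of_real x) * (w - complex_of_real x))"
    by (rule diff_frac_eq)
  also have "(1 + complex_of_real x * z) * (w - complex_of_real x) - (1 + complex_of_real x * w) * (z - complex_of_real x) =
      (w - z) * complex_of_real (1 + x\<^sup>2)"
    by (simp add: algebra_simps power2_eq_square)
  finally show ?thesis by simp
qed

text \<open>
  The solution in \<open>\<complex>\<^sup>+\<close> of \<open>w + \<phi>(w) = z\<close> is unique. Two solutions would satisfy
  \<open>\<integral> (1 + x\<^sup>2) / ((w\<^sub>1 - x) (w\<^sub>2 - x)) d\<eta> = 1\<close>, but by the arithmetic-geometric mean inequality the
  modulus of the left-hand side is at most the mean of \<open>- Im \<phi>(w\<^sub>i) / Im w\<^sub>i = 1 - Im z / Im w\<^sub>i\<close>,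
  which is less than \<open>1\<close>.
\<close>

lemma (in finite_borel_measure) subordination_unique:
  assumes w: "0 < Im w1" "0 < Im w2" and z: "0 < Im z"
    and eq: "w1 + pick_function \<gamma> M w1 = z" "w2 + pick_function \<gamma> M w2 = z"
  shows "w1 = w2"
proof (rule ccontr)
  assume ne: "w1 \<noteq> w2"
  let ?p = "\<lambda>w x. (1 + x\<^sup>2) / (norm (w - complex_of_real x))\<^sup>2"
  let ?k = "\<lambda>x. complex_of_real (1 + x\<^sup>2) / ((w1 - complex_of_real x) * (w2 - complex_of_real x))"
  have p_eq: "(\<integral>x. ?p w x \<partial>M) = 1 - Im z / Im w" if "0 < Im w" "w + pick_function \<gamma> M w = z" for w
  proof -
    have "Im z = Im w + Im (pick_function \<gamma> M w)" using that(2) by auto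
    then show ?thesis unfolding Im_pick_function[OF that(1)] using that(1) by (simp add: field_simps)
  qed
  have "pick_function \<gamma> M w1 - pick_function \<gamma> M w2 =
      (\<integral>x. (1 + complex_of_real x * w1) / (w1 - complex_of_real x) \<partial>M) -
      (\<integral>x. (1 + complex_of_real x * w2) / (w2 - complex_of_real x) \<partial>M)"
    unfolding pick_function_def by simp
  also have "\<dots> = (\<integral>x. (1 + complex_of_real x * w1) / (w1 - complex_of_real x) -
                     (1 + complex_of_real x * w2) / (w2 - complex_of_real x) \<partial>M)"
    by (rule Bochner_Integration.integral_diff[symmetric, OF integrable_pick_kernel[OF w(1)] integrable_pick_kernel[OF w(2)]])
  also have "\<dots> = (w2 - w1) * (\<integral>x. ?k x \<partial>M)"
    by (simp only: pick_kernel_diff[OF w] integral_mult_right_zero)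
  finally have diff: "pick_function \<gamma> M w1 - pick_function \<gamma> M w2 = (w2 - w1) * (\<integral>x. ?k x \<partial>M)" .
  have "pick_function \<gamma> M w1 = z - w1" "pick_function \<gamma> M w2 = z - w2"
    using eq by (simp_all add: eq_diff_eq add.commute)
  then have "pick_function \<gamma> M w1 - pick_function \<gamma> M w2 = (w2 - w1) * 1" by simp
  with diff have "(w2 - w1) * (\<integral>x. ?k x \<partial>M) = (w2 - w1) * 1" by (simp only:)
  then have one: "(\<integral>x. ?k x \<partial>M) = 1"
    using ne by (simp only: mult_cancel_left) auto
  have "norm (\<integral>x. ?k x \<partial>M) \<le> (\<integral>x. (?p w1 x + ?p w2 x) / 2 \<partial>M)"
  proof (rule Bochner_Integration.integral_norm_bound_integral)
    have "integrable M (\<lambda>x. (1 / (w2 - w1)) * ((w2 - w1) * ?k x))"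
      unfolding pick_kernel_diff[OF w, symmetric]
      by (intro integrable_mult_right Bochner_Integration.integrable_diff integrable_pick_kernel w)
    then show "integrable M ?k" using ne by simp
    show "integrable M (\<lambda>x. (?p w1 x + ?p w2 x) / 2)"
      by (intro integrable_divide Bochner_Integration.integrable_add integrable_weighted_poisson w)
    fix x
    have "norm (?k x) = (1 + x\<^sup>2) * (inverse (norm (w1 - complex_of_real x)) * inverse (norm (w2 - complex_of_real x)))"
    proof -
      have "norm (complex_of_real (1 + x\<^sup>2)) = 1 + x\<^sup>2" by (simp only: norm_of_real) simp
      then show ?thesis by (simp only: norm_divide norm_mult norm_inverse divide_inverse inverse_mult_distrib)
    qed
    also have "\<dots> \<le> (1 + x\<^sup>2) * (((inverse (norm (w1 - complex_of_real x)))\<^sup>2 + (inverse (norm (w2 - complex_of_real x)))\<^sup>2) / 2)"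
    proof (rule mult_left_mono)
      have "a * b \<le> (a\<^sup>2 + b\<^sup>2) / 2" for a b :: real
        using sum_squares_bound[of a b] by simp
      then show "inverse (norm (w1 - complex_of_real x)) * inverse (norm (w2 - complex_of_real x)) \<le>
         ((inverse (norm (w1 - complex_of_real x)))\<^sup>2 + (inverse (norm (w2 - complex_of_real x)))\<^sup>2) / 2" .
    qed simp
    also have "\<dots> = (?p w1 x + ?p w2 x) / 2"
    proof -
      have "q * ((u + v) / 2) = (q * u + q * v) / 2" for q u v :: real
        by (simp add: distrib_left)
      then show ?thesis by (simp only: divide_inverse[of _ "_\<^sup>2"] power_inverse)
    qed
    finally show "norm (?k x) \<le> (?p w1 x + ?p w2 x) / 2" .
  qed
  also have "\<dots> = ((\<integral>x. ?p w1 x \<partial>M) + (\<integral>x. ?p w2 x \<partial>M)) / 2"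
    by (simp only: integral_divide_zero Bochner_Integration.integral_add[OF integrable_weighted_poisson[OF w(1)] integrable_weighted_poisson[OF w(2)]])
  also have "\<dots> < 1"
    unfolding p_eq[OF w(1) eq(1)] p_eq[OF w(2) eq(2)]
    using divide_pos_pos[OF z w(1)] divide_pos_pos[OF z w(2)] by simp
  finally show False unfolding one by simp
qed

text \<open>
  Suppose the pairs converge and let \<open>w = F(z)\<close>. The points \<open>z\<^sub>n = w + \<phi>\<^sub>n(w)\<close> tend to \<open>z\<close>, and
  by uniqueness \<open>F\<^sub>n(z\<^sub>n) = w\<close>, that is \<open>G\<^sub>n(z\<^sub>n) = G(z)\<close>. Equicontinuity moves the argument
  back to \<open>z\<close>.
\<close>

theorem measures_converge_if_generating_pairs_converge:
  assumes \<mu>: "\<And>n. real_distribution (\<mu> n)" and \<nu>: "real_distribution \<nu>"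
    and \<eta>: "\<And>n. finite_borel_measure (\<eta> n)" and \<eta>': "finite_borel_measure \<eta>'"
    and sub_n: "\<And>n z. 0 < Im z \<Longrightarrow> recip_cauchy_transform (\<mu> n) z +
       pick_function (\<gamma> n) (\<eta> n) (recip_cauchy_transform (\<mu> n) z) = z"
    and sub: "\<And>z. 0 < Im z \<Longrightarrow> recip_cauchy_transform \<nu> z +
       pick_function \<gamma>' \<eta>' (recip_cauchy_transform \<nu> z) = z"
    and \<gamma>: "\<gamma> \<longlonglongrightarrow> \<gamma>'" and wc: "weakly_converges UNIV \<eta> \<eta>'"
  shows "weakly_converges UNIV \<mu> \<nu>"
proof -
  have fb: "\<And>n. finite_borel_measure (\<mu> n)" "finite_borel_measure \<nu>"
    by (intro real_distribution.finite_borel_measure_M \<mu> \<nu>)+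
  have mass: "measure (\<mu> n) UNIV = 1" "measure \<nu> UNIV = 1" for n
    by (intro real_distribution.measure_UNIV_eq_1 \<mu> \<nu>)+
  show ?thesis
  proof (rule weakly_converges_if_cauchy_transform_converges[OF fb])
    show "(\<lambda>n. measure (\<mu> n) UNIV) \<longlonglongrightarrow> measure \<nu> UNIV" by (simp add: mass)
    fix z assume z: "0 < Im z"
    define w where "w = recip_cauchy_transform \<nu> z"
    have w: "0 < Im w" unfolding w_def by (rule real_distribution.Im_recip_cauchy_transform_pos[OF \<nu> z])
    define \<zeta> where "\<zeta> n = w + pick_function (\<gamma> n) (\<eta> n) w" for n
    have "\<zeta> \<longlonglongrightarrow> w + pick_function \<gamma>' \<eta>' w"
      unfolding \<zeta>_def by (intro tendsto_intros pick_function_tendsto[OF wc \<gamma> \<eta> \<eta>' w w tendsto_const])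
    then have \<zeta>: "\<zeta> \<longlonglongrightarrow> z" using sub[OF z] unfolding w_def by simp
    define \<zeta>' where "\<zeta>' n = (if 0 < Im (\<zeta> n) then \<zeta> n else z)" for n
    have ev: "\<forall>\<^sub>F n in sequentially. 0 < Im (\<zeta> n)"
      using tendsto_Im[OF \<zeta>] z by (rule order_tendstoD)
    then have "\<forall>\<^sub>F n in sequentially. \<zeta> n = \<zeta>' n"
      by eventually_elim (simp add: \<zeta>'_def)
    with \<zeta> have \<zeta>': "\<zeta>' \<longlonglongrightarrow> z" by (rule Lim_transform_eventually)
    have pos: "0 < Im (\<zeta>' n)" for n using z by (simp add: \<zeta>'_def)
    have "\<forall>\<^sub>F n in sequentially. cauchy_transform \<nu> z = cauchy_transform (\<mu> n) (\<zeta>' n)"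
      using ev
    proof eventually_elim
      case (elim n)
      have "recip_cauchy_transform (\<mu> n) (\<zeta> n) = w"
        by (rule finite_borel_measure.subordination_unique[OF \<eta> _ w elim sub_n[OF elim]])
           (simp_all add: \<zeta>_def real_distribution.Im_recip_cauchy_transform_pos[OF \<mu> elim[unfolded \<zeta>_def]])
      then show ?case using elim unfolding w_def recip_cauchy_transform_def \<zeta>'_def by simp
    qed
    then have "(\<lambda>n. cauchy_transform (\<mu> n) (\<zeta>' n)) \<longlonglongrightarrow> cauchy_transform \<nu> z"
      by (rule Lim_transform_eventually[OF tendsto_const])
    moreover have "(\<lambda>n. cauchy_transform (\<mu> n) (\<zeta>' n) - cauchy_transform (\<mu> n) z) \<longlonglongrightarrow> 0"
      by (rule cauchy_transform_equicontinuous[OF fb(1) _ pos z \<zeta>', where C = 1]) (simp add: mass)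
    ultimately have "(\<lambda>n. cauchy_transform (\<mu> n) (\<zeta>' n) - (cauchy_transform (\<mu> n) (\<zeta>' n) - cauchy_transform (\<mu> n) z))
         \<longlonglongrightarrow> cauchy_transform \<nu> z - 0"
      by (rule tendsto_diff)
    then show "(\<lambda>n. cauchy_transform (\<mu> n) z) \<longlonglongrightarrow> cauchy_transform \<nu> z" by simp
  qed
qed

text \<open>
  Conversely, \<open>F\<^sub>n(z) \<rightarrow> F(z)\<close> gives \<open>\<phi>\<^sub>n(F\<^sub>n(z)) = z - F\<^sub>n(z) \<rightarrow> \<phi>(F(z))\<close>; this bounds the masses,
  so \<open>\<phi>\<^sub>n \<rightarrow> \<phi>\<close> on the range of \<open>F\<close>. The range accumulates at each of its points because
  \<open>F\<close> is injective.
\<close>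

theorem generating_pairs_converge_if_measures_converge:
  assumes \<mu>: "\<And>n. real_distribution (\<mu> n)" and \<nu>: "real_distribution \<nu>"
    and \<eta>: "\<And>n. finite_borel_measure (\<eta> n)" and \<eta>': "finite_borel_measure \<eta>'"
    and sub_n: "\<And>n z. 0 < Im z \<Longrightarrow> recip_cauchy_transform (\<mu> n) z +
       pick_function (\<gamma> n) (\<eta> n) (recip_cauchy_transform (\<mu> n) z) = z"
    and sub: "\<And>z. 0 < Im z \<Longrightarrow> recip_cauchy_transform \<nu> z +
       pick_function \<gamma>' \<eta>' (recip_cauchy_transform \<nu> z) = z"
    and wc: "weakly_converges UNIV \<mu> \<nu>"
  shows "\<gamma> \<longlonglongrightarrow> \<gamma>'" "weakly_converges UNIV \<eta> \<eta>'"
proof -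
  let ?F = "recip_cauchy_transform \<nu>"
  define A where "A = ?F ` upper_half_plane"
  have fb: "\<And>n. finite_borel_measure (\<mu> n)" "finite_borel_measure \<nu>"
    by (intro real_distribution.finite_borel_measure_M \<mu> \<nu>)+
  have conv: "(\<lambda>n. pick_function (\<gamma> n) (\<eta> n) w) \<longlonglongrightarrow> pick_function \<gamma>' \<eta>' w" if "w \<in> A" for w
  proof -
    from that obtain z where z: "0 < Im z" and wz: "w = ?F z"
      unfolding A_def upper_half_plane_def by blast
    define \<omega> where "\<omega> n = recip_cauchy_transform (\<mu> n) z" for n
    have w: "0 < Im w" unfolding wz by (rule real_distribution.Im_recip_cauchy_transform_pos[OF \<nu> z])
    have \<omega>_pos: "0 < Im (\<omega> n)" for n
      unfolding \<omega>_def by (rule real_distribution.Im_recip_cauchy_transform_pos[OF \<mu> z])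
    have \<omega>: "\<omega> \<longlonglongrightarrow> w"
      unfolding \<omega>_def wz recip_cauchy_transform_def
      by (intro tendsto_intros weakly_converges_cauchy_transform[OF wc fb z]
            real_distribution.cauchy_transform_nonzero[OF \<nu> z])
    have pick_n: "pick_function (\<gamma> n) (\<eta> n) (\<omega> n) = z - \<omega> n" for n
      using sub_n[OF z, of n] unfolding \<omega>_def by (simp add: algebra_simps)
    define h where "h n = 2 * (1 + (norm (\<omega> n))\<^sup>2) * - Im (z - \<omega> n) / Im (\<omega> n)" for n
    have "h \<longlonglongrightarrow> 2 * (1 + (norm w)\<^sup>2) * - Im (z - w) / Im w"
      unfolding h_def by (intro tendsto_intros \<omega>) (use w in auto)
    then obtain C where C: "\<And>n. \<bar>h n\<bar> \<le> C" using convergent_bounded_above by blast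
    have "measure (\<eta> n) UNIV \<le> C" for n
    proof -
      have "Im (\<omega> n) * measure (\<eta> n) UNIV \<le> 2 * (1 + (norm (\<omega> n))\<^sup>2) * - Im (z - \<omega> n)"
        using finite_borel_measure.mass_le_Im_pick_function[OF \<eta> \<omega>_pos, of n n "\<gamma> n"] unfolding pick_n .
      then have "measure (\<eta> n) UNIV \<le> h n"
        unfolding h_def using \<omega>_pos[of n] by (simp add: pos_le_divide_eq mult.commute)
      also have "\<dots> \<le> C" using C[of n] by simp
      finally show ?thesis .
    qed
    then have "(\<lambda>n. pick_function (\<gamma> n) (\<eta> n) (\<omega> n) - pick_function (\<gamma> n) (\<eta> n) w) \<longlonglongrightarrow> 0"
      by (rule pick_function_equicontinuous[OF \<eta> _ \<omega>_pos w \<omega>])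
    moreover have "(\<lambda>n. pick_function (\<gamma> n) (\<eta> n) (\<omega> n)) \<longlonglongrightarrow> z - w"
      unfolding pick_n by (intro tendsto_intros \<omega>)
    ultimately have "(\<lambda>n. pick_function (\<gamma> n) (\<eta> n) (\<omega> n) -
        (pick_function (\<gamma> n) (\<eta> n) (\<omega> n) - pick_function (\<gamma> n) (\<eta> n) w)) \<longlonglongrightarrow> z - w - 0"
      by (intro tendsto_diff)
    moreover have "z - w = pick_function \<gamma>' \<eta>' w" using sub[OF z] unfolding wz by (simp add: algebra_simps)
    ultimately show ?thesis by simp
  qed
  have A_sub: "A \<subseteq> upper_half_plane"
    unfolding A_def using real_distribution.recip_in_upper_half_plane[OF \<nu>] by blast
  have conA: "connected A"
    unfolding A_def
    by (intro connected_continuous_image holomorphic_on_imp_continuous_on connected_upper_half_plane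
          real_distribution.holomorphic_recip_cauchy_transform \<nu>)
  have "\<i> \<in> upper_half_plane" "2 * \<i> \<in> upper_half_plane" by (auto simp: upper_half_plane_def)
  then have mem: "?F \<i> \<in> A" "?F (2 * \<i>) \<in> A" by (auto simp: A_def)
  have "?F \<i> \<noteq> ?F (2 * \<i>)"
  proof
    assume "?F \<i> = ?F (2 * \<i>)"
    then have "?F \<i> + pick_function \<gamma>' \<eta>' (?F \<i>) = ?F (2 * \<i>) + pick_function \<gamma>' \<eta>' (?F (2 * \<i>))"
      by (simp only:)
    then have "\<i> = 2 * \<i>" by (subst (asm) (1 2) sub) simp_all
    then show False by (simp add: complex_eq_iff)
  qed
  then have "A \<noteq> {x}" for x using mem by (metis singletonD)
  with conA mem(1) have lp: "?F \<i> islimpt A" by (rule connected_imp_perfect)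
  have mem': "?F \<i> \<in> upper_half_plane" using mem(1) A_sub by (rule subsetD[rotated])
  note * = generating_pair_converges_if_pick_function_converges[OF \<eta> \<eta>' A_sub mem' lp conv]
  show "\<gamma> \<longlonglongrightarrow> \<gamma>'" by (rule *(1))
  show "weakly_converges UNIV \<eta> \<eta>'" by (rule *(2))
qed

section \<open>Generating families\<close>

text \<open>Increments of a generating family are formed as differences of measures.\<close>

lemma finite_borel_measure_diff_measure:
  assumes M: "finite_borel_measure M" and N: "finite_borel_measure N"
    and le: "\<forall>B\<in>sets borel. emeasure N B \<le> emeasure M B"
  shows "finite_borel_measure (diff_measure M N)"
    and "B \<in> sets borel \<Longrightarrow> emeasure (diff_measure M N) B = emeasure M B - emeasure N B"
proof -
  interpret M: finite_borel_measure M by fact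
  interpret N: finite_borel_measure N by fact
  show em: "emeasure (diff_measure M N) B = emeasure M B - emeasure N B" if "B \<in> sets borel" for B
    by (rule emeasure_diff_measure)
       (use that le M.M_is_borel N.M_is_borel M.finite_measure_axioms N.finite_measure_axioms in auto)
  show "finite_borel_measure (diff_measure M N)"
  proof (intro finite_borel_measure.intro finite_measureI finite_borel_measure_axioms.intro)
    show "sets (diff_measure M N) = sets borel" by (simp add: M.M_is_borel)
    have "emeasure (diff_measure M N) UNIV \<le> emeasure M UNIV"
      by (subst em) (auto intro: diff_le_self_ennreal)
    then show "emeasure (diff_measure M N) (space (diff_measure M N)) \<noteq> \<infinity>"
      using M.emeasure_finite[of UNIV] by (auto simp: M.space_M_UNIV top_unique)
  qed
qed

lemma nn_integral_diff_measure:
  assumes M: "finite_borel_measure M" and N: "finite_borel_measure N"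
    and le: "\<forall>B\<in>sets borel. emeasure N B \<le> emeasure M B"
    and f: "f \<in> borel_measurable borel"
  shows "(\<integral>\<^sup>+x. f x \<partial>M) = (\<integral>\<^sup>+x. f x \<partial>N) + (\<integral>\<^sup>+x. f x \<partial>diff_measure M N)"
proof -
  note D = finite_borel_measure_diff_measure[OF M N le]
  have sets [measurable_cong]: "sets M = sets borel" "sets N = sets borel" "sets (diff_measure M N) = sets borel"
    by (rule finite_borel_measure.M_is_borel, fact M N D(1))+
  show ?thesis
    using f
  proof (induct rule: borel_measurable_induct)
    case (cong f g)
    then have "f = g" by auto
    with cong show ?case by simp
  next
    case (set A)
    then show ?case using sets D(2) le by (simp add: add_diff_inverse_ennreal)
  next
    case (mult u c)
    then show ?case by (simp add: nn_integral_cmult distrib_left)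
  next
    case (add u v)
    then show ?case by (simp add: nn_integral_add ac_simps)
  next
    case (seq U)
    have inc: "incseq (\<lambda>i. \<integral>\<^sup>+x. U i x \<partial>L)" for L
      using seq(4) by (auto simp: incseq_def le_fun_def intro!: nn_integral_mono)
    have S: "(\<integral>\<^sup>+x. (SUP i. U i) x \<partial>L) = (SUP i. \<integral>\<^sup>+x. U i x \<partial>L)" if [measurable_cong]: "sets L = sets borel" for L
      unfolding SUP_apply
      by (rule nn_integral_monotone_convergence_SUP[OF seq(4)])
         (simp add: seq(1) measurable_cong_sets[OF that refl])
    have "(SUP i. \<integral>\<^sup>+x. U i x \<partial>M) = (SUP i. (\<integral>\<^sup>+x. U i x \<partial>N) + (\<integral>\<^sup>+x. U i x \<partial>diff_measure M N))"
      using seq(3) by simp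
    also have "\<dots> = (SUP i. \<integral>\<^sup>+x. U i x \<partial>N) + (SUP i. \<integral>\<^sup>+x. U i x \<partial>diff_measure M N)"
      by (rule ennreal_SUP_add[OF inc inc])
    finally show ?case by (simp only: S[OF sets(1)] S[OF sets(2)] S[OF sets(3)])
  qed
qed

lemma integral_diff_measure:
  fixes g :: "real \<Rightarrow> real"
  assumes M: "finite_borel_measure M" and N: "finite_borel_measure N"
    and le: "\<forall>B\<in>sets borel. emeasure N B \<le> emeasure M B"
    and g: "g \<in> borel_measurable borel" "\<And>x. \<bar>g x\<bar> \<le> C"
  shows "(\<integral>x. g x \<partial>diff_measure M N) = (\<integral>x. g x \<partial>M) - (\<integral>x. g x \<partial>N)"
proof -
  note D = finite_borel_measure_diff_measure(1)[OF M N le]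
  have nonneg: "(\<integral>x. h x \<partial>M) = (\<integral>x. h x \<partial>N) + (\<integral>x. h x \<partial>diff_measure M N)"
    if h: "h \<in> borel_measurable borel" "\<And>x. 0 \<le> h x" "\<And>x. h x \<le> c" for h :: "real \<Rightarrow> real" and c
  proof -
    have eq: "(\<integral>\<^sup>+x. ennreal (h x) \<partial>L) = ennreal (\<integral>x. h x \<partial>L)" if "finite_borel_measure L" for L
      by (rule nn_integral_eq_integral[OF finite_borel_measure.integrable_bounded[OF that, of _ c]])
         (use h in auto)
    have int_nn: "0 \<le> (\<integral>x. h x \<partial>L)" for L using h(2) by simp
    have "ennreal (\<integral>x. h x \<partial>M) = ennreal (\<integral>x. h x \<partial>N) + ennreal (\<integral>x. h x \<partial>diff_measure M N)"
      unfolding eq[OF M, symmetric] eq[OF N, symmetric] eq[OF D, symmetric]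
      by (rule nn_integral_diff_measure[OF M N le]) (use h(1) in measurable)
    then show ?thesis using int_nn by (simp add: ennreal_plus[symmetric] del: ennreal_plus)
  qed
  have shift: "(\<integral>x. g x + C \<partial>L) = (\<integral>x. g x \<partial>L) + (\<integral>x. C \<partial>L)" if "finite_borel_measure L" for L
  proof -
    interpret finite_borel_measure L by fact
    show ?thesis
      by (rule Bochner_Integration.integral_add[OF integrable_bounded[of g C] integrable_const]) (use g in auto)
  qed
  have C0: "0 \<le> C" using g(2)[of 0] by linarith
  have "(\<integral>x. g x + C \<partial>M) = (\<integral>x. g x + C \<partial>N) + (\<integral>x. g x + C \<partial>diff_measure M N)"
  proof (rule nonneg)
    show "0 \<le> g x + C" "g x + C \<le> 2 * C" for x using g(2)[of x] by linarith+
  qed (use g(1) in measurable)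
  moreover have "(\<integral>x. C \<partial>M) = (\<integral>x. C \<partial>N) + (\<integral>x. C \<partial>diff_measure M N)"
    by (rule nonneg[of _ C]) (use C0 in auto)
  ultimately show ?thesis unfolding shift[OF M] shift[OF N] shift[OF D] by linarith
qed

lemma cauchy_transform_diff_measure:
  assumes M: "finite_borel_measure M" and N: "finite_borel_measure N"
    and le: "\<forall>B\<in>sets borel. emeasure N B \<le> emeasure M B" and z: "0 < Im z"
  shows "cauchy_transform (diff_measure M N) z = cauchy_transform M z - cauchy_transform N z"
proof -
  note D = finite_borel_measure_diff_measure(1)[OF M N le]
  have "\<bar>Re (1 / (z - complex_of_real x))\<bar> \<le> 1 / Im z" "\<bar>Im (1 / (z - complex_of_real x))\<bar> \<le> 1 / Im z" for x
    using order_trans[OF abs_Re_le_cmod norm_resolvent_le[OF z]]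
      order_trans[OF abs_Im_le_cmod norm_resolvent_le[OF z]] by blast+
  from integral_diff_measure[OF M N le _ this(1)] integral_diff_measure[OF M N le _ this(2)]
  show ?thesis
    by (intro complex_eqI) (simp_all only: Re_cauchy_transform_integral[OF _ z] Im_cauchy_transform_integral[OF _ z] M N D
        minus_complex.sel, simp_all)
qed

lemma pick_function_diff_measure:
  assumes M: "finite_borel_measure M" and N: "finite_borel_measure N"
    and le: "\<forall>B\<in>sets borel. emeasure N B \<le> emeasure M B" and z: "0 < Im z"
  shows "pick_function (a - b) (diff_measure M N) z = pick_function a M z - pick_function b N z"
proof -
  note D = finite_borel_measure_diff_measure(1)[OF M N le]
  have "(\<integral>x. 1 \<partial>diff_measure M N) = (\<integral>x. 1 \<partial>M) - (\<integral>x. (1::real) \<partial>N)"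
    by (rule integral_diff_measure[OF M N le, of _ 1]) auto
  then have mass: "measure (diff_measure M N) UNIV = measure M UNIV - measure N UNIV"
    using finite_borel_measure.space_M_UNIV[OF M] finite_borel_measure.space_M_UNIV[OF N]
      finite_borel_measure.space_M_UNIV[OF D] by simp
  show ?thesis
    unfolding finite_borel_measure.pick_function_eq_cauchy[OF M z]
      finite_borel_measure.pick_function_eq_cauchy[OF N z]
      finite_borel_measure.pick_function_eq_cauchy[OF D z]
      cauchy_transform_diff_measure[OF M N le z] mass
    by (simp add: algebra_simps)
qed

lemma weakly_converges_diff_measure:
  assumes M: "\<And>n. finite_borel_measure (M n)" "finite_borel_measure M'"
    and N: "\<And>n. finite_borel_measure (N n)" "finite_borel_measure N'"
    and le: "\<And>n. \<forall>B\<in>sets borel. emeasure (N n) B \<le> emeasure (M n) B"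
      "\<forall>B\<in>sets borel. emeasure N' B \<le> emeasure M' B"
    and conv: "weakly_converges UNIV M M'" "weakly_converges UNIV N N'"
  shows "weakly_converges UNIV (\<lambda>n. diff_measure (M n) (N n)) (diff_measure M' N')"
  unfolding weakly_converges_def
proof (intro allI impI)
  fix g :: "real \<Rightarrow> real" assume g: "continuous_on UNIV g \<and> bounded (range g)"
  then obtain C where C: "\<And>x. \<bar>g x\<bar> \<le> C" unfolding bounded_iff by auto
  have meas: "g \<in> borel_measurable borel" using g by (intro borel_measurable_continuous_onI) simp
  show "(\<lambda>n. \<integral>x. g x \<partial>diff_measure (M n) (N n)) \<longlonglongrightarrow> (\<integral>x. g x \<partial>diff_measure M' N')"
    unfolding integral_diff_measure[OF M(1) N(1) le(1) meas C] integral_diff_measure[OF M(2) N(2) le(2) meas C]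
    using conv g unfolding weakly_converges_def by (intro tendsto_diff) simp_all
qed

subsection \<open>The time interval\<close>

lemma time_interval_zero: "time_interval I \<Longrightarrow> 0 \<in> I"
  and time_interval_nonneg: "time_interval I \<Longrightarrow> t \<in> I \<Longrightarrow> 0 \<le> t"
  and time_interval_closed_below: "time_interval I \<Longrightarrow> t \<in> I \<Longrightarrow> 0 \<le> s \<Longrightarrow> s \<le> t \<Longrightarrow> s \<in> I"
  unfolding time_interval_def by auto

lemma time_interval_cofinal_sequence:
  assumes "time_interval I"
  obtains T :: "nat \<Rightarrow> real" where "\<And>n. T n \<in> I" "\<And>t. t \<in> I \<Longrightarrow> \<exists>n. t \<le> T n"
proof -
  consider "I = {0..}" | b where "b > 0" "I = {0..<b}" | b where "b > 0" "I = {0..b}"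
    using assms unfolding time_interval_def by blast
  then show thesis
  proof cases
    case 1
    then show thesis using that[of real] real_arch_simple by auto
  next
    case 2
    have "\<exists>n. t \<le> b - b / real (Suc n)" if tb: "t < b" for t
    proof -
      obtain n where "inverse (real (Suc n)) < (b - t) / b"
        using reals_Archimedean[of "(b - t) / b"] tb 2 by auto
      then have "t \<le> b - b / real (Suc n)" using 2 by (simp add: field_simps)
      then show ?thesis ..
    qed
    then show thesis using that[of "\<lambda>n. b - b / real (Suc n)"] 2 by (auto simp: field_simps)
  next
    case 3
    then show thesis using that[of "\<lambda>_. b"] by auto
  qed
qed

lemma compact_subset_time_interval:
  assumes I: "time_interval I" and K: "compact K" "K \<subseteq> I"
  obtains T where "T \<in> I" "K \<subseteq> {0..T}"
proof (cases "K = {}")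
  case True
  then show thesis using that[OF time_interval_zero[OF I]] by simp
next
  case False
  then obtain T where "T \<in> K" "\<And>t. t \<in> K \<Longrightarrow> t \<le> T" using compact_attains_sup[OF K(1)] by blast
  then have "T \<in> I" "K \<subseteq> {0..T}" using K(2) time_interval_nonneg[OF I] by auto
  then show thesis by (rule that)
qed

lemma fine_grid:
  fixes T d :: real
  assumes "0 \<le> T" "0 < d"
  obtains N :: nat and g :: "nat \<Rightarrow> real" where "g 0 = 0" "g N = T" "mono g" "\<And>i. g i \<in> {0..T}"
    "\<And>i. g (Suc i) - g i \<le> d"
proof -
  define N where "N = nat \<lceil>T / d\<rceil>"
  define g where "g i = min T (real i * d)" for i
  have "T / d \<le> real N" unfolding N_def by linarith
  then have "T \<le> real N * d" using assms by (simp add: field_simps)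
  then have "g N = T" by (simp add: g_def)
  moreover have "mono g" unfolding g_def using assms by (intro monoI min.mono order_refl mult_right_mono) auto
  moreover have "g (Suc i) - g i \<le> d" for i using assms by (auto simp: g_def algebra_simps min_def)
  moreover have "g 0 = 0" "g i \<in> {0..T}" for i using assms by (auto simp: g_def)
  ultimately show thesis using that by blast
qed

lemma grid_cell:
  fixes g :: "nat \<Rightarrow> real"
  assumes "g 0 < t" "t \<le> g N"
  obtains i where "i < N" "g i < t" "t \<le> g (Suc i)"
  using assms
proof (induction N arbitrary: thesis)
  case (Suc N)
  show ?case
  proof (cases "t \<le> g N")
    case True
    then show ?thesis using Suc.IH[OF _ Suc.prems(2) True] Suc.prems(1) less_SucI by metis
  next
    case False
    then show ?thesis using Suc.prems(1)[of N] Suc.prems(3) by simp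
  qed
qed simp

text \<open>
  Polya's theorem. By monotonicity the values on a fine grid control those in between, up to
  the oscillation of the continuous limit on a cell.
\<close>

lemma monotone_pointwise_limit_uniform:
  fixes \<phi> :: "nat \<Rightarrow> real \<Rightarrow> real"
  assumes T: "0 \<le> T" and mono: "\<And>n. mono_on {0..T} (\<phi> n)" and cont: "continuous_on {0..T} \<psi>"
    and conv: "\<And>t. t \<in> {0..T} \<Longrightarrow> (\<lambda>n. \<phi> n t) \<longlonglongrightarrow> \<psi> t"
  shows "uniform_limit {0..T} \<phi> \<psi> sequentially"
proof (rule uniform_limitI)
  fix e :: real assume e: "0 < e"
  have "uniformly_continuous_on {0..T} \<psi>"
    by (rule compact_uniformly_continuous[OF cont compact_Icc])
  then obtain d where d: "0 < d"
    "\<And>s t. s \<in> {0..T} \<Longrightarrow> t \<in> {0..T} \<Longrightarrow> dist t s < d \<Longrightarrow> dist (\<psi> t) (\<psi> s) < e / 2"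
    unfolding uniformly_continuous_on_def using half_gt_zero[OF e] by metis
  obtain N g where g: "g 0 = 0" "g N = T" "mono g" "\<And>i. g i \<in> {0..T}" "\<And>i. g (Suc i) - g i \<le> d / 2"
    using fine_grid[OF T, of "d / 2"] d(1) by (metis half_gt_zero)
  have "\<forall>\<^sub>F n in sequentially. \<forall>i\<in>{..N}. dist (\<phi> n (g i)) (\<psi> (g i)) < e / 2"
    using conv[OF g(4)] e by (intro eventually_ball_finite ballI tendstoD) auto
  then show "\<forall>\<^sub>F n in sequentially. \<forall>t\<in>{0..T}. dist (\<phi> n t) (\<psi> t) < e"
  proof eventually_elim
    case (elim n)
    show ?case
    proof
      fix t assume t: "t \<in> {0..T}"
      show "dist (\<phi> n t) (\<psi> t) < e"
      proof (cases "t = 0")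
        case True
        then show ?thesis using elim[rule_format, of 0] g(1) e by simp
      next
        case False
        then obtain i where i: "i < N" "g i < t" "t \<le> g (Suc i)"
          using grid_cell[of g t N] t g by auto
        have near: "\<bar>\<psi> t - \<psi> (g i)\<bar> < e / 2" "\<bar>\<psi> t - \<psi> (g (Suc i))\<bar> < e / 2"
          using d(2)[OF g(4) t, of i] d(2)[OF g(4) t, of "Suc i"] g(5)[of i] i d(1)
          by (auto simp: dist_real_def)
        have "\<phi> n (g i) \<le> \<phi> n t" "\<phi> n t \<le> \<phi> n (g (Suc i))"
          using i t g(4) by (auto intro!: mono_onD[OF mono])
        moreover have "\<bar>\<phi> n (g i) - \<psi> (g i)\<bar> < e / 2" "\<bar>\<phi> n (g (Suc i)) - \<psi> (g (Suc i))\<bar> < e / 2"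
          using elim i(1) by (auto simp: dist_real_def)
        ultimately show ?thesis using near unfolding dist_real_def by linarith
      qed
    qed
  qed
qed

subsection \<open>Integrals against a generating family\<close>

locale generator =
  fixes I :: "real set" and \<gamma> :: "real \<Rightarrow> real" and \<eta> :: "real \<Rightarrow> real measure"
  assumes time: "time_interval I" and gen: "generating_family I \<gamma> \<eta>"
begin

lemma finite_borel: "t \<in> I \<Longrightarrow> finite_borel_measure (\<eta> t)"
  and eta_zero: "\<eta> 0 = null_measure borel"
  and measure_mono: "B \<in> sets borel \<Longrightarrow> s \<in> I \<Longrightarrow> t \<in> I \<Longrightarrow> s \<le> t \<Longrightarrow> measure (\<eta> s) B \<le> measure (\<eta> t) B"
  and measure_cont: "B \<in> sets borel \<Longrightarrow> continuous_on I (\<lambda>t. measure (\<eta> t) B)"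
  and gamma_cont: "continuous_on I \<gamma>"
  using gen unfolding generating_family_def by (auto dest: mono_onD)

lemma emeasure_eq: "t \<in> I \<Longrightarrow> emeasure (\<eta> t) B = ennreal (measure (\<eta> t) B)"
  using finite_borel finite_measure.emeasure_eq_measure finite_borel_measure.axioms(1) by blast

lemma emeasure_mono_time:
  "s \<in> I \<Longrightarrow> t \<in> I \<Longrightarrow> s \<le> t \<Longrightarrow> \<forall>B\<in>sets borel. emeasure (\<eta> s) B \<le> emeasure (\<eta> t) B"
  by (simp add: emeasure_eq measure_mono ennreal_leI)

lemma finite_borel_increment:
  assumes "s \<in> I" "t \<in> I" "s \<le> t"
  shows "finite_borel_measure (diff_measure (\<eta> t) (\<eta> s))"
  by (rule finite_borel_measure_diff_measure(1)) (use assms finite_borel emeasure_mono_time in auto)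

lemma integral_increment:
  fixes g :: "real \<Rightarrow> real"
  assumes "s \<in> I" "t \<in> I" "s \<le> t" "g \<in> borel_measurable borel" "\<And>x. \<bar>g x\<bar> \<le> C"
  shows "(\<integral>x. g x \<partial>diff_measure (\<eta> t) (\<eta> s)) = (\<integral>x. g x \<partial>\<eta> t) - (\<integral>x. g x \<partial>\<eta> s)"
  by (rule integral_diff_measure[OF finite_borel finite_borel emeasure_mono_time]) (use assms in auto)

lemma integral_mono_time:
  fixes g :: "real \<Rightarrow> real"
  assumes st: "s \<in> I" "t \<in> I" "s \<le> t" and g: "g \<in> borel_measurable borel" "\<And>x. 0 \<le> g x" "\<And>x. g x \<le> C"
  shows "(\<integral>x. g x \<partial>\<eta> s) \<le> (\<integral>x. g x \<partial>\<eta> t)"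
proof -
  have "0 \<le> (\<integral>x. g x \<partial>diff_measure (\<eta> t) (\<eta> s))" using g(2) by simp
  moreover have "\<bar>g x\<bar> \<le> C" for x using g(2,3)[of x] by simp
  ultimately show ?thesis using integral_increment[OF st g(1), of C] by simp
qed

lemma integral_time_continuous:
  fixes g :: "real \<Rightarrow> real"
  assumes g: "g \<in> borel_measurable borel" "\<And>x. \<bar>g x\<bar> \<le> C"
  shows "continuous_on I (\<lambda>t. \<integral>x. g x \<partial>\<eta> t)"
proof -
  have "0 \<le> C" using g(2)[of 0] by linarith
  have le: "\<bar>(\<integral>x. g x \<partial>\<eta> t) - (\<integral>x. g x \<partial>\<eta> s)\<bar> \<le> C * \<bar>measure (\<eta> t) UNIV - measure (\<eta> s) UNIV\<bar>"
    if st: "s \<in> I" "t \<in> I" "s \<le> t" for s t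
  proof -
    let ?D = "diff_measure (\<eta> t) (\<eta> s)"
    interpret D: finite_borel_measure ?D by (rule finite_borel_increment[OF st])
    have "(\<integral>x. 1 \<partial>?D) = (\<integral>x. 1 \<partial>\<eta> t) - (\<integral>x. (1::real) \<partial>\<eta> s)"
      by (rule integral_increment[OF st, of _ 1]) auto
    then have mass: "measure ?D UNIV = measure (\<eta> t) UNIV - measure (\<eta> s) UNIV"
      using finite_borel_measure.space_M_UNIV[OF finite_borel] D.space_M_UNIV st by simp
    have "norm (\<integral>x. g x \<partial>?D) \<le> C * measure ?D UNIV"
      by (rule D.norm_integral_le_mass) (use g in auto)
    then show ?thesis unfolding integral_increment[OF st g] mass
      using mass measure_nonneg[of ?D UNIV] by simp
  qed
  have le': "\<bar>(\<integral>x. g x \<partial>\<eta> t) - (\<integral>x. g x \<partial>\<eta> s)\<bar> \<le> C * \<bar>measure (\<eta> t) UNIV - measure (\<eta> s) UNIV\<bar>"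
    if "s \<in> I" "t \<in> I" for s t
    using le[of s t] le[of t s] that by (cases "s \<le> t") (auto simp: abs_minus_commute)
  show ?thesis
    unfolding continuous_on_def
  proof
    fix s assume s: "s \<in> I"
    have "((\<lambda>t. measure (\<eta> t) UNIV) \<longlongrightarrow> measure (\<eta> s) UNIV) (at s within I)"
      using measure_cont[of UNIV] s unfolding continuous_on_def by simp
    then have "((\<lambda>t. C * \<bar>measure (\<eta> t) UNIV - measure (\<eta> s) UNIV\<bar>) \<longlongrightarrow> C * \<bar>measure (\<eta> s) UNIV - measure (\<eta> s) UNIV\<bar>) (at s within I)"
      by (intro tendsto_intros)
    then have lim: "((\<lambda>t. C * \<bar>measure (\<eta> t) UNIV - measure (\<eta> s) UNIV\<bar>) \<longlongrightarrow> 0) (at s within I)" by simp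
    have "((\<lambda>t. (\<integral>x. g x \<partial>\<eta> t) - (\<integral>x. g x \<partial>\<eta> s)) \<longlongrightarrow> 0) (at s within I)"
      by (rule Lim_null_comparison[OF _ lim]) (use le'[OF s] in \<open>auto simp: eventually_at_filter\<close>)
    then show "((\<lambda>t. \<integral>x. g x \<partial>\<eta> t) \<longlongrightarrow> (\<integral>x. g x \<partial>\<eta> s)) (at s within I)"
      by (rule LIM_zero_cancel)
  qed
qed

end

text \<open>
  For a nonnegative test function the integrals are monotone in time, so Polya's theorem
  upgrades pointwise to locally uniform convergence; adding a constant reduces the general case
  to this one.
\<close>

lemma weakly_converges_loc_uniformly_if_pointwise:
  assumes gen_n: "\<And>n. generator I (\<gamma> n) (\<eta> n)" and gen: "generator I \<gamma>' \<eta>'"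
    and conv: "\<And>t. t \<in> I \<Longrightarrow> weakly_converges UNIV (\<lambda>n. \<eta> n t) (\<eta>' t)"
  shows "weakly_converges_loc_uniformly I \<eta> \<eta>'"
  unfolding weakly_converges_loc_uniformly_def loc_uniform_limit_def
proof (intro allI impI)
  fix g :: "real \<Rightarrow> real" and K
  assume g: "continuous_on UNIV g \<and> bounded (range g)" and K: "compact K \<and> K \<subseteq> I"
  have I: "time_interval I" by (rule generator.time[OF gen])
  obtain T where T: "T \<in> I" "K \<subseteq> {0..T}"
    using compact_subset_time_interval[OF I] K by blast
  have T0: "0 \<le> T" by (rule time_interval_nonneg[OF I T(1)])
  have sub: "t \<in> I" if "t \<in> {0..T}" for t using time_interval_closed_below[OF I T(1)] that by simp
  obtain C where C: "\<And>x. \<bar>g x\<bar> \<le> C" using g unfolding bounded_iff by auto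
  have unif: "uniform_limit {0..T} (\<lambda>n t. \<integral>x. h x \<partial>\<eta> n t) (\<lambda>t. \<integral>x. h x \<partial>\<eta>' t) sequentially"
    if h: "continuous_on UNIV h" "\<And>x. 0 \<le> h x" "\<And>x. h x \<le> c" for h :: "real \<Rightarrow> real" and c
  proof (rule monotone_pointwise_limit_uniform[OF T0])
    have meas: "h \<in> borel_measurable borel" by (intro borel_measurable_continuous_onI h)
    have bd: "\<bar>h x\<bar> \<le> c" for x using h(2,3)[of x] by simp
    show "mono_on {0..T} (\<lambda>t. \<integral>x. h x \<partial>\<eta> n t)" for n
      by (intro mono_onI generator.integral_mono_time[OF gen_n _ _ _ meas h(2,3)] sub) auto
    show "continuous_on {0..T} (\<lambda>t. \<integral>x. h x \<partial>\<eta>' t)"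
      by (rule continuous_on_subset[OF generator.integral_time_continuous[OF gen meas bd]]) (use sub in auto)
    have "bounded (range h)" unfolding bounded_iff using bd by auto
    moreover fix t assume "t \<in> {0..T}"
    ultimately show "(\<lambda>n. \<integral>x. h x \<partial>\<eta> n t) \<longlonglongrightarrow> (\<integral>x. h x \<partial>\<eta>' t)"
      using conv[OF sub] h(1) unfolding weakly_converges_def by simp
  qed
  have C0: "0 \<le> C" using C[of 0] by linarith
  have "uniform_limit {0..T} (\<lambda>n t. \<integral>x. g x + C \<partial>\<eta> n t) (\<lambda>t. \<integral>x. g x + C \<partial>\<eta>' t) sequentially"
  proof (rule unif[of _ "2 * C"])
    show "continuous_on UNIV (\<lambda>x. g x + C)" using g by (intro continuous_intros) simp
    show "0 \<le> g x + C" "g x + C \<le> 2 * C" for x using C[of x] by linarith+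
  qed
  moreover have "uniform_limit {0..T} (\<lambda>n t. \<integral>x. C \<partial>\<eta> n t) (\<lambda>t. \<integral>x. C \<partial>\<eta>' t) sequentially"
    by (rule unif[of _ C]) (use C0 in auto)
  ultimately have lim: "uniform_limit {0..T} (\<lambda>n t. (\<integral>x. g x + C \<partial>\<eta> n t) - (\<integral>x. C \<partial>\<eta> n t))
     (\<lambda>t. (\<integral>x. g x + C \<partial>\<eta>' t) - (\<integral>x. C \<partial>\<eta>' t)) sequentially"
    by (rule uniform_limit_minus)
  have shift: "(\<integral>x. g x + C \<partial>L) - (\<integral>x. C \<partial>L) = (\<integral>x. g x \<partial>L)" if "finite_borel_measure L" for L
  proof -
    interpret finite_borel_measure L by fact
    have "integrable L g" by (rule integrable_continuous_bounded[of _ C]) (use g C in auto)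
    then show ?thesis by (subst Bochner_Integration.integral_add[OF _ integrable_const]) simp_all
  qed
  have "uniform_limit {0..T} (\<lambda>n t. \<integral>x. g x \<partial>\<eta> n t) (\<lambda>t. \<integral>x. g x \<partial>\<eta>' t) sequentially
     \<longleftrightarrow> uniform_limit {0..T} (\<lambda>n t. (\<integral>x. g x + C \<partial>\<eta> n t) - (\<integral>x. C \<partial>\<eta> n t))
     (\<lambda>t. (\<integral>x. g x + C \<partial>\<eta>' t) - (\<integral>x. C \<partial>\<eta>' t)) sequentially"
    by (intro uniform_limit_cong' shift[symmetric] generator.finite_borel[OF gen_n]
        generator.finite_borel[OF gen] sub)
  with lim have "uniform_limit {0..T} (\<lambda>n t. \<integral>x. g x \<partial>\<eta> n t) (\<lambda>t. \<integral>x. g x \<partial>\<eta>' t) sequentially" by blast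
  then show "uniform_limit K (\<lambda>n t. \<integral>x. g x \<partial>\<eta> n t) (\<lambda>t. \<integral>x. g x \<partial>\<eta>' t) sequentially"
    by (rule uniform_limit_on_subset[OF _ T(2)])
qed

section \<open>The space-time measure\<close>

lemma emeasure_lborel_subgraph: "emeasure lborel {u::real. 0 \<le> u \<and> ennreal u < c} = c"
proof (cases c)
  case (real r)
  then have "{u. 0 \<le> u \<and> ennreal u < c} = {0..<r}" by (auto simp: ennreal_less_iff)
  then show ?thesis using real by simp
next
  case top
  then have "{u. 0 \<le> u \<and> ennreal u < c} = {0..}" by auto
  moreover have "emeasure lborel {0::real..} = top"
  proof (rule ccontr)
    assume "emeasure lborel {0::real..} \<noteq> top"
    then obtain r where r: "0 \<le> r" "emeasure lborel {0::real..} = ennreal r" by (cases "emeasure lborel {0::real..}") auto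
    have "emeasure lborel {0..r + 1} \<le> emeasure lborel {0::real..}" by (intro emeasure_mono) auto
    then show False using r by (simp add: ennreal_le_iff)
  qed
  ultimately show ?thesis using top by simp
qed

text \<open>
  Over the set where \<open>g < f\<close> the integral of \<open>g\<close> is finite, so if that set had positive measure the
  integral of \<open>f\<close> over it would be strictly larger, against the hypothesis.
\<close>

lemma AE_le_of_density_le:
  assumes f: "f \<in> borel_measurable M" and g: "g \<in> borel_measurable M"
    and le: "\<And>A. A \<in> sets M \<Longrightarrow> emeasure (density M f) A \<le> emeasure (density M g) A"
    and fin: "emeasure (density M g) (space M) \<noteq> \<infinity>"
  shows "AE x in M. f x \<le> g x"
proof (rule ccontr)
  assume not: "\<not> (AE x in M. f x \<le> g x)"
  define C where "C = {x \<in> space M. g x < f x}"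
  have C: "C \<in> sets M" unfolding C_def using f g by measurable
  have "(\<integral>\<^sup>+x. g x * indicator C x \<partial>M) < (\<integral>\<^sup>+x. f x * indicator C x \<partial>M)"
  proof (rule nn_integral_less)
    have "(\<integral>\<^sup>+x. g x * indicator C x \<partial>M) = emeasure (density M g) C"
      using C g by (simp add: emeasure_density)
    also have "\<dots> \<le> emeasure (density M g) (space M)"
      by (rule emeasure_mono) (use C sets.sets_into_space in auto)
    finally show "(\<integral>\<^sup>+x. g x * indicator C x \<partial>M) \<noteq> \<infinity>" using fin by (auto simp: top_unique)
    show "AE x in M. g x * indicator C x \<le> f x * indicator C x"
      by (intro AE_I2) (auto simp: C_def split: split_indicator)
    show "\<not> (AE x in M. f x * indicator C x \<le> g x * indicator C x)"
    proof
      assume "AE x in M. f x * indicator C x \<le> g x * indicator C x"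
      then have "AE x in M. f x \<le> g x"
        using AE_space
      proof eventually_elim
        case (elim x)
        show ?case
        proof (rule ccontr)
          assume "\<not> f x \<le> g x"
          moreover from this have "x \<in> C" using elim by (simp add: C_def not_le)
          ultimately show False using elim by simp
        qed
      qed
      with not show False ..
    qed
  qed (use C f g in measurable)
  then have "emeasure (density M g) C < emeasure (density M f) C"
    using C f g by (simp add: emeasure_density)
  with le[OF C] show False by simp
qed

text \<open>
  The dominating measure is a mixture, with geometric and hence positive weights, of the \<open>M n\<close>
  rescaled to mass at most \<open>1\<close>.
\<close>

lemma dominating_finite_measure:
  fixes M :: "nat \<Rightarrow> real measure"
  assumes M: "\<And>n. finite_borel_measure (M n)"
  obtains \<nu> :: "real measure" where "finite_borel_measure \<nu>"
    "\<And>n B. B \<in> null_sets \<nu> \<Longrightarrow> emeasure (M n) B = 0"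
proof -
  define w where "w n = ennreal (1 / (1 + measure (M n) UNIV))" for n
  define f where "f n = scale_measure (w n) (M n)" for n
  define p where "p = geometric_pmf (1 / 2)"
  define \<nu> where "\<nu> = measure_pmf p \<bind> f"
  have w_pos: "0 < w n" for n
    unfolding w_def using measure_nonneg[of "M n" UNIV] by (simp add: add_pos_nonneg)
  have f_sp: "f n \<in> space (subprob_algebra borel)" for n
    unfolding space_subprob_algebra
  proof (intro CollectI conjI subprob_spaceI)
    interpret finite_borel_measure "M n" by (rule M)
    have "emeasure (f n) (space (f n)) = w n * ennreal (measure (M n) UNIV)"
      by (simp add: f_def space_scale_measure space_M_UNIV emeasure_eq_measure)
    also have "\<dots> = ennreal (measure (M n) UNIV / (1 + measure (M n) UNIV))"
      unfolding w_def by (subst ennreal_mult[symmetric]) auto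
    also have "\<dots> \<le> ennreal 1"
      by (intro ennreal_leI) (simp add: divide_le_eq_1_pos add_pos_nonneg)
    finally show "emeasure (f n) (space (f n)) \<le> 1" by simp
    show "space (f n) \<noteq> {}" by (simp add: f_def space_scale_measure space_M_UNIV)
    show "sets (f n) = sets borel" by (simp add: f_def M_is_borel)
  qed
  then have f_meas: "f \<in> measurable (measure_pmf p) (subprob_algebra borel)" by auto
  have sets_\<nu>: "sets \<nu> = sets borel"
    unfolding \<nu>_def using f_sp by (intro sets_bind) (auto simp: space_subprob_algebra)
  interpret \<nu>: subprob_space \<nu>
    unfolding \<nu>_def by (rule subprob_space_bind[OF _ f_meas]) (rule measure_pmf.subprob_space_axioms)
  show thesis
  proof (rule that)
    show "finite_borel_measure \<nu>"
      by (intro finite_borel_measure.intro finite_borel_measure_axioms.intro sets_\<nu> \<nu>.finite_measure_axioms)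
    fix n B assume "B \<in> null_sets \<nu>"
    then have "emeasure \<nu> B = 0" "B \<in> sets borel" using sets_\<nu> by auto
    then have "(\<integral>\<^sup>+k. emeasure (f k) B \<partial>measure_pmf p) = 0"
      unfolding \<nu>_def by (subst (asm) emeasure_bind[OF _ f_meas]) auto
    then have "AE k in measure_pmf p. emeasure (f k) B = 0"
      by (subst (asm) nn_integral_0_iff_AE) auto
    then have "emeasure (f n) B = 0"
      unfolding AE_measure_pmf_iff p_def by (simp add: set_pmf_geometric)
    then show "emeasure (M n) B = 0" using w_pos[of n] by (auto simp: f_def)
  qed
qed

lemma time_interval_borel: "time_interval I \<Longrightarrow> I \<in> sets borel"
  unfolding time_interval_def by auto

lemma space_time_sets_iff:
  assumes "time_interval I"
  shows "A \<in> sets (restrict_space borel (UNIV \<times> I)) \<longleftrightarrow> A \<in> sets borel \<and> A \<subseteq> (UNIV :: real set) \<times> I"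
proof -
  have "(UNIV :: real set) \<times> I \<in> sets borel"
    using time_interval_borel[OF assms] by (intro borel_Times) auto
  then show ?thesis by (subst sets_restrict_space_iff) auto
qed

context generator
begin

text \<open>
  The strips \<open>B \<times> (s, t]\<close> and the slices \<open>B \<times> {0}\<close> form a generator closed under intersections on
  which the values are prescribed, the slices being null.
\<close>

lemma space_time_measure_unique:
  assumes H1: "is_space_time_measure I \<eta> H1" and H2: "is_space_time_measure I \<eta> H2"
  shows "H1 = H2"
proof -
  let ?\<Omega> = "(UNIV :: real set) \<times> I"
  define E :: "(real \<times> real) set set" where
    "E = {B \<times> {s<..t} | B s t. B \<in> sets borel \<and> s \<in> I \<and> t \<in> I \<and> s \<le> t} \<union> {B \<times> {0} | B. B \<in> sets borel}"
  note I = time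
  have I_pos: "\<And>t. t \<in> I \<Longrightarrow> 0 \<le> t" by (rule time_interval_nonneg[OF I])
  obtain T where T: "\<And>n::nat. T n \<in> I" "\<And>t. t \<in> I \<Longrightarrow> \<exists>n. t \<le> T n"
    using time_interval_cofinal_sequence[OF I] by blast
  have sub: "{s<..t} \<subseteq> I" if "s \<in> I" "t \<in> I" for s t
    using time_interval_closed_below[OF I that(2)] I_pos[OF that(1)] by auto
  have between: "r \<in> I" if "s \<in> I" "t \<in> I" "s < r" "r \<le> t" for r s t
    using sub[OF that(1,2)] that(3,4) by auto
  have decomp: "I = {0} \<union> (\<Union>n. {0<..T n})"
  proof (intro set_eqI iffI)
    fix t assume t: "t \<in> I"
    obtain n where "t \<le> T n" using T(2)[OF t] by blast
    then show "t \<in> {0} \<union> (\<Union>n. {0<..T n})" using I_pos[OF t] by (cases "t = 0") auto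
  next
    fix t assume "t \<in> {0} \<union> (\<Union>n. {0<..T n})"
    then consider "t = 0" | n where "0 < t" "t \<le> T n" by auto
    then show "t \<in> I"
      using between[OF time_interval_zero[OF I] T(1)] time_interval_zero[OF I] by cases simp_all
  qed
  have E_sets: "E \<subseteq> sets (restrict_space borel ?\<Omega>)"
    unfolding E_def using time_interval_zero[OF I]
    by (auto simp: space_time_sets_iff[OF I] intro!: borel_Times) (metis between)
  have E_Pow: "E \<subseteq> Pow ?\<Omega>"
  proof
    fix x assume "x \<in> E"
    then have "x \<in> sets (restrict_space borel ?\<Omega>)" using E_sets by (rule subsetD[rotated])
    then show "x \<in> Pow ?\<Omega>" by (simp only: space_time_sets_iff[OF I] Pow_iff)
  qed
  define S where "S = sigma ?\<Omega> E"
  have sets_S: "sets S = sigma_sets ?\<Omega> E" and space_S: "space S = ?\<Omega>"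
    unfolding S_def using E_Pow by auto
  have strip: "B \<times> {s<..t} \<in> sets S" if "B \<in> sets borel" "s \<in> I" "t \<in> I" "s \<le> t" for B s t
    unfolding sets_S using that by (intro sigma_sets.Basic) (auto simp: E_def)
  have slice: "B \<times> {0} \<in> sets S" if "B \<in> sets borel" for B
    unfolding sets_S using that by (intro sigma_sets.Basic) (auto simp: E_def)
  have cyl: "B \<times> I \<in> sets S" if B: "B \<in> sets borel" for B
  proof -
    have "B \<times> I = B \<times> {0} \<union> (\<Union>n. B \<times> {0<..T n})" by (subst decomp) auto
    moreover have "B \<times> {0} \<union> (\<Union>n. B \<times> {0<..T n}) \<in> sets S"
      by (rule sets.Un[OF slice[OF B]], rule sets.countable_UN)
         (use strip[OF B time_interval_zero[OF I] T(1)] I_pos[OF T(1)] in auto)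
    ultimately show ?thesis by simp
  qed
  have "(\<lambda>p. (fst p, snd p)) \<in> measurable S (borel \<Otimes>\<^sub>M borel)"
  proof (rule measurable_Pair)
    show "fst \<in> borel_measurable S"
    proof (rule measurableI)
      fix B :: "real set" assume "B \<in> sets borel"
      moreover have "fst -` B \<inter> space S = B \<times> I" by (auto simp: space_S)
      ultimately show "fst -` B \<inter> space S \<in> sets S" using cyl by simp
    qed auto
    show "snd \<in> borel_measurable S"
      unfolding borel_measurable_iff_le
    proof
      fix a :: real
      consider "a < 0" | "a \<in> I" | "\<And>t. t \<in> I \<Longrightarrow> t \<le> a"
        using time_interval_closed_below[OF I, of _ a] by force
      then show "{w \<in> space S. snd w \<le> a} \<in> sets S"
      proof cases
        case 1
        then have "{w \<in> space S. snd w \<le> a} = {}" using I_pos by (force simp: space_S)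
        then show ?thesis by (simp only: sets.empty_sets)
      next
        case 2
        then have "{w \<in> space S. snd w \<le> a} = UNIV \<times> {0} \<union> UNIV \<times> {0<..a}"
          using sub[OF time_interval_zero[OF I] 2] time_interval_zero[OF I] I_pos by (force simp: space_S)
        moreover have "UNIV \<times> {0} \<union> UNIV \<times> {0<..a} \<in> sets S"
          by (intro sets.Un slice strip time_interval_zero[OF I] 2 I_pos) auto
        ultimately show ?thesis by simp
      next
        case 3
        then have "{w \<in> space S. snd w \<le> a} = UNIV \<times> I" by (auto simp: space_S)
        then show ?thesis using cyl by simp
      qed
    qed
  qed
  then have id_meas: "(\<lambda>p. p) \<in> measurable S borel" by (simp add: borel_prod)
  have sets_eq: "sets (restrict_space borel ?\<Omega>) = sigma_sets ?\<Omega> E"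
  proof
    have "sigma_sets (space (restrict_space borel ?\<Omega>)) E \<subseteq> sets (restrict_space borel ?\<Omega>)"
      by (rule sets.sigma_sets_subset[OF E_sets])
    then show "sigma_sets ?\<Omega> E \<subseteq> sets (restrict_space borel ?\<Omega>)" by (simp add: space_restrict_space)
    show "sets (restrict_space borel ?\<Omega>) \<subseteq> sigma_sets ?\<Omega> E"
    proof
      fix A assume "A \<in> sets (restrict_space borel ?\<Omega>)"
      then have A: "A \<in> sets borel" "A \<subseteq> ?\<Omega>" by (auto simp: space_time_sets_iff[OF I])
      have "(\<lambda>p. p) -` A \<inter> space S \<in> sets S" by (rule measurable_sets[OF id_meas A(1)])
      moreover have "(\<lambda>p. p) -` A \<inter> space S = A" using A(2) by (auto simp: space_S)
      ultimately show "A \<in> sigma_sets ?\<Omega> E" by (simp add: sets_S)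
    qed
  qed
  have zero: "emeasure H (B \<times> {0}) = 0" if H: "is_space_time_measure I \<eta> H" and B: "B \<in> sets borel" for H B
  proof -
    have "UNIV \<times> {0} \<in> sets H"
      using H time_interval_zero[OF I] unfolding is_space_time_measure_def
      by (auto simp: space_time_sets_iff[OF I] intro!: borel_Times)
    then have "emeasure H (B \<times> {0}) \<le> emeasure H (UNIV \<times> {0})" by (intro emeasure_mono) auto
    then show ?thesis using H by (simp add: is_space_time_measure_def)
  qed
  show ?thesis
  proof (rule measure_eqI_generator_eq_countable[where E = E and \<Omega> = ?\<Omega>
        and A = "insert (UNIV \<times> {0}) (range (\<lambda>n. UNIV \<times> {0<..T n}))"])
    show "Int_stable E"
    proof (rule Int_stableI)
      fix X Y assume X: "X \<in> E" and Y: "Y \<in> E"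
      have int: "(B \<times> {s<..t}) \<inter> (B' \<times> {s'<..t'}) \<in> E"
        if "B \<in> sets borel" "B' \<in> sets borel" "s \<in> I" "t \<in> I" "s' \<in> I" "t' \<in> I" for B B' s t s' t'
      proof -
        define a where "a = max s s'"
        \<comment> \<open>The maximum with \<open>a\<close> writes an empty intersection as the strip with \<open>s = t = a\<close>.\<close>
        define b where "b = max a (min t t')"
        have "(B \<times> {s<..t}) \<inter> (B' \<times> {s'<..t'}) = (B \<inter> B') \<times> {a<..b}"
          unfolding a_def b_def by (auto simp: max_def min_def)
        moreover have "a \<in> I" "b \<in> I" "a \<le> b" using that unfolding a_def b_def by (auto simp: max_def min_def)
        ultimately show ?thesis unfolding E_def using that(1,2) by blast
      qed
      have zz: "B \<times> {0} \<in> E" if "B \<in> sets borel" for B using that by (auto simp: E_def)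
      have empty: "{} \<in> E" using zz[of "{}"] by simp
      have mixed: "(B \<times> {s<..t}) \<inter> (B' \<times> {0}) = {}" if "s \<in> I" for B B' :: "real set" and s t
        using I_pos[OF that] by auto
      from X consider B s t where "X = B \<times> {s<..t}" "B \<in> sets borel" "s \<in> I" "t \<in> I" | B where "X = B \<times> {0}" "B \<in> sets borel"
        unfolding E_def by blast
      then show "X \<inter> Y \<in> E"
      proof cases
        case 1
        from Y consider B' s' t' where "Y = B' \<times> {s'<..t'}" "B' \<in> sets borel" "s' \<in> I" "t' \<in> I" | B' where "Y = B' \<times> {0}" "B' \<in> sets borel"
          unfolding E_def by blast
        then show ?thesis using 1 int mixed empty by cases simp_all
      next
        case 2
        from Y consider B' s' t' where "Y = B' \<times> {s'<..t'}" "B' \<in> sets borel" "s' \<in> I" "t' \<in> I" | B' where "Y = B' \<times> {0}" "B' \<in> sets borel"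
          unfolding E_def by blast
        then show ?thesis
        proof cases
          case 1
          then have "Y \<inter> X = {}" using \<open>X = B \<times> {0}\<close> mixed by simp
          then show ?thesis using empty by (simp add: Int_commute)
        next
          case (2 B')
          have "X \<inter> Y = (B \<inter> B') \<times> {0}" using 2 \<open>X = B \<times> {0}\<close> by auto
          then show ?thesis using zz 2 \<open>B \<in> sets borel\<close> by simp
        qed
      qed
    qed
    show "emeasure H1 X = emeasure H2 X" if "X \<in> E" for X
      using that zero[OF H1] zero[OF H2] H1 H2 unfolding E_def is_space_time_measure_def by auto
    show "sets H1 = sigma_sets ?\<Omega> E" "sets H2 = sigma_sets ?\<Omega> E"
      using H1 H2 sets_eq by (auto simp: is_space_time_measure_def)
    show "insert (UNIV \<times> {0}) (range (\<lambda>n. UNIV \<times> {0<..T n})) \<subseteq> E"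
    proof -
      have "UNIV \<times> {0} \<in> E" unfolding E_def by (intro UnI2 CollectI exI[of _ UNIV]) simp
      moreover have "UNIV \<times> {0<..T n} \<in> E" for n
        unfolding E_def
        by (intro UnI1 CollectI exI[of _ UNIV] exI[of _ 0] exI[of _ "T n"])
           (simp add: T(1) time_interval_zero[OF I] I_pos)
      ultimately show ?thesis by auto
    qed
    show "\<Union> (insert (UNIV \<times> {0}) (range (\<lambda>n. UNIV \<times> {0<..T n}))) = ?\<Omega>"
    proof -
      have "\<Union> (insert (UNIV \<times> {0}) (range (\<lambda>n. UNIV \<times> {0<..T n}))) =
          (UNIV :: real set) \<times> ({0} \<union> (\<Union>n. {0<..T n}))" by auto
      then show ?thesis by (simp only: decomp[symmetric])
    qed
    show "emeasure H1 a \<noteq> \<infinity>" if "a \<in> insert (UNIV \<times> {0}) (range (\<lambda>n. UNIV \<times> {0<..T n}))" for a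
    proof -
      have "emeasure H1 (UNIV \<times> {0<..T n}) = ennreal (measure (\<eta> (T n)) UNIV - measure (\<eta> 0) UNIV)" for n
        using H1[unfolded is_space_time_measure_def, THEN conjunct2, THEN conjunct1, rule_format, of UNIV 0 "T n"]
          T(1) time_interval_zero[OF I] I_pos[OF T(1)] by simp
      then have "emeasure H1 (UNIV \<times> {0<..T n}) \<noteq> \<infinity>" for n by simp
      moreover have "emeasure H1 (UNIV \<times> {0}) \<noteq> \<infinity>" using zero[OF H1, of UNIV] by simp
      ultimately show ?thesis using that by blast
    qed
  qed (use E_Pow in auto)
qed

text \<open>
  Let \<open>\<nu>\<close> dominate all \<open>\<eta>\<^sub>t\<close> and let \<open>f\<^sub>q\<close> be the density of \<open>\<eta>\<^sub>q\<close>. Almost everywhere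
  \<open>f\<^sub>q\<close> increases along rational \<open>q\<close>, so that \<open>q \<mapsto> f\<^sub>q(x)\<close> is, up to normalisation, the distribution
  function of the conditional law of time given the position \<open>x\<close>. Its quantile function
  \<open>\<tau>(x, u) = inf {q. u < f\<^sub>q(x)}\<close> turns \<open>\<nu> \<otimes> du\<close> into the measure sought.
\<close>

lemma space_time_measure_exists: "\<exists>H. is_space_time_measure I \<eta> H"
proof -
  note I = time
  have I0: "0 \<in> I" by (rule time_interval_zero[OF I])
  have I_pos: "\<And>t. t \<in> I \<Longrightarrow> 0 \<le> t" by (rule time_interval_nonneg[OF I])
  obtain T where T: "\<And>n::nat. T n \<in> I" "\<And>t. t \<in> I \<Longrightarrow> \<exists>n. t \<le> T n"
    using time_interval_cofinal_sequence[OF I] by blast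
  obtain \<nu> :: "real measure" where \<nu>: "finite_borel_measure \<nu>"
    "\<And>n B. B \<in> null_sets \<nu> \<Longrightarrow> emeasure (\<eta> (T n)) B = 0"
    using dominating_finite_measure[of "\<lambda>n. \<eta> (T n)"] finite_borel[OF T(1)] by blast
  interpret \<nu>: finite_borel_measure \<nu> by (rule \<nu>)
  have [measurable_cong]: "sets \<nu> = sets borel" by (rule \<nu>.M_is_borel)
  interpret P: pair_sigma_finite \<nu> lborel ..
  let ?P = "\<nu> \<Otimes>\<^sub>M (lborel :: real measure)"
  have "sets ?P = sets (borel \<Otimes>\<^sub>M borel)"
    by (rule sets_pair_measure_cong) (simp_all add: \<nu>.M_is_borel)
  then have sets_P: "sets ?P = sets borel" by (simp only: borel_prod)
  have space_P: "space ?P = UNIV" using sets_eq_imp_space_eq[OF sets_P] by simp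
  define f where "f q = RN_deriv \<nu> (\<eta> q)" for q
  have f_meas[measurable]: "f q \<in> borel_measurable \<nu>" for q unfolding f_def by simp
  have sets_\<eta>: "sets (\<eta> q) = sets borel" if "q \<in> I" for q
    by (rule finite_borel_measure.M_is_borel[OF finite_borel[OF that]])
  have dens: "density \<nu> (f q) = \<eta> q" if q: "q \<in> I" for q
    unfolding f_def
  proof (rule \<nu>.density_RN_deriv)
    show "sets (\<eta> q) = sets \<nu>" using sets_\<eta>[OF q] \<nu>.M_is_borel by simp
    show "absolutely_continuous \<nu> (\<eta> q)"
      unfolding absolutely_continuous_def
    proof
      fix B assume B: "B \<in> null_sets \<nu>"
      then have Bb: "B \<in> sets borel" using \<nu>.M_is_borel by auto
      obtain n where "q \<le> T n" using T(2)[OF q] by blast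
      then have "emeasure (\<eta> q) B \<le> emeasure (\<eta> (T n)) B" using emeasure_mono_time[OF q T(1)] Bb by blast
      then show "B \<in> null_sets (\<eta> q)" using \<nu>(2)[OF B] Bb sets_\<eta>[OF q] by auto
    qed
  qed
  have f_mono: "AE x in \<nu>. f q x \<le> f r x" if qr: "q \<in> I" "r \<in> I" "q \<le> r" for q r
  proof (rule AE_le_of_density_le)
    show "emeasure (density \<nu> (f q)) A \<le> emeasure (density \<nu> (f r)) A" if "A \<in> sets \<nu>" for A
      unfolding dens[OF qr(1)] dens[OF qr(2)] using emeasure_mono_time[OF qr] that \<nu>.M_is_borel by blast
    show "emeasure (density \<nu> (f r)) (space \<nu>) \<noteq> \<infinity>"
      unfolding dens[OF qr(2)] by (simp add: emeasure_eq[OF qr(2)])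
  qed auto
  \<comment> \<open>\<open>E q\<close> is the region under the graph of \<open>f q\<close>. Lebesgue measure is used on the second axis because
    \<open>f q\<close> need not be bounded.\<close>
  define E where "E q = {p :: real \<times> real. 0 \<le> snd p \<and> ennreal (snd p) < f q (fst p)}" for q
  have E_meas[measurable]: "E q \<in> sets ?P" for q
  proof -
    have "{p \<in> space ?P. 0 \<le> snd p \<and> ennreal (snd p) < f q (fst p)} \<in> sets ?P" by measurable
    then show ?thesis by (simp add: E_def space_P)
  qed
  have E_emeasure: "emeasure ?P (E q \<inter> B \<times> UNIV) = ennreal (measure (\<eta> q) B)"
    if q: "q \<in> I" and B: "B \<in> sets borel" for q B
  proof -
    have [measurable]: "B \<in> sets \<nu>" using B \<nu>.M_is_borel by simp
    have "E q \<inter> B \<times> UNIV \<in> sets ?P" by measurable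
    then have "emeasure ?P (E q \<inter> B \<times> UNIV) =
        (\<integral>\<^sup>+x. emeasure lborel (Pair x -` (E q \<inter> B \<times> UNIV)) \<partial>\<nu>)"
      by (rule lborel.emeasure_pair_measure_alt)
    also have "\<dots> = (\<integral>\<^sup>+x. f q x * indicator B x \<partial>\<nu>)"
    proof (rule nn_integral_cong)
      fix x
      have "Pair x -` (E q \<inter> B \<times> UNIV) = (if x \<in> B then {u. 0 \<le> u \<and> ennreal u < f q x} else {})"
        by (auto simp: E_def)
      then show "emeasure lborel (Pair x -` (E q \<inter> B \<times> UNIV)) = f q x * indicator B x"
        by (simp add: emeasure_lborel_subgraph)
    qed
    also have "\<dots> = emeasure (\<eta> q) B" unfolding dens[OF q, symmetric] by (simp add: emeasure_density)
    finally show ?thesis by (simp add: emeasure_eq[OF q])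
  qed
  define Q where "Q = I \<inter> \<rat>"
  have Q: "countable Q" "Q \<subseteq> I" by (auto simp: Q_def countable_rat)
  have union_le: "emeasure ?P ((\<Union>q\<in>J. E q) \<inter> B \<times> UNIV) \<le> ennreal (measure (\<eta> r) B)"
    if J: "J \<subseteq> Q" and r: "r \<in> I" "\<And>q. q \<in> J \<Longrightarrow> q \<le> r" and B: "B \<in> sets borel" for J r B
  proof -
    have [measurable]: "B \<in> sets \<nu>" using B \<nu>.M_is_borel by simp
    have cJ: "countable J" using J Q(1) by (rule countable_subset)
    have "AE x in \<nu>. \<forall>q\<in>J. f q x \<le> f r x"
      unfolding AE_ball_countable[OF cJ] using J Q(2) r f_mono by blast
    then have "AE p in ?P. \<forall>q\<in>J. f q (fst p) \<le> f r (fst p)"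
    proof (intro P.AE_pair_measure)
      show "{p \<in> space ?P. \<forall>q\<in>J. f q (fst p) \<le> f r (fst p)} \<in> sets ?P"
        using cJ by measurable
    qed auto
    then have "AE p in ?P. p \<in> (\<Union>q\<in>J. E q) \<inter> B \<times> UNIV \<longrightarrow> p \<in> E r \<inter> B \<times> UNIV"
    proof eventually_elim
      case (elim p)
      show ?case
      proof
        assume p: "p \<in> (\<Union>q\<in>J. E q) \<inter> B \<times> UNIV"
        then obtain q where q: "q \<in> J" "0 \<le> snd p" "ennreal (snd p) < f q (fst p)" by (auto simp: E_def)
        have "ennreal (snd p) < f r (fst p)" using q(3) elim[rule_format, OF q(1)] by (rule less_le_trans)
        then show "p \<in> E r \<inter> B \<times> UNIV" using p q(2) by (auto simp: E_def)
      qed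
    qed
    then have "emeasure ?P ((\<Union>q\<in>J. E q) \<inter> B \<times> UNIV) \<le> emeasure ?P (E r \<inter> B \<times> UNIV)"
      by (rule emeasure_mono_AE) measurable
    then show ?thesis by (simp add: E_emeasure[OF r(1) B])
  qed
  \<comment> \<open>\<open>\<tau>\<close> is infinite off the graph regions, a set removed from the domain below.\<close>
  define \<tau> where "\<tau> p = (INF q\<in>Q. if p \<in> E q then ereal q else \<infinity>)" for p
  have \<tau>_meas[measurable]: "\<tau> \<in> borel_measurable ?P"
    unfolding \<tau>_def by (rule borel_measurable_INF[OF Q(1)]) measurable
  have \<tau>_less: "\<tau> p < ereal r \<longleftrightarrow> (\<exists>q\<in>Q. q < r \<and> p \<in> E q)" for p r
    unfolding \<tau>_def INF_less_iff by (auto split: if_splits)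
  have \<tau>_fin: "\<tau> p < \<infinity> \<longleftrightarrow> (\<exists>q\<in>Q. p \<in> E q)" for p
    unfolding \<tau>_def INF_less_iff by (auto split: if_splits)
  have \<tau>_le: "\<tau> p \<le> ereal q" if "q \<in> Q" "p \<in> E q" for p q
    unfolding \<tau>_def by (rule INF_lower2[OF that(1)]) (use that(2) in simp)
  have \<tau>_nonneg: "0 \<le> \<tau> p" for p
    unfolding \<tau>_def using Q(2) I_pos by (intro INF_greatest) auto
  have rat_between: "\<exists>q\<in>Q. a < q \<and> q < b" if ab: "0 \<le> a" "a < b" "b \<in> I" for a b
  proof -
    obtain q where "q \<in> \<rat>" "a < q" "q < b" using Rats_dense_in_real[OF ab(2)] by blast
    then show ?thesis using time_interval_closed_below[OF I ab(3), of q] ab(1) by (auto simp: Q_def)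
  qed
  define L where "L B t = {p. fst p \<in> B \<and> \<tau> p \<le> ereal t}" for B t
  have L_sets: "L B t \<in> sets ?P" if "B \<in> sets borel" for B t
  proof -
    have [measurable]: "B \<in> sets \<nu>" using that \<nu>.M_is_borel by simp
    have "{p \<in> space ?P. fst p \<in> B \<and> \<tau> p \<le> ereal t} \<in> sets ?P" by measurable
    then show ?thesis by (simp add: L_def space_P)
  qed
  have L_emeasure: "emeasure ?P (L B t) = ennreal (measure (\<eta> t) B)"
    if t: "t \<in> I" and B: "B \<in> sets borel" for B t
  proof (rule antisym)
    have near: "\<exists>d>0. \<forall>r\<in>I. dist r t < d \<longrightarrow> dist (measure (\<eta> r) B) (measure (\<eta> t) B) < e" if "0 < e" for e
      using measure_cont[OF B] t that unfolding continuous_on_iff by simp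
    show "emeasure ?P (L B t) \<le> ennreal (measure (\<eta> t) B)"
    proof (rule ennreal_le_epsilon)
      fix e :: real assume e: "0 < e"
      obtain d where d: "0 < d" "\<And>r. r \<in> I \<Longrightarrow> dist r t < d \<Longrightarrow> dist (measure (\<eta> r) B) (measure (\<eta> t) B) < e"
        using near[OF e] by blast
      \<comment> \<open>Right continuity of \<open>\<eta>\<close> bounds the mass of \<open>\<tau> \<le> t\<close>. At a right end point of \<open>I\<close> there is no
        later time, but then every \<open>q\<close> is at most \<open>t\<close>.\<close>
      have "\<exists>r\<in>I. L B t \<subseteq> (\<Union>q\<in>{q\<in>Q. q \<le> r}. E q) \<inter> B \<times> UNIV \<and> measure (\<eta> r) B \<le> measure (\<eta> t) B + e"
      proof (cases "\<exists>s\<in>I. t < s")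
        case True
        then obtain s where s: "s \<in> I" "t < s" by blast
        define r where "r = min s (t + d / 2)"
        have r: "r \<in> I" "t < r" "dist r t < d"
          using time_interval_closed_below[OF I s(1), of r] s I_pos[OF t] d(1)
          by (auto simp: r_def dist_real_def min_def)
        have "L B t \<subseteq> (\<Union>q\<in>{q\<in>Q. q \<le> r}. E q) \<inter> B \<times> UNIV"
        proof
          fix p assume p: "p \<in> L B t"
          then have "\<tau> p \<le> ereal t" by (simp add: L_def)
          also have "\<dots> < ereal r" using r(2) by simp
          finally have "\<tau> p < ereal r" .
          then show "p \<in> (\<Union>q\<in>{q\<in>Q. q \<le> r}. E q) \<inter> B \<times> UNIV"
            using p unfolding \<tau>_less L_def by (auto simp: mem_Times_iff intro: less_imp_le)
        qed
        moreover have "measure (\<eta> r) B \<le> measure (\<eta> t) B + e"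
          using d(2)[OF r(1) r(3)] by (simp add: dist_real_def)
        ultimately show ?thesis using r(1) by blast
      next
        case False
        have "L B t \<subseteq> (\<Union>q\<in>{q\<in>Q. q \<le> t}. E q) \<inter> B \<times> UNIV"
        proof
          fix p assume p: "p \<in> L B t"
          then have "\<tau> p < \<infinity>" by (auto simp: L_def)
          then show "p \<in> (\<Union>q\<in>{q\<in>Q. q \<le> t}. E q) \<inter> B \<times> UNIV"
            using p False Q(2) unfolding \<tau>_fin L_def by (force simp: mem_Times_iff not_less)
        qed
        then show ?thesis using t e by (intro bexI[of _ t]) auto
      qed
      then obtain r where r: "r \<in> I" "L B t \<subseteq> (\<Union>q\<in>{q\<in>Q. q \<le> r}. E q) \<inter> B \<times> UNIV"
        "measure (\<eta> r) B \<le> measure (\<eta> t) B + e" by blast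
      have [measurable]: "B \<in> sets \<nu>" using B \<nu>.M_is_borel by simp
      have cJ: "countable {q\<in>Q. q \<le> r}" using Q(1) by (rule countable_subset[rotated]) auto
      have "emeasure ?P (L B t) \<le> emeasure ?P ((\<Union>q\<in>{q\<in>Q. q \<le> r}. E q) \<inter> B \<times> UNIV)"
      proof (rule emeasure_mono[OF r(2)])
        show "(\<Union>q\<in>{q\<in>Q. q \<le> r}. E q) \<inter> B \<times> UNIV \<in> sets ?P"
        proof (rule sets.Int)
          show "(\<Union>q\<in>{q\<in>Q. q \<le> r}. E q) \<in> sets ?P" by (rule sets.countable_UN'[OF cJ]) (use E_meas in blast)
          show "B \<times> UNIV \<in> sets ?P" by measurable
        qed
      qed
      also have "\<dots> \<le> ennreal (measure (\<eta> r) B)" by (rule union_le[OF _ r(1) _ B]) auto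
      also have "\<dots> \<le> ennreal (measure (\<eta> t) B + e)" by (rule ennreal_leI[OF r(3)])
      also have "\<dots> = ennreal (measure (\<eta> t) B) + ennreal e" using e by (simp add: ennreal_plus)
      finally show "emeasure ?P (L B t) \<le> ennreal (measure (\<eta> t) B) + ennreal e" .
    qed
    show "ennreal (measure (\<eta> t) B) \<le> emeasure ?P (L B t)"
    proof (cases "t = 0")
      case True
      then show ?thesis by (simp add: eta_zero)
    next
      case False
      then have t0: "0 < t" using I_pos[OF t] by simp
      show ?thesis
      proof (rule ennreal_le_epsilon)
        fix e :: real assume e: "0 < e"
        obtain d where d: "0 < d" "\<And>r. r \<in> I \<Longrightarrow> dist r t < d \<Longrightarrow> dist (measure (\<eta> r) B) (measure (\<eta> t) B) < e"
          using near[OF e] by blast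
        obtain q where q: "q \<in> Q" "max 0 (t - d) < q" "q < t"
          using rat_between[of "max 0 (t - d)" t] t t0 d(1) by auto
        have "measure (\<eta> t) B \<le> measure (\<eta> q) B + e"
          using d(2)[of q] q Q(2) by (auto simp: dist_real_def)
        then have "ennreal (measure (\<eta> t) B) \<le> ennreal (measure (\<eta> q) B) + ennreal e"
          using e by (simp add: ennreal_plus[symmetric] ennreal_leI del: ennreal_plus)
        also have "ennreal (measure (\<eta> q) B) = emeasure ?P (E q \<inter> B \<times> UNIV)"
          using E_emeasure[OF _ B, of q] q(1) Q(2) by auto
        also have "\<dots> \<le> emeasure ?P (L B t)"
        proof (rule emeasure_mono[OF _ L_sets[OF B]])
          show "E q \<inter> B \<times> UNIV \<subseteq> L B t"
          proof
            fix p assume p: "p \<in> E q \<inter> B \<times> UNIV"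
            then have "\<tau> p \<le> ereal q" using \<tau>_le[OF q(1)] by simp
            also have "\<dots> \<le> ereal t" using q(3) by simp
            finally show "p \<in> L B t" using p by (auto simp: L_def)
          qed
        qed
        finally show "ennreal (measure (\<eta> t) B) \<le> emeasure ?P (L B t) + ennreal e"
          by (simp add: add_mono)
      qed
    qed
  qed
  define D where "D = {p. \<tau> p < \<infinity>}"
  have D_sets: "D \<inter> space ?P \<in> sets ?P"
  proof -
    have "{p \<in> space ?P. \<tau> p < \<infinity>} \<in> sets ?P" by measurable
    then show ?thesis by (simp add: D_def Int_def conj_commute)
  qed
  define h where "h p = (fst p, real_of_ereal (\<tau> p))" for p :: "real \<times> real"
  have \<tau>_real: "\<tau> p = ereal (real_of_ereal (\<tau> p))" if "p \<in> D" for p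
    using that \<tau>_nonneg[of p] by (cases "\<tau> p") (auto simp: D_def)
  have h_range: "h p \<in> UNIV \<times> I" if p: "p \<in> D" for p
  proof -
    obtain q where q: "q \<in> Q" "p \<in> E q" using p \<tau>_fin by (auto simp: D_def)
    have "ereal (real_of_ereal (\<tau> p)) \<le> ereal q" "0 \<le> ereal (real_of_ereal (\<tau> p))"
      using \<tau>_le[OF q] \<tau>_nonneg[of p] unfolding \<tau>_real[OF p, symmetric] .
    then have "real_of_ereal (\<tau> p) \<in> I"
      using time_interval_closed_below[OF I, of q] q(1) Q(2) by auto
    then show ?thesis by (simp add: h_def)
  qed
  have "h \<in> measurable ?P borel"
    unfolding h_def borel_prod[symmetric] by measurable
  then have h_meas: "h \<in> measurable (restrict_space ?P D) (restrict_space borel (UNIV \<times> I))"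
    by (intro measurable_restrict_space2 measurable_restrict_space1)
       (use h_range in \<open>auto simp: space_restrict_space\<close>)
  define H where "H = distr (restrict_space ?P D) (restrict_space borel (UNIV \<times> I)) h"
  have H_emeasure: "emeasure H A = emeasure ?P (h -` A \<inter> D)"
    if "A \<in> sets (restrict_space borel (UNIV \<times> I))" for A
  proof -
    have "emeasure H A = emeasure (restrict_space ?P D) (h -` A \<inter> space (restrict_space ?P D))"
      unfolding H_def by (rule emeasure_distr[OF h_meas that])
    also have "h -` A \<inter> space (restrict_space ?P D) = h -` A \<inter> D"
      by (simp add: space_restrict_space space_P)
    also have "emeasure (restrict_space ?P D) (h -` A \<inter> D) = emeasure ?P (h -` A \<inter> D)"
      by (rule emeasure_restrict_space[OF D_sets]) auto
    finally show ?thesis .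
  qed
  have "is_space_time_measure I \<eta> H"
    unfolding is_space_time_measure_def
  proof (intro conjI ballI impI)
    show "sets H = sets (restrict_space borel (UNIV \<times> I))" by (simp add: H_def)
    fix B :: "real set" and s t
    assume B: "B \<in> sets borel" and st: "s \<in> I" "t \<in> I" "s \<le> t"
    have A: "B \<times> {s<..t} \<in> sets (restrict_space borel (UNIV \<times> I))"
      using B st I_pos[OF st(1)] time_interval_closed_below[OF I st(2)]
      by (auto simp: space_time_sets_iff[OF I] intro!: borel_Times)
    have mem: "real_of_ereal (\<tau> p) \<le> r \<longleftrightarrow> \<tau> p \<le> ereal r" if "p \<in> D" for p r
      by (subst (2) \<tau>_real[OF that]) (simp only: ereal_less_eq)
    have mem': "r < real_of_ereal (\<tau> p) \<longleftrightarrow> \<not> \<tau> p \<le> ereal r" if "p \<in> D" for p r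
      unfolding mem[OF that, symmetric] by (simp only: not_le)
    have "h -` (B \<times> {s<..t}) \<inter> D = L B t - L B s"
    proof (intro set_eqI iffI)
      fix p assume "p \<in> h -` (B \<times> {s<..t}) \<inter> D"
      then show "p \<in> L B t - L B s" by (auto simp: h_def L_def mem mem')
    next
      fix p assume p: "p \<in> L B t - L B s"
      then have "p \<in> D" by (auto simp: L_def D_def)
      then show "p \<in> h -` (B \<times> {s<..t}) \<inter> D" using p by (auto simp: h_def L_def mem mem')
    qed
    then have "emeasure H (B \<times> {s<..t}) = emeasure ?P (L B t - L B s)"
      using H_emeasure[OF A] by simp
    also have "\<dots> = emeasure ?P (L B t) - emeasure ?P (L B s)"
    proof (rule emeasure_Diff)
      show "emeasure ?P (L B s) \<noteq> \<infinity>" by (simp add: L_emeasure[OF st(1) B])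
      show "L B s \<subseteq> L B t" 
      proof
        fix p assume "p \<in> L B s"
        then have p: "fst p \<in> B" "\<tau> p \<le> ereal s" by (simp_all add: L_def)
        have "ereal s \<le> ereal t" using st(3) by simp
        with p(2) have "\<tau> p \<le> ereal t" by (rule order_trans)
        with p(1) show "p \<in> L B t" by (simp add: L_def)
      qed
    qed (use L_sets[OF B] in auto)
    also have "\<dots> = ennreal (measure (\<eta> t) B - measure (\<eta> s) B)"
      using L_emeasure[OF st(1) B] L_emeasure[OF st(2) B] by (simp add: ennreal_minus)
    finally show "emeasure H (B \<times> {s<..t}) = ennreal (measure (\<eta> t) B - measure (\<eta> s) B)" .
  next
    have A: "UNIV \<times> {0} \<in> sets (restrict_space borel ((UNIV :: real set) \<times> I))"
      using I0 by (auto simp: space_time_sets_iff[OF I] intro!: borel_Times)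
    have "emeasure H (UNIV \<times> {0}) = emeasure ?P (h -` (UNIV \<times> {0}) \<inter> D)" by (rule H_emeasure[OF A])
    also have "\<dots> \<le> emeasure ?P (L UNIV 0)"
    proof (rule emeasure_mono)
      show "h -` (UNIV \<times> {0}) \<inter> D \<subseteq> L UNIV 0"
      proof
        fix p assume "p \<in> h -` (UNIV \<times> {0}) \<inter> D"
        then have "p \<in> D" "real_of_ereal (\<tau> p) = 0" by (auto simp: h_def)
        then show "p \<in> L UNIV 0" using \<tau>_real[of p] by (simp add: L_def)
      qed
      show "L UNIV 0 \<in> sets ?P" by (rule L_sets) simp
    qed
    also have "\<dots> = 0" using L_emeasure[OF I0, of UNIV] by (simp add: eta_zero)
    finally show "emeasure H (UNIV \<times> {0}) = 0" by simp
  qed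
  then show ?thesis ..
qed

lemma is_space_time_measure_space_time_measure: "is_space_time_measure I \<eta> (space_time_measure I \<eta>)"
proof -
  have "\<exists>!H. is_space_time_measure I \<eta> H"
    using space_time_measure_exists space_time_measure_unique by blast
  then show ?thesis unfolding space_time_measure_def by (rule theI')
qed

end

subsection \<open>Integration against the space-time measure\<close>

context generator
begin

abbreviation "H \<equiv> space_time_measure I \<eta>"

lemma sets_H: "sets H = sets (restrict_space borel (UNIV \<times> I))"
  and emeasure_H: "B \<in> sets borel \<Longrightarrow> s \<in> I \<Longrightarrow> t \<in> I \<Longrightarrow> s \<le> t \<Longrightarrow>
     emeasure H (B \<times> {s<..t}) = ennreal (measure (\<eta> t) B - measure (\<eta> s) B)"
  and emeasure_H_zero: "emeasure H (UNIV \<times> {0}) = 0"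
  using is_space_time_measure_space_time_measure unfolding is_space_time_measure_def by blast+

lemma space_H: "space H = UNIV \<times> I"
  using sets_eq_imp_space_eq[OF sets_H] by (simp add: space_restrict_space)

lemma sets_H_iff: "A \<in> sets H \<longleftrightarrow> A \<in> sets borel \<and> A \<subseteq> UNIV \<times> I"
  unfolding sets_H by (rule space_time_sets_iff[OF time])

lemma zero_in_time: "0 \<in> I"
  by (rule time_interval_zero[OF time])

lemma time_nonneg: "t \<in> I \<Longrightarrow> 0 \<le> t"
  by (rule time_interval_nonneg[OF time])

lemma strip_subset: "s \<in> I \<Longrightarrow> t \<in> I \<Longrightarrow> {s<..t} \<subseteq> I" "t \<in> I \<Longrightarrow> {0..t} \<subseteq> I"
  using time_interval_closed_below[OF time, of t] time_nonneg[of s] by auto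

lemma strip_in_sets_H: "s \<in> I \<Longrightarrow> t \<in> I \<Longrightarrow> UNIV \<times> {s<..t} \<in> sets H"
  and closed_strip_in_sets_H: "t \<in> I \<Longrightarrow> UNIV \<times> {0..t} \<in> sets H"
  unfolding sets_H_iff by (intro conjI borel_Times Sigma_mono strip_subset; simp)+

lemma space_restrict_strip:
  "s \<in> I \<Longrightarrow> t \<in> I \<Longrightarrow> space (restrict_space H (UNIV \<times> {s<..t})) = UNIV \<times> {s<..t}"
  using strip_subset(1)[of s t] by (auto simp: space_restrict_space space_H)

lemma sets_restrict_strip:
  assumes "s \<in> I" "t \<in> I"
  shows "sets (restrict_space H (UNIV \<times> {s<..t})) = sets (restrict_space borel (UNIV \<times> {s<..t}))"
proof -
  have "sets (restrict_space H (UNIV \<times> {s<..t})) =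
        sets (restrict_space (restrict_space borel (UNIV \<times> I)) (UNIV \<times> {s<..t}))"
    by (rule sets_restrict_space_cong[OF sets_H])
  also have "\<dots> = (\<inter>) (UNIV \<times> {s<..t}) ` (\<inter>) (UNIV \<times> I) ` sets borel"
    by (simp only: sets_restrict_space)
  also have "\<dots> = (\<inter>) (UNIV \<times> {s<..t}) ` sets borel"
    unfolding image_image using strip_subset(1)[OF assms] by (intro image_cong) auto
  finally show ?thesis by (simp only: sets_restrict_space)
qed

lemma measurable_strip:
  assumes "s \<in> I" "t \<in> I" "continuous_on (UNIV \<times> {s<..t}) \<phi>"
  shows "\<phi> \<in> borel_measurable (restrict_space H (UNIV \<times> {s<..t}))"
  using borel_measurable_continuous_on_restrict[OF assms(3)]
    measurable_cong_sets[OF sets_restrict_strip[OF assms(1,2)] refl] by blast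

lemma fst_measurable_strip:
  "s \<in> I \<Longrightarrow> t \<in> I \<Longrightarrow> fst \<in> borel_measurable (restrict_space H (UNIV \<times> {s<..t}))"
  by (rule measurable_strip) (auto intro: continuous_intros)

lemma distr_strip:
  assumes st: "s \<in> I" "t \<in> I" "s \<le> t"
  shows "distr (restrict_space H (UNIV \<times> {s<..t})) borel fst = diff_measure (\<eta> t) (\<eta> s)"
proof (rule measure_eqI)
  have sets_D: "sets (diff_measure (\<eta> t) (\<eta> s)) = sets borel"
    by (rule finite_borel_measure.M_is_borel[OF finite_borel_increment[OF st]])
  then show "sets (distr (restrict_space H (UNIV \<times> {s<..t})) borel fst) = sets (diff_measure (\<eta> t) (\<eta> s))"
    by simp
  fix B assume "B \<in> sets (distr (restrict_space H (UNIV \<times> {s<..t})) borel fst)"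
  then have B: "B \<in> sets borel" by simp
  have "emeasure (distr (restrict_space H (UNIV \<times> {s<..t})) borel fst) B =
        emeasure (restrict_space H (UNIV \<times> {s<..t})) (fst -` B \<inter> space (restrict_space H (UNIV \<times> {s<..t})))"
    by (rule emeasure_distr[OF fst_measurable_strip[OF st(1,2)] B])
  also have "fst -` B \<inter> space (restrict_space H (UNIV \<times> {s<..t})) = B \<times> {s<..t}"
    unfolding space_restrict_strip[OF st(1,2)] by auto
  also have "emeasure (restrict_space H (UNIV \<times> {s<..t})) (B \<times> {s<..t}) = emeasure H (B \<times> {s<..t})"
    by (rule emeasure_restrict_space)
       (use strip_in_sets_H[OF st(1,2)] sets.sets_into_space[OF strip_in_sets_H[OF st(1,2)]] in \<open>auto simp: Int_absorb2\<close>)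
  also have "\<dots> = emeasure (\<eta> t) B - emeasure (\<eta> s) B"
    using emeasure_H[OF B st] by (simp add: emeasure_eq st ennreal_minus)
  also have "\<dots> = emeasure (diff_measure (\<eta> t) (\<eta> s)) B"
    by (rule finite_borel_measure_diff_measure(2)[symmetric, OF finite_borel[OF st(2)] finite_borel[OF st(1)]
          emeasure_mono_time[OF st] B])
  finally show "emeasure (distr (restrict_space H (UNIV \<times> {s<..t})) borel fst) B =
      emeasure (diff_measure (\<eta> t) (\<eta> s)) B" .
qed

lemma integral_strip:
  fixes h :: "real \<Rightarrow> real"
  assumes st: "s \<in> I" "t \<in> I" "s \<le> t" and h: "h \<in> borel_measurable borel" "\<And>x. \<bar>h x\<bar> \<le> C"
  shows "(\<integral>p. h (fst p) \<partial>restrict_space H (UNIV \<times> {s<..t})) = (\<integral>x. h x \<partial>\<eta> t) - (\<integral>x. h x \<partial>\<eta> s)"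
proof -
  have "(\<integral>p. h (fst p) \<partial>restrict_space H (UNIV \<times> {s<..t})) =
        (\<integral>x. h x \<partial>distr (restrict_space H (UNIV \<times> {s<..t})) borel fst)"
    by (rule integral_distr[symmetric, OF fst_measurable_strip[OF st(1,2)] h(1)])
  then show ?thesis unfolding distr_strip[OF st] integral_increment[OF st h] .
qed

lemma integral_eta_zero: "(\<integral>x. (h x :: real) \<partial>\<eta> 0) = 0"
  unfolding eta_zero by (simp add: integral_null_measure)

text \<open>The time slice at \<open>0\<close> is a null set.\<close>

lemma integral_closed_strip:
  fixes \<phi> :: "real \<times> real \<Rightarrow> real"
  assumes T: "T \<in> I" and \<phi>: "continuous_on (UNIV \<times> {0..T}) \<phi>"
  shows "(\<integral>p. \<phi> p \<partial>restrict_space H (UNIV \<times> {0..T})) = (\<integral>p. \<phi> p \<partial>restrict_space H (UNIV \<times> {0<..T}))"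
proof -
  note S = closed_strip_in_sets_H[OF T] and S' = strip_in_sets_H[OF zero_in_time T]
  have sp: "UNIV \<times> {0..T} \<inter> space H \<in> sets H" "UNIV \<times> {0<..T} \<inter> space H \<in> sets H"
    by (intro sets.Int S S' sets.top)+
  have Sb: "UNIV \<times> {0..T} \<in> sets (borel :: (real \<times> real) measure)" "UNIV \<times> {0<..T} \<in> sets (borel :: (real \<times> real) measure)"
    using S S' sets_H_iff by blast+
  have m: "f \<in> borel_measurable H" if "f \<in> borel_measurable borel" for f :: "real \<times> real \<Rightarrow> real"
    using measurable_restrict_space1[OF that, of "UNIV \<times> I"] measurable_cong_sets[OF sets_H refl] by blast
  have 1: "(\<lambda>p. indicator (UNIV \<times> {0..T}) p *\<^sub>R \<phi> p) \<in> borel_measurable borel"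
    by (rule borel_measurable_continuous_on_indicator[OF Sb(1) \<phi>])
  have 2: "(\<lambda>p. indicator (UNIV \<times> {0<..T}) p *\<^sub>R \<phi> p) \<in> borel_measurable borel"
    by (rule borel_measurable_continuous_on_indicator[OF Sb(2) continuous_on_subset[OF \<phi>]]) auto
  have "UNIV \<times> {0} \<in> null_sets H"
    using emeasure_H_zero zero_in_time by (auto simp: null_sets_def sets_H_iff intro!: borel_Times)
  then have "AE p in H. p \<notin> UNIV \<times> {0}" by (rule AE_not_in)
  then have "AE p in H. indicator (UNIV \<times> {0..T}) p *\<^sub>R \<phi> p = indicator (UNIV \<times> {0<..T}) p *\<^sub>R \<phi> p"
  proof eventually_elim
    case (elim p)
    then have "p \<in> UNIV \<times> {0..T} \<longleftrightarrow> p \<in> UNIV \<times> {0<..T}" by (cases p) auto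
    then show ?case by (simp only: indicator_def)
  qed
  then show ?thesis
    unfolding integral_restrict_space[OF sp(1)] integral_restrict_space[OF sp(2)]
    by (rule integral_cong_AE[OF m[OF 1] m[OF 2]])
qed

lemma integral_substrip:
  fixes k :: "real \<times> real \<Rightarrow> real"
  assumes T: "T \<in> I" and st: "s \<in> I" "t \<in> I" "t \<le> T"
  shows "(\<integral>p. indicator (UNIV \<times> {s<..t}) p * k p \<partial>restrict_space H (UNIV \<times> {0<..T})) =
         (\<integral>p. k p \<partial>restrict_space H (UNIV \<times> {s<..t}))"
proof -
  have sp: "UNIV \<times> {s<..t} \<inter> space H \<in> sets H" "UNIV \<times> {0<..T} \<inter> space H \<in> sets H"
    by (intro sets.Int strip_in_sets_H st T zero_in_time sets.top)+
  show ?thesis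
    unfolding integral_restrict_space[OF sp(1)] integral_restrict_space[OF sp(2)]
    by (rule Bochner_Integration.integral_cong)
       (use time_nonneg[OF st(1)] st(3) in \<open>auto simp: indicator_def split: if_splits\<close>)
qed

text \<open>
  A Riemann-type sum in time for the integral over a strip. On each cell of the grid the
  integrand is frozen at the right end point and cut off in space; the error is the oscillation
  in time plus the mass outside the cut-off.
\<close>

lemma space_time_riemann_sum:
  fixes \<phi> :: "real \<times> real \<Rightarrow> real"
  assumes T: "T \<in> I" and \<phi>: "continuous_on (UNIV \<times> {0..T}) \<phi>"
    and C: "\<And>x t. t \<in> {0..T} \<Longrightarrow> \<bar>\<phi> (x, t)\<bar> \<le> C"
    and g: "g 0 = 0" "g N = T" "mono g" "\<And>i. g i \<in> {0..T}"
    and osc: "\<And>i x t. \<bar>x\<bar> \<le> R + 1 \<Longrightarrow> g i < t \<Longrightarrow> t \<le> g (Suc i) \<Longrightarrow> \<bar>\<phi> (x, t) - \<phi> (x, g (Suc i))\<bar> \<le> e"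
    and e: "0 \<le> e"
  defines "h i x \<equiv> \<phi> (x, g (Suc i)) * cutoff R x"
  shows "\<bar>(\<integral>p. \<phi> p \<partial>restrict_space H (UNIV \<times> {0..T})) -
            (\<Sum>i<N. (\<integral>x. h i x \<partial>\<eta> (g (Suc i))) - (\<integral>x. h i x \<partial>\<eta> (g i)))\<bar> \<le>
         e * measure (\<eta> T) UNIV + C * (\<integral>x. 1 - cutoff R x \<partial>\<eta> T)"
proof -
  let ?R = "restrict_space H (UNIV \<times> {0<..T})"
  have gI: "g i \<in> I" for i using g(4) strip_subset(2)[OF T] by blast
  have gle: "g i \<le> g (Suc i)" for i using g(3) by (simp add: monoD)
  have C0: "0 \<le> C" using C[of 0 0] time_nonneg[OF T] by force
  have T0: "0 \<le> T" by (rule time_nonneg[OF T])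
  have slice: "continuous_on UNIV (\<lambda>x. \<phi> (x, g i))" for i
    by (rule continuous_on_compose2[OF \<phi>, of UNIV "\<lambda>x. (x, g i)"]) (use g(4) in \<open>auto intro!: continuous_intros\<close>)
  have h_cont: "continuous_on UNIV (h i)" for i
    unfolding h_def by (intro continuous_on_mult slice continuous_on_cutoff)
  have h_meas[measurable]: "h i \<in> borel_measurable borel" for i
    by (rule borel_measurable_continuous_onI[OF h_cont])
  have h_bd: "\<bar>h i x\<bar> \<le> C" for i x
  proof -
    have "\<bar>\<phi> (x, g (Suc i))\<bar> * cutoff R x \<le> C * 1"
      by (intro mult_mono C g(4) cutoff_le_1 C0 cutoff_nonneg)
    then show ?thesis by (simp add: h_def abs_mult cutoff_nonneg)
  qed
  define \<psi> where "\<psi> p = (\<Sum>i<N. indicator (UNIV \<times> {g i<..g (Suc i)}) p * h i (fst p))" for p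
  have \<phi>_meas: "\<phi> \<in> borel_measurable ?R"
    by (rule measurable_strip[OF zero_in_time T continuous_on_subset[OF \<phi>]]) auto
  have fst_meas[measurable]: "fst \<in> borel_measurable ?R"
    by (rule fst_measurable_strip[OF zero_in_time T])
  have strip_meas[measurable]: "UNIV \<times> {g i<..g (Suc i)} \<inter> space ?R \<in> sets ?R" for i
  proof -
    have "UNIV \<times> {g i<..g (Suc i)} \<in> sets (borel :: (real \<times> real) measure)" by (intro borel_Times) auto
    then have "UNIV \<times> {0<..T} \<inter> (UNIV \<times> {g i<..g (Suc i)}) \<in> sets ?R"
      unfolding sets_restrict_strip[OF zero_in_time T] unfolding sets_restrict_space by (rule imageI)
    then show ?thesis unfolding space_restrict_strip[OF zero_in_time T] by (simp only: Int_commute)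
  qed
  have h_fst_meas: "(\<lambda>p. h i (fst p)) \<in> borel_measurable ?R" for i
    by (rule measurable_compose[OF fst_meas h_meas])
  have fin: "finite_measure ?R"
  proof (rule finite_measureI)
    have "emeasure ?R (space ?R) = emeasure H (UNIV \<times> {0<..T})"
      unfolding space_restrict_strip[OF zero_in_time T]
      by (rule emeasure_restrict_space) (use strip_in_sets_H[OF zero_in_time T] in auto)
    then show "emeasure ?R (space ?R) \<noteq> \<infinity>"
      using emeasure_H[OF _ zero_in_time T T0, of UNIV] by simp
  qed
  interpret R: finite_measure ?R by (rule fin)
  have term_int: "integrable ?R (\<lambda>p. indicator (UNIV \<times> {g i<..g (Suc i)}) p * h i (fst p))" for i
  proof (rule R.integrable_const_bound[of _ C])
    show "AE p in ?R. norm (indicator (UNIV \<times> {g i<..g (Suc i)}) p * h i (fst p)) \<le> C"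
      using h_bd C0 by (intro AE_I2) (auto simp: indicator_def)
    have "(indicator (UNIV \<times> {g i<..g (Suc i)}) :: real \<times> real \<Rightarrow> real) \<in> borel_measurable ?R"
      by (subst borel_measurable_indicator_iff) (rule strip_meas)
    then show "(\<lambda>p. indicator (UNIV \<times> {g i<..g (Suc i)}) p * h i (fst p)) \<in> borel_measurable ?R"
      by (intro borel_measurable_times h_fst_meas)
  qed
  have \<psi>_int: "integrable ?R \<psi>" unfolding \<psi>_def by (intro Bochner_Integration.integrable_sum term_int)
  have \<phi>_int: "integrable ?R \<phi>"
  proof (rule R.integrable_const_bound[of _ C])
    show "AE p in ?R. norm (\<phi> p) \<le> C"
      by (intro AE_I2) (use C in \<open>auto simp: space_restrict_strip[OF zero_in_time T]\<close>)
  qed (rule \<phi>_meas)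
  have \<psi>_eq: "(\<integral>p. \<psi> p \<partial>?R) = (\<Sum>i<N. (\<integral>x. h i x \<partial>\<eta> (g (Suc i))) - (\<integral>x. h i x \<partial>\<eta> (g i)))"
  proof -
    have "(\<integral>p. \<psi> p \<partial>?R) = (\<Sum>i<N. \<integral>p. indicator (UNIV \<times> {g i<..g (Suc i)}) p * h i (fst p) \<partial>?R)"
      unfolding \<psi>_def by (rule Bochner_Integration.integral_sum[OF term_int])
    also have "\<dots> = (\<Sum>i<N. (\<integral>x. h i x \<partial>\<eta> (g (Suc i))) - (\<integral>x. h i x \<partial>\<eta> (g i)))"
    proof (rule sum.cong[OF refl])
      fix i
      have "g (Suc i) \<le> T" using g(4)[of "Suc i"] by simp
      then show "(\<integral>p. indicator (UNIV \<times> {g i<..g (Suc i)}) p * h i (fst p) \<partial>?R) =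
          (\<integral>x. h i x \<partial>\<eta> (g (Suc i))) - (\<integral>x. h i x \<partial>\<eta> (g i))"
        by (simp only: integral_substrip[OF T gI gI] integral_strip[OF gI gI gle h_meas h_bd])
    qed
    finally show ?thesis .
  qed
  define k where "k x = e + C * (1 - cutoff R x)" for x
  have close: "\<bar>\<phi> p - \<psi> p\<bar> \<le> k (fst p)" if p: "p \<in> space ?R" for p
  proof -
    obtain x t where xt: "p = (x, t)" "0 < t" "t \<le> T"
      using p unfolding space_restrict_strip[OF zero_in_time T] by auto
    obtain i where i: "i < N" "g i < t" "t \<le> g (Suc i)"
      using grid_cell[of g t N] xt g by auto
    have "\<psi> p = (\<Sum>j<N. if j = i then h i x else 0)"
      unfolding \<psi>_def
    proof (rule sum.cong[OF refl])
      fix j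
      have "t \<notin> {g j<..g (Suc j)}" if "j \<noteq> i"
      proof (cases "j < i")
        case True
        then have "g (Suc j) \<le> g i" using monoD[OF g(3), of "Suc j" i] by simp
        then show ?thesis using i by auto
      next
        case False
        then have "g (Suc i) \<le> g j" using monoD[OF g(3), of "Suc i" j] that by simp
        then show ?thesis using i by auto
      qed
      then show "indicator (UNIV \<times> {g j<..g (Suc j)}) p * h j (fst p) = (if j = i then h i x else 0)"
        using i xt by auto
    qed
    then have \<psi>p: "\<psi> p = h i x" using i(1) by simp
    let ?c = "cutoff R x"
    have "\<phi> p - \<psi> p = (\<phi> (x, t) - \<phi> (x, g (Suc i))) * ?c + \<phi> (x, t) * (1 - ?c)"
      unfolding \<psi>p h_def unfolding xt(1) by (simp add: algebra_simps)
    then have "\<bar>\<phi> p - \<psi> p\<bar> \<le> \<bar>(\<phi> (x, t) - \<phi> (x, g (Suc i))) * ?c\<bar> + \<bar>\<phi> (x, t) * (1 - ?c)\<bar>"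
      by (simp only: abs_triangle_ineq)
    moreover have "\<bar>(\<phi> (x, t) - \<phi> (x, g (Suc i))) * ?c\<bar> \<le> e"
    proof (cases "\<bar>x\<bar> \<le> R + 1")
      case True
      have "\<bar>\<phi> (x, t) - \<phi> (x, g (Suc i))\<bar> * ?c \<le> e * 1"
        by (intro mult_mono osc True i cutoff_le_1 e cutoff_nonneg)
      then show ?thesis by (simp add: abs_mult cutoff_nonneg)
    next
      case False
      then show ?thesis using cutoff_eq_0[of R x] e by simp
    qed
    moreover have "\<bar>\<phi> (x, t) * (1 - ?c)\<bar> \<le> C * (1 - ?c)"
    proof -
      have "\<bar>\<phi> (x, t)\<bar> * (1 - ?c) \<le> C * (1 - ?c)"
        using xt cutoff_le_1[of R x] by (intro mult_right_mono C) auto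
      then show ?thesis using cutoff_le_1[of R x] by (simp add: abs_mult)
    qed
    ultimately show ?thesis unfolding k_def xt(1) by simp
  qed
  have k_meas: "k \<in> borel_measurable borel" unfolding k_def by measurable
  have k_bd: "\<bar>k x\<bar> \<le> e + C" for x
  proof -
    have "0 \<le> C * (1 - cutoff R x)"
      using C0 cutoff_le_1[of R x] by simp
    moreover have "C * (1 - cutoff R x) \<le> C * 1"
      by (rule mult_left_mono[OF _ C0]) (simp add: cutoff_nonneg)
    ultimately
    show ?thesis unfolding k_def using e by simp
  qed
  have k_int: "integrable ?R (\<lambda>p. k (fst p))"
    by (rule R.integrable_const_bound[of _ "e + C"])
       (use k_bd measurable_compose[OF fst_meas k_meas] in auto)
  have "\<bar>(\<integral>p. \<phi> p \<partial>?R) - (\<integral>p. \<psi> p \<partial>?R)\<bar> = \<bar>\<integral>p. \<phi> p - \<psi> p \<partial>?R\<bar>"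
    by (simp only: Bochner_Integration.integral_diff[OF \<phi>_int \<psi>_int])
  also have "\<dots> \<le> (\<integral>p. \<bar>\<phi> p - \<psi> p\<bar> \<partial>?R)" by (rule integral_abs_bound)
  also have "\<dots> \<le> (\<integral>p. k (fst p) \<partial>?R)"
    by (rule integral_mono[OF integrable_abs[OF Bochner_Integration.integrable_diff[OF \<phi>_int \<psi>_int]] k_int close])
  also have "\<dots> = (\<integral>x. k x \<partial>\<eta> T)"
    unfolding integral_strip[OF zero_in_time T T0 k_meas k_bd] by (simp add: integral_eta_zero)
  also have "\<dots> = e * measure (\<eta> T) UNIV + C * (\<integral>x. 1 - cutoff R x \<partial>\<eta> T)"
  proof -
    interpret \<eta>: finite_borel_measure "\<eta> T" by (rule finite_borel[OF T])
    have "integrable (\<eta> T) (\<lambda>x. 1 - cutoff R x)"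
      by (rule \<eta>.integrable_bounded[of _ 1]) (use cutoff_nonneg[of R] cutoff_le_1[of R] in auto)
    then have "(\<integral>x. k x \<partial>\<eta> T) = (\<integral>x. e \<partial>\<eta> T) + (\<integral>x. C * (1 - cutoff R x) \<partial>\<eta> T)"
      unfolding k_def by (intro Bochner_Integration.integral_add integrable_mult_right \<eta>.integrable_const)
    also have "(\<integral>x. C * (1 - cutoff R x) \<partial>\<eta> T) = C * (\<integral>x. 1 - cutoff R x \<partial>\<eta> T)"
      by (rule integral_mult_right_zero)
    finally show ?thesis by (simp add: \<eta>.space_M_UNIV mult.commute)
  qed
  finally show ?thesis unfolding \<psi>_eq integral_closed_strip[OF T \<phi>] .
qed

end

text \<open>
  Testing with functions of the position alone recovers \<open>\<eta>\<^sub>T\<close> from the strip up to \<open>T\<close>. Conversely,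
  the time sums converge termwise, and their errors are uniformly small because the masses
  and the tails of \<open>\<eta>\<^sub>T\<close> converge as well.
\<close>

lemma weakly_converges_space_time_iff:
  assumes gen_n: "\<And>n. generator I (\<gamma> n) (\<eta> n)" and gen: "generator I \<gamma>' \<eta>'"
  shows "(\<forall>t\<in>I. weakly_converges UNIV (\<lambda>n. \<eta> n t) (\<eta>' t)) \<longleftrightarrow>
    (\<forall>T\<in>I. weakly_converges (UNIV \<times> {0..T})
       (\<lambda>n. restrict_space (space_time_measure I (\<eta> n)) (UNIV \<times> {0..T}))
       (restrict_space (space_time_measure I \<eta>') (UNIV \<times> {0..T})))" (is "?L \<longleftrightarrow> ?R")
proof
  assume R: ?R
  show ?L
  proof
    fix T assume T: "T \<in> I"
    show "weakly_converges UNIV (\<lambda>n. \<eta> n T) (\<eta>' T)"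
      unfolding weakly_converges_def
    proof (intro allI impI, elim conjE)
      fix g :: "real \<Rightarrow> real" assume g: "continuous_on UNIV g" and bd: "bounded (range g)"
      then obtain C where C: "\<And>x. \<bar>g x\<bar> \<le> C" unfolding bounded_iff by auto
      have meas: "g \<in> borel_measurable borel" by (rule borel_measurable_continuous_onI[OF g])
      have c: "continuous_on (UNIV \<times> {0..T}) (\<lambda>p. g (fst p))"
        by (rule continuous_on_compose2[OF g]) (auto intro: continuous_intros)
      have "bounded ((\<lambda>p. g (fst p)) ` (UNIV \<times> {0..T}))"
        using C unfolding bounded_iff by auto
      with R T c have lim: "(\<lambda>n. \<integral>p. g (fst p) \<partial>restrict_space (space_time_measure I (\<eta> n)) (UNIV \<times> {0..T}))
         \<longlonglongrightarrow> (\<integral>p. g (fst p) \<partial>restrict_space (space_time_measure I \<eta>') (UNIV \<times> {0..T}))"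
        unfolding weakly_converges_def by blast
      have eq: "(\<integral>p. g (fst p) \<partial>restrict_space (space_time_measure I \<eta>'') (UNIV \<times> {0..T})) = (\<integral>x. g x \<partial>\<eta>'' T)"
        if "generator I \<gamma>'' \<eta>''" for \<gamma>'' \<eta>''
      proof -
        interpret generator I \<gamma>'' \<eta>'' by fact
        show ?thesis
          unfolding integral_closed_strip[OF T c] integral_strip[OF zero_in_time T time_nonneg[OF T] meas C]
          by (simp add: integral_eta_zero)
      qed
      show "(\<lambda>n. \<integral>x. g x \<partial>\<eta> n T) \<longlonglongrightarrow> (\<integral>x. g x \<partial>\<eta>' T)"
        using lim unfolding eq[OF gen_n] eq[OF gen] .
    qed
  qed
next
  assume L: ?L
  have conv: "(\<lambda>n. \<integral>x. k x \<partial>\<eta> n t) \<longlonglongrightarrow> (\<integral>x. k x \<partial>\<eta>' t)"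
    if "t \<in> I" "continuous_on UNIV k" "\<And>x. \<bar>k x\<bar> \<le> c" for t c and k :: "real \<Rightarrow> real"
  proof -
    have "bounded (range k)" unfolding bounded_iff using that(3) by auto
    then show ?thesis using L that(1,2) unfolding weakly_converges_def by simp
  qed
  interpret L: generator I \<gamma>' \<eta>' by (rule gen)
  show ?R
  proof
    fix T assume T: "T \<in> I"
    have T0: "0 \<le> T" by (rule L.time_nonneg[OF T])
    show "weakly_converges (UNIV \<times> {0..T})
       (\<lambda>n. restrict_space (space_time_measure I (\<eta> n)) (UNIV \<times> {0..T}))
       (restrict_space (space_time_measure I \<eta>') (UNIV \<times> {0..T}))"
      unfolding weakly_converges_def
    proof (intro allI impI, elim conjE)
      fix \<phi> :: "real \<times> real \<Rightarrow> real"
      assume \<phi>: "continuous_on (UNIV \<times> {0..T}) \<phi>" and bd: "bounded (\<phi> ` (UNIV \<times> {0..T}))"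
      obtain C where C: "0 < C" "\<And>x t. t \<in> {0..T} \<Longrightarrow> \<bar>\<phi> (x, t)\<bar> \<le> C"
        using bd unfolding bounded_pos by auto
      let ?A = "\<lambda>n. \<integral>p. \<phi> p \<partial>restrict_space (space_time_measure I (\<eta> n)) (UNIV \<times> {0..T})"
      let ?A' = "\<integral>p. \<phi> p \<partial>restrict_space (space_time_measure I \<eta>') (UNIV \<times> {0..T})"
      show "?A \<longlonglongrightarrow> ?A'"
      proof (rule LIMSEQ_I)
        fix e :: real assume e: "0 < e"
        define m where "m = measure (\<eta>' T) UNIV"
        have m0: "0 \<le> m" by (simp add: m_def)
        define d where "d = e / (8 * (m + 1))"
        have d: "0 < d" "d * m \<le> e / 8"
          using e m0 by (auto simp: d_def field_simps)
        obtain R where R: "0 \<le> R" "(\<integral>x. 1 - cutoff R x \<partial>\<eta>' T) < e / (8 * C)"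
          using finite_borel_measure.cutoff_tail_less[OF L.finite_borel[OF T], of "e / (8 * C)"] e C(1) by auto
        have tail: "C * (\<integral>x. 1 - cutoff R x \<partial>\<eta>' T) < e / 8"
          using R(2) C(1) by (simp add: field_simps)
        define K where "K = {- (R + 1)..R + 1} \<times> {0..T}"
        have uc: "uniformly_continuous_on K \<phi>"
          by (rule compact_uniformly_continuous[OF continuous_on_subset[OF \<phi>]])
             (auto simp: K_def intro!: compact_Times)
        obtain \<delta> where \<delta>: "0 < \<delta>" "\<forall>p\<in>K. \<forall>p'\<in>K. dist p' p < \<delta> \<longrightarrow> dist (\<phi> p') (\<phi> p) < d"
          using uc[unfolded uniformly_continuous_on_def, rule_format, OF d(1)] by blast
        obtain N and g :: "nat \<Rightarrow> real" where g: "g 0 = 0" "g N = T" "mono g" "\<And>i. g i \<in> {0..T}"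
          "\<And>i. g (Suc i) - g i \<le> \<delta> / 2"
          by (rule fine_grid[OF T0 half_gt_zero[OF \<delta>(1)]], rule that)
        have osc: "\<bar>\<phi> (x, t) - \<phi> (x, g (Suc i))\<bar> \<le> d" if x: "\<bar>x\<bar> \<le> R + 1" and t: "g i < t" "t \<le> g (Suc i)" for i x t
        proof -
          have "(x, t) \<in> K" "(x, g (Suc i)) \<in> K"
            using x t g(4)[of i] g(4)[of "Suc i"] by (auto simp: K_def)
          moreover have "dist (x, t) (x, g (Suc i)) < \<delta>"
            using t g(5)[of i] \<delta>(1) by (simp add: dist_Pair_Pair dist_real_def)
          ultimately have "dist (\<phi> (x, t)) (\<phi> (x, g (Suc i))) < d" using \<delta>(2) by blast
          then show ?thesis by (simp add: dist_real_def)
        qed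
        define h where "h i x = \<phi> (x, g (Suc i)) * cutoff R x" for i x
        let ?S = "\<lambda>\<eta>''. \<Sum>i<N. (\<integral>x. h i x \<partial>\<eta>'' (g (Suc i))) - (\<integral>x. h i x \<partial>\<eta>'' (g i))"
        have approx: "\<bar>(\<integral>p. \<phi> p \<partial>restrict_space (space_time_measure I \<eta>'') (UNIV \<times> {0..T})) - ?S \<eta>''\<bar>
            \<le> d * measure (\<eta>'' T) UNIV + C * (\<integral>x. 1 - cutoff R x \<partial>\<eta>'' T)"
          if "generator I \<gamma>'' \<eta>''" for \<gamma>'' and \<eta>'' :: "real \<Rightarrow> real measure"
          unfolding h_def
          by (rule generator.space_time_riemann_sum[OF that T \<phi> C(2) g(1-4) osc less_imp_le[OF d(1)]])
        have gI: "g i \<in> I" for i using g(4) L.strip_subset(2)[OF T] by blast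
        have h_cont: "continuous_on UNIV (h i)" for i
        proof -
          have "continuous_on UNIV (\<lambda>x. \<phi> (x, g (Suc i)))"
            by (rule continuous_on_compose2[OF \<phi>, of UNIV "\<lambda>x. (x, g (Suc i))"]) (use g(4) in \<open>auto intro!: continuous_intros\<close>)
          then show ?thesis unfolding h_def by (intro continuous_on_mult continuous_on_cutoff)
        qed
        have h_bd: "\<bar>h i x\<bar> \<le> C" for i x
        proof -
          have "\<bar>\<phi> (x, g (Suc i))\<bar> * cutoff R x \<le> C * 1"
            by (intro mult_mono C(2) g(4) cutoff_le_1 cutoff_nonneg) (use C(1) in simp)
          then show ?thesis by (simp add: h_def abs_mult cutoff_nonneg)
        qed
        have S_conv: "(\<lambda>n. ?S (\<eta> n)) \<longlonglongrightarrow> ?S \<eta>'"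
          by (intro tendsto_sum tendsto_diff conv[OF gI h_cont h_bd])
        have S: "\<forall>\<^sub>F n in sequentially. \<bar>?S (\<eta> n) - ?S \<eta>'\<bar> < e / 4"
          using tendstoD[OF S_conv, of "e / 4"] e by (simp add: dist_real_def)
        have mass_conv: "(\<lambda>n. measure (\<eta> n T) UNIV) \<longlonglongrightarrow> measure (\<eta>' T) UNIV"
          by (rule weakly_converges_mass) (use L T generator.finite_borel[OF gen_n T] L.finite_borel[OF T] in auto)
        have tail_conv: "(\<lambda>n. \<integral>x. 1 - cutoff R x \<partial>\<eta> n T) \<longlonglongrightarrow> (\<integral>x. 1 - cutoff R x \<partial>\<eta>' T)"
          by (rule conv[OF T, of _ 1])
             (use cutoff_nonneg[of R] cutoff_le_1[of R] in \<open>auto intro!: continuous_intros continuous_on_cutoff\<close>)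
        have err_conv: "(\<lambda>n. d * measure (\<eta> n T) UNIV + C * (\<integral>x. 1 - cutoff R x \<partial>\<eta> n T)) \<longlonglongrightarrow>
            d * measure (\<eta>' T) UNIV + C * (\<integral>x. 1 - cutoff R x \<partial>\<eta>' T)"
          by (intro tendsto_intros mass_conv tail_conv)
        have err: "d * measure (\<eta>' T) UNIV + C * (\<integral>x. 1 - cutoff R x \<partial>\<eta>' T) < e / 4"
          using d(2) tail unfolding m_def by linarith
        have "\<forall>\<^sub>F n in sequentially. d * measure (\<eta> n T) UNIV + C * (\<integral>x. 1 - cutoff R x \<partial>\<eta> n T) < e / 4"
          using err_conv err by (rule order_tendstoD(2))
        with S have "\<forall>\<^sub>F n in sequentially. norm (?A n - ?A') < e"
        proof eventually_elim
          case (elim n)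
          show ?case using approx[OF gen_n, of n] approx[OF gen] elim err unfolding real_norm_def by linarith
        qed
        then show "\<exists>no. \<forall>n\<ge>no. norm (?A n - ?A') < e" by (simp add: eventually_sequentially)
      qed
    qed
  qed
qed

section \<open>Locally uniform convergence as continuous convergence\<close>

text \<open>
  If uniformity fails on a compact set, then it fails along points of the set that, after
  passing to a subsequence, converge.
\<close>

lemma loc_uniform_limitI_sequences:
  fixes h :: "nat \<Rightarrow> 't::heine_borel \<Rightarrow> 'b::metric_space"
  assumes cont: "continuous_on S l"
    and seq: "\<And>r \<tau> \<tau>0. \<lbrakk>strict_mono r; \<And>k. \<tau> k \<in> S; \<tau>0 \<in> S; \<tau> \<longlonglongrightarrow> \<tau>0\<rbrakk> \<Longrightarrow>
                 (\<lambda>k. h (r k) (\<tau> k)) \<longlonglongrightarrow> l \<tau>0"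
  shows "loc_uniform_limit S h l"
  unfolding loc_uniform_limit_def
proof (intro allI impI, elim conjE)
  fix K assume K: "compact K" "K \<subseteq> S"
  show "uniform_limit K h l sequentially"
  proof (rule ccontr)
    assume "\<not> uniform_limit K h l sequentially"
    then obtain e where e: "0 < e" "\<not> (\<forall>\<^sub>F n in sequentially. \<forall>x\<in>K. dist (h n x) (l x) < e)"
      unfolding uniform_limit_iff by blast
    define N where "N = {n. \<not> (\<forall>x\<in>K. dist (h n x) (l x) < e)}"
    have "\<forall>m. \<exists>n\<ge>m. n \<in> N"
      using e(2) unfolding eventually_sequentially N_def by blast
    then have "infinite N" unfolding infinite_nat_iff_unbounded_le by simp
    then obtain r :: "nat \<Rightarrow> nat" where r: "strict_mono r" "\<And>k. r k \<in> N"
      using infinite_enumerate by blast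
    have "\<forall>k. \<exists>x\<in>K. e \<le> dist (h (r k) x) (l x)"
      using r(2) unfolding N_def by (auto simp: not_less)
    then obtain x where x: "\<And>k. x k \<in> K" "\<And>k. e \<le> dist (h (r k) (x k)) (l (x k))" by metis
    obtain x0 q where q: "x0 \<in> K" "strict_mono (q :: nat \<Rightarrow> nat)" "(x \<circ> q) \<longlonglongrightarrow> x0"
      using K(1) x(1) unfolding compact_def by blast
    have x0: "x0 \<in> S" and xS: "\<And>k. (x \<circ> q) k \<in> S" using q(1) x(1) K(2) by auto
    have "(\<lambda>k. h ((r \<circ> q) k) ((x \<circ> q) k)) \<longlonglongrightarrow> l x0"
      by (rule seq[OF strict_mono_o[OF r(1) q(2)] xS x0 q(3)])
    moreover have "(\<lambda>k. l ((x \<circ> q) k)) \<longlonglongrightarrow> l x0"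
      by (rule continuous_on_tendsto_compose[OF cont q(3) x0]) (use xS in auto)
    ultimately have "(\<lambda>k. dist (h ((r \<circ> q) k) ((x \<circ> q) k)) (l ((x \<circ> q) k))) \<longlonglongrightarrow> dist (l x0) (l x0)"
      by (rule tendsto_dist)
    then have "\<forall>\<^sub>F k in sequentially. dist (h ((r \<circ> q) k) ((x \<circ> q) k)) (l ((x \<circ> q) k)) < e"
      using e(1) by (intro order_tendstoD(2)) auto
    then obtain k where "dist (h ((r \<circ> q) k) ((x \<circ> q) k)) (l ((x \<circ> q) k)) < e"
      using eventually_happens'[OF sequentially_bot] by blast
    with x(2)[of "q k"] show False by simp
  qed
qed

text \<open>A convergent sequence together with its limit is compact.\<close>

lemma loc_uniform_limitD_sequences:
  fixes h :: "nat \<Rightarrow> 't::heine_borel \<Rightarrow> 'b::metric_space"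
  assumes lim: "loc_uniform_limit S h l" and cont: "continuous_on S l"
    and r: "strict_mono r" and \<tau>: "\<And>k. \<tau> k \<in> S" "\<tau>0 \<in> S" "\<tau> \<longlonglongrightarrow> \<tau>0"
  shows "(\<lambda>k. h (r k) (\<tau> k)) \<longlonglongrightarrow> l \<tau>0"
proof (rule tendstoI)
  fix e :: real assume e: "0 < e"
  let ?K = "insert \<tau>0 (range \<tau>)"
  have "compact ?K" by (rule compact_sequence_with_limit[OF \<tau>(3)])
  moreover have "?K \<subseteq> S" using \<tau>(1,2) by auto
  ultimately have "uniform_limit ?K h l sequentially" using lim unfolding loc_uniform_limit_def by blast
  then have "\<forall>\<^sub>F n in sequentially. \<forall>x\<in>?K. dist (h n x) (l x) < e / 2"
    by (rule uniform_limitD[OF _ half_gt_zero[OF e]])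
  then have "\<forall>\<^sub>F k in sequentially. \<forall>x\<in>?K. dist (h (r k) x) (l x) < e / 2"
    by (rule eventually_subseq[OF r])
  moreover have "(\<lambda>k. l (\<tau> k)) \<longlonglongrightarrow> l \<tau>0"
    by (rule continuous_on_tendsto_compose[OF cont \<tau>(3,2)]) (use \<tau>(1) in auto)
  then have "\<forall>\<^sub>F k in sequentially. dist (l (\<tau> k)) (l \<tau>0) < e / 2"
    by (rule tendstoD) (use e in simp)
  ultimately show "\<forall>\<^sub>F k in sequentially. dist (h (r k) (\<tau> k)) (l \<tau>0) < e"
  proof eventually_elim
    case (elim k)
    then have "dist (h (r k) (\<tau> k)) (l (\<tau> k)) < e / 2" by simp
    with elim(2) show ?case using dist_triangle[of "h (r k) (\<tau> k)" "l \<tau>0" "l (\<tau> k)"] by linarith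
  qed
qed

lemma loc_uniform_limit_cong:
  assumes "\<And>n x. x \<in> S \<Longrightarrow> h n x = h' n x" "\<And>x. x \<in> S \<Longrightarrow> l x = l' x"
  shows "loc_uniform_limit S h l \<longleftrightarrow> loc_uniform_limit S h' l'"
proof -
  have "uniform_limit K h l sequentially \<longleftrightarrow> uniform_limit K h' l' sequentially" if "K \<subseteq> S" for K
    by (rule uniform_limit_cong') (use assms that in auto)
  then show ?thesis unfolding loc_uniform_limit_def by blast
qed

section \<open>Free convolution hemigroups and their generators\<close>

text \<open>
  Two generating pairs of the same measure have transforms that agree on a cone, hence on the
  whole half-plane.
\<close>

lemma voiculescu_ext_eq_pick_function:
  assumes \<mu>: "real_distribution \<mu>" and pair: "free_generating_pair \<mu> \<gamma> \<eta>" and z: "0 < Im z"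
  shows "voiculescu_ext \<mu> z = pick_function \<gamma> \<eta> z"
  unfolding voiculescu_ext_def
proof (rule the_equality, goal_cases)
  case 1
  show ?case using pair by blast
next
  case (2 w)
  then obtain \<gamma>' \<eta>' where pair': "free_generating_pair \<mu> \<gamma>' \<eta>'" and w: "w = pick_function \<gamma>' \<eta>' z" by blast
  have fb: "finite_borel_measure \<eta>" "finite_borel_measure \<eta>'"
    using pair pair' by (auto simp: free_generating_pair_def)
  obtain b where b: "0 < b" "trunc_cone 2 b \<subseteq> voiculescu_domain \<mu>"
    by (rule real_distribution.voiculescu_domain_contains_cone[OF \<mu>])
  have cone: "Complex 0 (b + 1) \<in> trunc_cone 2 b" using b(1) by (intro imaginary_in_trunc_cone) auto
  have "pick_function \<gamma>' \<eta>' z - pick_function \<gamma> \<eta> z = 0"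
  proof (rule analytic_continuation[of "\<lambda>w. pick_function \<gamma>' \<eta>' w - pick_function \<gamma> \<eta> w" upper_half_plane
        "trunc_cone 2 b" "Complex 0 (b + 1)"])
    show "(\<lambda>w. pick_function \<gamma>' \<eta>' w - pick_function \<gamma> \<eta> w) holomorphic_on upper_half_plane"
      by (intro holomorphic_on_diff finite_borel_measure.holomorphic_pick_function fb)
    show "Complex 0 (b + 1) islimpt trunc_cone 2 b" by (rule open_imp_islimpt[OF open_trunc_cone cone])
    show "Complex 0 (b + 1) \<in> upper_half_plane" using cone trunc_cone_subset_upper_half_plane by blast
    fix w assume "w \<in> trunc_cone 2 b"
    then have "w \<in> voiculescu_domain \<mu>" using b(2) by blast
    then show "pick_function \<gamma>' \<eta>' w - pick_function \<gamma> \<eta> w = 0"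
      using pair pair' unfolding free_generating_pair_def by simp
  qed (use open_upper_half_plane connected_upper_half_plane trunc_cone_subset_upper_half_plane z
        in \<open>auto simp: upper_half_plane_def\<close>)
  then show ?case using w by simp
qed

locale free_hemigroup_generator = generator I \<gamma> \<eta>
  for I :: "real set" and \<gamma> :: "real \<Rightarrow> real" and \<eta> :: "real \<Rightarrow> real measure" +
  fixes f :: "real \<Rightarrow> real \<Rightarrow> real measure"
  assumes hemigroup: "free_hemigroup I f"
    and pair: "\<forall>t\<in>I. free_generating_pair (f 0 t) (\<gamma> t) (\<eta> t)"
begin

lemma distribution: "s \<in> I \<Longrightarrow> t \<in> I \<Longrightarrow> s \<le> t \<Longrightarrow> real_distribution (f s t)"
  using hemigroup unfolding free_hemigroup_def by blast

lemma distribution_zero: "t \<in> I \<Longrightarrow> real_distribution (f 0 t)"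
  by (rule distribution[OF zero_in_time _ time_nonneg])

lemma voiculescu_ext_zero: "t \<in> I \<Longrightarrow> 0 < Im z \<Longrightarrow> voiculescu_ext (f 0 t) z = pick_function (\<gamma> t) (\<eta> t) z"
  using voiculescu_ext_eq_pick_function[OF distribution_zero] pair by blast

lemma subordination_zero:
  assumes t: "t \<in> I" and z: "0 < Im z"
  shows "recip_cauchy_transform (f 0 t) z + pick_function (\<gamma> t) (\<eta> t) (recip_cauchy_transform (f 0 t) z) = z"
proof -
  obtain b where b: "trunc_cone 2 b \<subseteq> voiculescu_domain (f 0 t)"
    using real_distribution.voiculescu_domain_contains_cone[OF distribution_zero[OF t]] by blast
  show ?thesis
  proof (rule real_distribution.subordination_equation[OF distribution_zero[OF t] finite_borel[OF t] _ z])
    fix w assume "w \<in> trunc_cone 2 b"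
    then show "voiculescu (f 0 t) w = pick_function (\<gamma> t) (\<eta> t) w"
      using b pair t unfolding free_generating_pair_def by blast
  qed
qed

text \<open>
  The increments of the generator form a generating pair of \<open>f s t\<close>: on a cone common to the
  three domains this is the additivity of the Voiculescu transform.
\<close>

lemma subordination_increment:
  assumes st: "s \<in> I" "t \<in> I" "s \<le> t" and z: "0 < Im z"
  shows "recip_cauchy_transform (f s t) z +
     pick_function (\<gamma> t - \<gamma> s) (diff_measure (\<eta> t) (\<eta> s)) (recip_cauchy_transform (f s t) z) = z"
proof -
  obtain b1 where b1: "trunc_cone 2 b1 \<subseteq> voiculescu_domain (f 0 s)"
    using real_distribution.voiculescu_domain_contains_cone[OF distribution_zero[OF st(1)]] by blast
  obtain b2 where b2: "trunc_cone 2 b2 \<subseteq> voiculescu_domain (f s t)"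
    using real_distribution.voiculescu_domain_contains_cone[OF distribution[OF st]] by blast
  obtain b3 where b3: "trunc_cone 2 b3 \<subseteq> voiculescu_domain (f 0 t)"
    using real_distribution.voiculescu_domain_contains_cone[OF distribution_zero[OF st(2)]] by blast
  define b where "b = max b1 (max b2 b3)"
  have sub: "trunc_cone 2 b \<subseteq> trunc_cone 2 b1" "trunc_cone 2 b \<subseteq> trunc_cone 2 b2" "trunc_cone 2 b \<subseteq> trunc_cone 2 b3"
    by (rule trunc_cone_mono; simp add: b_def)+
  have conv: "is_free_convolution (f 0 s) (f s t) (f 0 t)"
    using hemigroup st zero_in_time time_nonneg[OF st(1)] unfolding free_hemigroup_def by blast
  show ?thesis
  proof (rule real_distribution.subordination_equation[OF distribution[OF st] finite_borel_increment[OF st] _ z])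
    fix w assume w: "w \<in> trunc_cone 2 b"
    then have dom: "w \<in> voiculescu_domain (f 0 s)" "w \<in> voiculescu_domain (f s t)" "w \<in> voiculescu_domain (f 0 t)"
      using sub b1 b2 b3 by blast+
    have Im: "0 < Im w" using w by (simp add: trunc_cone_iff)
    have "voiculescu (f 0 t) w = voiculescu (f 0 s) w + voiculescu (f s t) w"
      using conv dom unfolding is_free_convolution_def by blast
    moreover have "voiculescu (f 0 t) w = pick_function (\<gamma> t) (\<eta> t) w"
      using pair st(2) dom(3) unfolding free_generating_pair_def by blast
    moreover have "voiculescu (f 0 s) w = pick_function (\<gamma> s) (\<eta> s) w"
      using pair st(1) dom(1) unfolding free_generating_pair_def by blast
    ultimately show "voiculescu (f s t) w = pick_function (\<gamma> t - \<gamma> s) (diff_measure (\<eta> t) (\<eta> s)) w"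
      unfolding pick_function_diff_measure[OF finite_borel[OF st(2)] finite_borel[OF st(1)] emeasure_mono_time[OF st] Im]
      by simp
  qed
qed

lemma gamma_tendsto: "(\<And>k. t k \<in> I) \<Longrightarrow> t0 \<in> I \<Longrightarrow> t \<longlonglongrightarrow> t0 \<Longrightarrow> (\<lambda>k::nat. \<gamma> (t k)) \<longlonglongrightarrow> \<gamma> t0"
  by (rule continuous_on_tendsto_compose[OF gamma_cont]) auto

lemma eta_weakly_converges:
  assumes "\<And>k. t k \<in> I" "t0 \<in> I" "t \<longlonglongrightarrow> t0"
  shows "weakly_converges UNIV (\<lambda>k. \<eta> (t k)) (\<eta> t0)"
  unfolding weakly_converges_def
proof (intro allI impI, elim conjE)
  fix g :: "real \<Rightarrow> real" assume g: "continuous_on UNIV g" and "bounded (range g)"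
  then obtain C where C: "\<And>x. \<bar>g x\<bar> \<le> C" unfolding bounded_iff by auto
  have "continuous_on I (\<lambda>t. \<integral>x. g x \<partial>\<eta> t)"
    by (rule integral_time_continuous[OF borel_measurable_continuous_onI[OF g] C])
  then show "(\<lambda>k. \<integral>x. g x \<partial>\<eta> (t k)) \<longlonglongrightarrow> (\<integral>x. g x \<partial>\<eta> t0)"
    by (rule continuous_on_tendsto_compose[OF _ assms(3,2)]) (use assms(1) in auto)
qed

lemma pick_function_continuous:
  "continuous_on (upper_half_plane \<times> I) (\<lambda>(z, t). pick_function (\<gamma> t) (\<eta> t) z)"
proof (unfold continuous_on_sequentially, intro allI ballI impI, elim conjE)
  fix x :: "nat \<Rightarrow> complex \<times> real" and a
  assume a: "a \<in> upper_half_plane \<times> I" and x: "\<forall>n. x n \<in> upper_half_plane \<times> I" and lim: "x \<longlonglongrightarrow> a"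
  have x': "0 < Im (fst (x n))" "snd (x n) \<in> I" for n
    using x[rule_format, of n] by (auto simp: mem_Times_iff upper_half_plane_def)
  have a': "0 < Im (fst a)" "snd a \<in> I" using a by (auto simp: mem_Times_iff upper_half_plane_def)
  have "(\<lambda>n. pick_function (\<gamma> (snd (x n))) (\<eta> (snd (x n))) (fst (x n))) \<longlonglongrightarrow>
        pick_function (\<gamma> (snd a)) (\<eta> (snd a)) (fst a)"
    by (rule pick_function_tendsto[OF eta_weakly_converges[OF x'(2) a'(2) tendsto_snd[OF lim]]
          gamma_tendsto[OF x'(2) a'(2) tendsto_snd[OF lim]] finite_borel[OF x'(2)] finite_borel[OF a'(2)]
          x'(1) a'(1) tendsto_fst[OF lim]])
  then show "((\<lambda>(z, t). pick_function (\<gamma> t) (\<eta> t) z) \<circ> x) \<longlonglongrightarrow> (case a of (z, t) \<Rightarrow> pick_function (\<gamma> t) (\<eta> t) z)"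
    by (simp add: o_def split_beta)
qed

end

lemma free_hemigroup_generatorI:
  "time_interval I \<Longrightarrow> free_hemigroup_with_generator I f \<gamma> \<eta> \<Longrightarrow> free_hemigroup_generator I \<gamma> \<eta> f"
  unfolding free_hemigroup_with_generator_def
  by (intro free_hemigroup_generator.intro generator.intro free_hemigroup_generator_axioms.intro) auto

text \<open>
  The common form to which the conditions are brought. Testing along subsequences \<open>r\<close> as well as
  sequences of times makes it equivalent to locally uniform convergence.
\<close>

definition generators_converge_continuously ::
  "real set \<Rightarrow> (nat \<Rightarrow> real \<Rightarrow> real) \<Rightarrow> (nat \<Rightarrow> real \<Rightarrow> real measure) \<Rightarrow> (real \<Rightarrow> real) \<Rightarrow> (real \<Rightarrow> real measure) \<Rightarrow> bool"
  where "generators_converge_continuously I \<gamma> \<eta> \<gamma>' \<eta>' \<longleftrightarrow>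
    (\<forall>r t t0. strict_mono r \<and> (\<forall>k. t k \<in> I) \<and> t0 \<in> I \<and> t \<longlonglongrightarrow> t0 \<longrightarrow>
       (\<lambda>k. \<gamma> (r k) (t k)) \<longlonglongrightarrow> \<gamma>' t0 \<and> weakly_converges UNIV (\<lambda>k. \<eta> (r k) (t k)) (\<eta>' t0))"

locale converging_hemigroups =
  fixes I :: "real set" and f :: "nat \<Rightarrow> real \<Rightarrow> real \<Rightarrow> real measure"
    and \<gamma> :: "nat \<Rightarrow> real \<Rightarrow> real" and \<eta> :: "nat \<Rightarrow> real \<Rightarrow> real measure"
    and f' :: "real \<Rightarrow> real \<Rightarrow> real measure" and \<gamma>' :: "real \<Rightarrow> real" and \<eta>' :: "real \<Rightarrow> real measure"
  assumes hemi: "\<forall>n. free_hemigroup_generator I (\<gamma> n) (\<eta> n) (f n)"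
    and hemi': "free_hemigroup_generator I \<gamma>' \<eta>' f'"
begin

sublocale L: free_hemigroup_generator I \<gamma>' \<eta>' f' by (rule hemi')

lemma gen_n: "free_hemigroup_generator I (\<gamma> n) (\<eta> n) (f n)"
  using hemi by blast

lemma generator_n: "generator I (\<gamma> n) (\<eta> n)"
  by (rule free_hemigroup_generator.axioms(1)[OF gen_n])

lemmas fb_n = generator.finite_borel[OF generator_n]

lemma generators_converge_continuously_iff:
  "generators_converge_continuously I \<gamma> \<eta> \<gamma>' \<eta>' \<longleftrightarrow>
     loc_uniform_limit I \<gamma> \<gamma>' \<and> weakly_converges_loc_uniformly I \<eta> \<eta>'"
proof
  assume c: "generators_converge_continuously I \<gamma> \<eta> \<gamma>' \<eta>'"
  show "loc_uniform_limit I \<gamma> \<gamma>' \<and> weakly_converges_loc_uniformly I \<eta> \<eta>'"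
  proof
    show "loc_uniform_limit I \<gamma> \<gamma>'"
      by (rule loc_uniform_limitI_sequences[OF L.gamma_cont])
         (use c in \<open>simp add: generators_converge_continuously_def\<close>)
    show "weakly_converges_loc_uniformly I \<eta> \<eta>'"
      unfolding weakly_converges_loc_uniformly_def
    proof (intro allI impI, elim conjE)
      fix g :: "real \<Rightarrow> real" assume g: "continuous_on UNIV g" and bd: "bounded (range g)"
      obtain C where C: "\<And>x. \<bar>g x\<bar> \<le> C" using bd unfolding bounded_iff by auto
      show "loc_uniform_limit I (\<lambda>n \<tau>. \<integral>x. g x \<partial>\<eta> n \<tau>) (\<lambda>\<tau>. \<integral>x. g x \<partial>\<eta>' \<tau>)"
      proof (rule loc_uniform_limitI_sequences)
        show "continuous_on I (\<lambda>\<tau>. \<integral>x. g x \<partial>\<eta>' \<tau>)"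
          by (rule L.integral_time_continuous[OF borel_measurable_continuous_onI[OF g] C])
        fix r :: "nat \<Rightarrow> nat" and t t0
        assume "strict_mono r" "\<And>k. t k \<in> I" "t0 \<in> I" "t \<longlonglongrightarrow> t0"
        then have "weakly_converges UNIV (\<lambda>k. \<eta> (r k) (t k)) (\<eta>' t0)"
          using c unfolding generators_converge_continuously_def by simp
        then show "(\<lambda>k. \<integral>x. g x \<partial>\<eta> (r k) (t k)) \<longlonglongrightarrow> (\<integral>x. g x \<partial>\<eta>' t0)"
          using g bd unfolding weakly_converges_def by simp
      qed
    qed
  qed
next
  assume c: "loc_uniform_limit I \<gamma> \<gamma>' \<and> weakly_converges_loc_uniformly I \<eta> \<eta>'"
  show "generators_converge_continuously I \<gamma> \<eta> \<gamma>' \<eta>'"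
    unfolding generators_converge_continuously_def
  proof (intro allI impI, elim conjE)
    fix r :: "nat \<Rightarrow> nat" and t t0
    assume r: "strict_mono r" and t: "\<forall>k. t k \<in> I" "t0 \<in> I" "t \<longlonglongrightarrow> t0"
    note * = r t(1)[rule_format] t(2,3)
    show "(\<lambda>k. \<gamma> (r k) (t k)) \<longlonglongrightarrow> \<gamma>' t0 \<and> weakly_converges UNIV (\<lambda>k. \<eta> (r k) (t k)) (\<eta>' t0)"
    proof
      show "(\<lambda>k. \<gamma> (r k) (t k)) \<longlonglongrightarrow> \<gamma>' t0"
        by (rule loc_uniform_limitD_sequences[OF conjunct1[OF c] L.gamma_cont *])
      show "weakly_converges UNIV (\<lambda>k. \<eta> (r k) (t k)) (\<eta>' t0)"
        unfolding weakly_converges_def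
      proof (intro allI impI, elim conjE)
        fix g :: "real \<Rightarrow> real" assume g: "continuous_on UNIV g" and bd: "bounded (range g)"
        obtain C where C: "\<And>x. \<bar>g x\<bar> \<le> C" using bd unfolding bounded_iff by auto
        have "loc_uniform_limit I (\<lambda>n \<tau>. \<integral>x. g x \<partial>\<eta> n \<tau>) (\<lambda>\<tau>. \<integral>x. g x \<partial>\<eta>' \<tau>)"
          using c g bd unfolding weakly_converges_loc_uniformly_def by simp
        from loc_uniform_limitD_sequences[OF this
            L.integral_time_continuous[OF borel_measurable_continuous_onI[OF g] C] *]
        show "(\<lambda>k. \<integral>x. g x \<partial>\<eta> (r k) (t k)) \<longlonglongrightarrow> (\<integral>x. g x \<partial>\<eta>' t0)" .
      qed
    qed
  qed
qed

lemma integral_f'_continuous: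
  fixes g :: "real \<Rightarrow> real"
  assumes "continuous_on UNIV g" "bounded (range g)"
  shows "continuous_on (ordered_pairs I) (\<lambda>\<tau>. \<integral>x. g x \<partial>(case \<tau> of (s, t) \<Rightarrow> f' s t))"
  using L.hemigroup assms unfolding free_hemigroup_def weakly_continuous_on_def by simp

lemma hemigroups_converge_iff:
  "weakly_converges_loc_uniformly (ordered_pairs I) (\<lambda>n (s, t). f n s t) (\<lambda>(s, t). f' s t) \<longleftrightarrow>
   generators_converge_continuously I \<gamma> \<eta> \<gamma>' \<eta>'"
proof
  assume c: "weakly_converges_loc_uniformly (ordered_pairs I) (\<lambda>n (s, t). f n s t) (\<lambda>(s, t). f' s t)"
  show "generators_converge_continuously I \<gamma> \<eta> \<gamma>' \<eta>'"
    unfolding generators_converge_continuously_def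
  proof (intro allI impI, elim conjE)
    fix r :: "nat \<Rightarrow> nat" and t t0
    assume r: "strict_mono r" and t: "\<forall>k. t k \<in> I" "t0 \<in> I" "t \<longlonglongrightarrow> t0"
    have op: "(0, u) \<in> ordered_pairs I" if "u \<in> I" for u
      using that L.zero_in_time L.time_nonneg[OF that] by (simp add: ordered_pairs_def)
    have "weakly_converges UNIV (\<lambda>k. f (r k) 0 (t k)) (f' 0 t0)"
      unfolding weakly_converges_def
    proof (intro allI impI, elim conjE)
      fix g :: "real \<Rightarrow> real" assume g: "continuous_on UNIV g" "bounded (range g)"
      have "loc_uniform_limit (ordered_pairs I) (\<lambda>n \<tau>. \<integral>x. g x \<partial>(case \<tau> of (s, t) \<Rightarrow> f n s t))
          (\<lambda>\<tau>. \<integral>x. g x \<partial>(case \<tau> of (s, t) \<Rightarrow> f' s t))"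
        using c g unfolding weakly_converges_loc_uniformly_def by simp
      from loc_uniform_limitD_sequences[OF this integral_f'_continuous[OF g] r op[OF t(1)[rule_format]] op[OF t(2)]
          tendsto_Pair[OF tendsto_const t(3)]]
      show "(\<lambda>k. \<integral>x. g x \<partial>f (r k) 0 (t k)) \<longlonglongrightarrow> (\<integral>x. g x \<partial>f' 0 t0)" by simp
    qed
    note wc = this and t1 = t(1)[rule_format]
    note * = generating_pairs_converge_if_measures_converge[
        OF free_hemigroup_generator.distribution_zero[OF gen_n t1] L.distribution_zero[OF t(2)]
          fb_n[OF t1] L.finite_borel[OF t(2)] free_hemigroup_generator.subordination_zero[OF gen_n t1]
          L.subordination_zero[OF t(2)] wc]
    show "(\<lambda>k. \<gamma> (r k) (t k)) \<longlonglongrightarrow> \<gamma>' t0 \<and> weakly_converges UNIV (\<lambda>k. \<eta> (r k) (t k)) (\<eta>' t0)"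
      by (rule conjI, rule *(1), assumption, assumption, rule *(2))
  qed
next
  assume c: "generators_converge_continuously I \<gamma> \<eta> \<gamma>' \<eta>'"
  show "weakly_converges_loc_uniformly (ordered_pairs I) (\<lambda>n (s, t). f n s t) (\<lambda>(s, t). f' s t)"
    unfolding weakly_converges_loc_uniformly_def
  proof (intro allI impI, elim conjE)
    fix g :: "real \<Rightarrow> real" assume g: "continuous_on UNIV g" "bounded (range g)"
    show "loc_uniform_limit (ordered_pairs I) (\<lambda>n \<tau>. \<integral>x. g x \<partial>(case \<tau> of (s, t) \<Rightarrow> f n s t))
        (\<lambda>\<tau>. \<integral>x. g x \<partial>(case \<tau> of (s, t) \<Rightarrow> f' s t))"
    proof (rule loc_uniform_limitI_sequences[OF integral_f'_continuous[OF g]])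
      fix r :: "nat \<Rightarrow> nat" and \<tau> :: "nat \<Rightarrow> real \<times> real" and \<tau>0
      assume r: "strict_mono r" and \<tau>: "\<And>k. \<tau> k \<in> ordered_pairs I" "\<tau>0 \<in> ordered_pairs I" "\<tau> \<longlonglongrightarrow> \<tau>0"
      define s t s0 t0 where defs: "s = fst \<circ> \<tau>" "t = snd \<circ> \<tau>" "s0 = fst \<tau>0" "t0 = snd \<tau>0"
      have mem: "s k \<in> I" "t k \<in> I" "s k \<le> t k" for k
        using \<tau>(1)[of k] by (auto simp: defs ordered_pairs_def)
      have mem0: "s0 \<in> I" "t0 \<in> I" "s0 \<le> t0" using \<tau>(2) by (auto simp: defs ordered_pairs_def)
      have s: "s \<longlonglongrightarrow> s0" and t: "t \<longlonglongrightarrow> t0"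
        using tendsto_fst[OF \<tau>(3)] tendsto_snd[OF \<tau>(3)] by (simp_all add: defs o_def)
      have cs: "(\<lambda>k. \<gamma> (r k) (s k)) \<longlonglongrightarrow> \<gamma>' s0" "weakly_converges UNIV (\<lambda>k. \<eta> (r k) (s k)) (\<eta>' s0)"
        and ct: "(\<lambda>k. \<gamma> (r k) (t k)) \<longlonglongrightarrow> \<gamma>' t0" "weakly_converges UNIV (\<lambda>k. \<eta> (r k) (t k)) (\<eta>' t0)"
        using c r mem mem0 s t unfolding generators_converge_continuously_def by simp_all
      have "weakly_converges UNIV (\<lambda>k. f (r k) (s k) (t k)) (f' s0 t0)"
      proof (rule measures_converge_if_generating_pairs_converge)
        show "real_distribution (f (r k) (s k) (t k))" for k
          by (rule free_hemigroup_generator.distribution[OF gen_n mem])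
        show "real_distribution (f' s0 t0)" by (rule L.distribution[OF mem0])
        show "finite_borel_measure (diff_measure (\<eta> (r k) (t k)) (\<eta> (r k) (s k)))" for k
          by (rule generator.finite_borel_increment[OF generator_n mem])
        show "finite_borel_measure (diff_measure (\<eta>' t0) (\<eta>' s0))"
          by (rule L.finite_borel_increment[OF mem0])
        show "recip_cauchy_transform (f (r k) (s k) (t k)) z + pick_function (\<gamma> (r k) (t k) - \<gamma> (r k) (s k))
            (diff_measure (\<eta> (r k) (t k)) (\<eta> (r k) (s k))) (recip_cauchy_transform (f (r k) (s k) (t k)) z) = z"
          if "0 < Im z" for k z
          by (rule free_hemigroup_generator.subordination_increment[OF gen_n mem that])
        show "recip_cauchy_transform (f' s0 t0) z + pick_function (\<gamma>' t0 - \<gamma>' s0)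
            (diff_measure (\<eta>' t0) (\<eta>' s0)) (recip_cauchy_transform (f' s0 t0) z) = z" if "0 < Im z" for z
          by (rule L.subordination_increment[OF mem0 that])
        show "(\<lambda>k. \<gamma> (r k) (t k) - \<gamma> (r k) (s k)) \<longlonglongrightarrow> \<gamma>' t0 - \<gamma>' s0"
          by (intro tendsto_diff cs ct)
        show "weakly_converges UNIV (\<lambda>k. diff_measure (\<eta> (r k) (t k)) (\<eta> (r k) (s k))) (diff_measure (\<eta>' t0) (\<eta>' s0))"
          by (rule weakly_converges_diff_measure[OF fb_n[OF mem(2)] L.finite_borel[OF mem0(2)]
                fb_n[OF mem(1)] L.finite_borel[OF mem0(1)]
                generator.emeasure_mono_time[OF generator_n mem] L.emeasure_mono_time[OF mem0] ct(2) cs(2)])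
      qed
      then have "(\<lambda>k. \<integral>x. g x \<partial>f (r k) (s k) (t k)) \<longlonglongrightarrow> (\<integral>x. g x \<partial>f' s0 t0)"
        using g unfolding weakly_converges_def by simp
      then show "(\<lambda>k. \<integral>x. g x \<partial>(case \<tau> k of (s, t) \<Rightarrow> f (r k) s t)) \<longlonglongrightarrow> (\<integral>x. g x \<partial>(case \<tau>0 of (s, t) \<Rightarrow> f' s t))"
        by (simp add: defs split_beta)
    qed
  qed
qed

lemma transforms_loc_uniform_if_generators_converge:
  assumes c: "generators_converge_continuously I \<gamma> \<eta> \<gamma>' \<eta>'"
  shows "loc_uniform_limit (upper_half_plane \<times> I)
     (\<lambda>n (z, t). voiculescu_ext (f n 0 t) z) (\<lambda>(z, t). voiculescu_ext (f' 0 t) z)"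
proof -
  have "loc_uniform_limit (upper_half_plane \<times> I)
     (\<lambda>n (z, t). pick_function (\<gamma> n t) (\<eta> n t) z) (\<lambda>(z, t). pick_function (\<gamma>' t) (\<eta>' t) z)"
  proof (rule loc_uniform_limitI_sequences[OF L.pick_function_continuous])
    fix r :: "nat \<Rightarrow> nat" and \<tau> :: "nat \<Rightarrow> complex \<times> real" and \<tau>0
    assume r: "strict_mono r" and \<tau>: "\<And>k. \<tau> k \<in> upper_half_plane \<times> I" "\<tau>0 \<in> upper_half_plane \<times> I" "\<tau> \<longlonglongrightarrow> \<tau>0"
    have mem: "0 < Im (fst (\<tau> k))" "snd (\<tau> k) \<in> I" for k
      using \<tau>(1)[of k] by (auto simp: mem_Times_iff upper_half_plane_def)
    have mem0: "0 < Im (fst \<tau>0)" "snd \<tau>0 \<in> I" using \<tau>(2) by (auto simp: mem_Times_iff upper_half_plane_def)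
    have "(\<lambda>k. \<gamma> (r k) (snd (\<tau> k))) \<longlonglongrightarrow> \<gamma>' (snd \<tau>0)"
      and "weakly_converges UNIV (\<lambda>k. \<eta> (r k) (snd (\<tau> k))) (\<eta>' (snd \<tau>0))"
      using c[unfolded generators_converge_continuously_def, rule_format, of r "\<lambda>k. snd (\<tau> k)" "snd \<tau>0"]
        r mem mem0 tendsto_snd[OF \<tau>(3)] by simp_all
    from pick_function_tendsto[OF this(2,1) fb_n[OF mem(2)] L.finite_borel[OF mem0(2)] mem(1) mem0(1) tendsto_fst[OF \<tau>(3)]]
    show "(\<lambda>k. case \<tau> k of (z, t) \<Rightarrow> pick_function (\<gamma> (r k) t) (\<eta> (r k) t) z) \<longlonglongrightarrow>
        (case \<tau>0 of (z, t) \<Rightarrow> pick_function (\<gamma>' t) (\<eta>' t) z)" by (simp add: split_beta)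
  qed
  then show ?thesis
  proof (rule iffD2[OF loc_uniform_limit_cong, rotated 2])
    show "(case x of (z, t) \<Rightarrow> voiculescu_ext (f n 0 t) z) = (case x of (z, t) \<Rightarrow> pick_function (\<gamma> n t) (\<eta> n t) z)"
      if "x \<in> upper_half_plane \<times> I" for n x
      using that free_hemigroup_generator.voiculescu_ext_zero[OF gen_n] by (auto simp: upper_half_plane_def)
    show "(case x of (z, t) \<Rightarrow> voiculescu_ext (f' 0 t) z) = (case x of (z, t) \<Rightarrow> pick_function (\<gamma>' t) (\<eta>' t) z)"
      if "x \<in> upper_half_plane \<times> I" for x
      using that L.voiculescu_ext_zero by (auto simp: upper_half_plane_def)
  qed
qed

lemma generators_converge_if_transforms_converge_on:
  assumes A: "A \<subseteq> upper_half_plane" "\<xi> \<in> upper_half_plane" "\<xi> islimpt A"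
    and c: "\<forall>z\<in>A. loc_uniform_limit I (\<lambda>n t. voiculescu_ext (f n 0 t) z) (\<lambda>t. voiculescu_ext (f' 0 t) z)"
  shows "generators_converge_continuously I \<gamma> \<eta> \<gamma>' \<eta>'"
  unfolding generators_converge_continuously_def
proof (intro allI impI, elim conjE)
  fix r :: "nat \<Rightarrow> nat" and t t0
  assume r: "strict_mono r" and t: "\<forall>k. t k \<in> I" "t0 \<in> I" "t \<longlonglongrightarrow> t0"
  note t1 = t(1)[rule_format]
  have conv: "(\<lambda>k. pick_function (\<gamma> (r k) (t k)) (\<eta> (r k) (t k)) z) \<longlonglongrightarrow> pick_function (\<gamma>' t0) (\<eta>' t0) z"
    if z: "z \<in> A" for z
  proof -
    have Im: "0 < Im z" using z A(1) by (auto simp: upper_half_plane_def)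
    have "loc_uniform_limit I (\<lambda>n t. voiculescu_ext (f n 0 t) z) (\<lambda>t. voiculescu_ext (f' 0 t) z)"
      using c z by blast
    then have "loc_uniform_limit I (\<lambda>n t. pick_function (\<gamma> n t) (\<eta> n t) z) (\<lambda>t. pick_function (\<gamma>' t) (\<eta>' t) z)"
    proof (rule iffD1[OF loc_uniform_limit_cong, rotated 2])
      show "voiculescu_ext (f n 0 t) z = pick_function (\<gamma> n t) (\<eta> n t) z" if "t \<in> I" for n t
        by (rule free_hemigroup_generator.voiculescu_ext_zero[OF gen_n that Im])
      show "voiculescu_ext (f' 0 t) z = pick_function (\<gamma>' t) (\<eta>' t) z" if "t \<in> I" for t
        by (rule L.voiculescu_ext_zero[OF that Im])
    qed
    moreover have "continuous_on I (\<lambda>t. pick_function (\<gamma>' t) (\<eta>' t) z)"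
    proof -
      have "continuous_on I (\<lambda>t. case (z, t) of (z, t) \<Rightarrow> pick_function (\<gamma>' t) (\<eta>' t) z)"
        by (rule continuous_on_compose2[OF L.pick_function_continuous, of I "\<lambda>t. (z, t)"])
           (use Im in \<open>auto simp: upper_half_plane_def intro!: continuous_intros\<close>)
      then show ?thesis by simp
    qed
    ultimately show ?thesis by (rule loc_uniform_limitD_sequences[OF _ _ r t1 t(2,3)])
  qed
  note * = generating_pair_converges_if_pick_function_converges[OF fb_n[OF t1] L.finite_borel[OF t(2)] A conv]
  show "(\<lambda>k. \<gamma> (r k) (t k)) \<longlonglongrightarrow> \<gamma>' t0 \<and> weakly_converges UNIV (\<lambda>k. \<eta> (r k) (t k)) (\<eta>' t0)"
    by (intro conjI *)
qed

end

lemma loc_uniform_limit_section: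
  assumes lim: "loc_uniform_limit (S \<times> T) h l" and z: "z \<in> S"
  shows "loc_uniform_limit T (\<lambda>n t. h n (z, t)) (\<lambda>t. l (z, t))"
  unfolding loc_uniform_limit_def
proof (intro allI impI)
  fix K assume K: "compact K \<and> K \<subseteq> T"
  then have "compact ({z} \<times> K)" "{z} \<times> K \<subseteq> S \<times> T" using z by (auto intro: compact_Times)
  then have "uniform_limit ({z} \<times> K) h l sequentially" using lim unfolding loc_uniform_limit_def by blast
  then show "uniform_limit K (\<lambda>n t. h n (z, t)) (\<lambda>t. l (z, t)) sequentially"
    unfolding uniform_limit_iff by simp
qed

lemma weakly_converges_pointwise_if_loc_uniformly:
  assumes "weakly_converges_loc_uniformly I M N" "t \<in> I"
  shows "weakly_converges UNIV (\<lambda>n. M n t) (N t)"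
  unfolding weakly_converges_def
proof (intro allI impI)
  fix g :: "real \<Rightarrow> real" assume "continuous_on UNIV g \<and> bounded (range g)"
  then have "loc_uniform_limit I (\<lambda>n \<tau>. \<integral>x. g x \<partial>M n \<tau>) (\<lambda>\<tau>. \<integral>x. g x \<partial>N \<tau>)"
    using assms(1) unfolding weakly_converges_loc_uniformly_def by simp
  from this[unfolded loc_uniform_limit_def, rule_format, of "{t}"]
  show "(\<lambda>n. \<integral>x. g x \<partial>M n t) \<longlonglongrightarrow> (\<integral>x. g x \<partial>N t)"
    using assms(2) by simp
qed

text \<open>
  Every condition involving the hemigroups or the transforms is equivalent to continuous
  convergence of the generators, and so is the conjunction of the conditions on \<open>\<gamma>\<close> and \<open>\<eta>\<close>.
\<close>

theorem theorem7p7: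
  fixes I :: "real set"
    and A :: "complex set"
    and f :: "nat \<Rightarrow> real \<Rightarrow> real \<Rightarrow> real measure"
    and \<gamma> :: "nat \<Rightarrow> real \<Rightarrow> real"
    and \<eta> :: "nat \<Rightarrow> real \<Rightarrow> real measure"
    and f_lim :: "real \<Rightarrow> real \<Rightarrow> real measure"
    and \<gamma>_lim :: "real \<Rightarrow> real"
    and \<eta>_lim :: "real \<Rightarrow> real measure"
  assumes "time_interval I"
    and "A \<subseteq> upper_half_plane"
    and "\<exists>z\<in>upper_half_plane. z islimpt A"
    and "\<And>n. free_hemigroup_with_generator I (f n) (\<gamma> n) (\<eta> n)"
    and "free_hemigroup_with_generator I f_lim \<gamma>_lim \<eta>_lim"
  shows
    "let
       c1 = weakly_converges_loc_uniformly (ordered_pairs I)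
              (\<lambda>n (s, t). f n s t) (\<lambda>(s, t). f_lim s t);
       c2 = loc_uniform_limit (upper_half_plane \<times> I)
              (\<lambda>n (z, t). voiculescu_ext (f n 0 t) z) (\<lambda>(z, t). voiculescu_ext (f_lim 0 t) z);
       c3 = (\<forall>z\<in>A. loc_uniform_limit I
              (\<lambda>n t. voiculescu_ext (f n 0 t) z) (\<lambda>t. voiculescu_ext (f_lim 0 t) z));
       c4_shift = loc_uniform_limit I \<gamma> \<gamma>_lim;
       c4i = weakly_converges_loc_uniformly I \<eta> \<eta>_lim;
       c4ii = (\<forall>t\<in>I. weakly_converges UNIV (\<lambda>n. \<eta> n t) (\<eta>_lim t));
       c4iii = (\<forall>T\<in>I. weakly_converges (UNIV \<times> {0..T})
                 (\<lambda>n. restrict_space (space_time_measure I (\<eta> n)) (UNIV \<times> {0..T}))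
                 (restrict_space (space_time_measure I \<eta>_lim) (UNIV \<times> {0..T})))
     in
       (c4i \<longleftrightarrow> c4ii) \<and> (c4ii \<longleftrightarrow> c4iii) \<and>
       (c1 \<longleftrightarrow> c2) \<and> (c2 \<longleftrightarrow> c3) \<and> (c3 \<longleftrightarrow> c4_shift \<and> c4i \<and> c4ii \<and> c4iii)"
proof -
  interpret converging_hemigroups I f \<gamma> \<eta> f_lim \<gamma>_lim \<eta>_lim
    by (intro converging_hemigroups.intro allI free_hemigroup_generatorI assms)
  obtain \<xi> where \<xi>: "\<xi> \<in> upper_half_plane" "\<xi> islimpt A" using assms(3) by blast
  let ?SQ = "generators_converge_continuously I \<gamma> \<eta> \<gamma>_lim \<eta>_lim"
  let ?c2 = "loc_uniform_limit (upper_half_plane \<times> I)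
              (\<lambda>n (z, t). voiculescu_ext (f n 0 t) z) (\<lambda>(z, t). voiculescu_ext (f_lim 0 t) z)"
  let ?c3 = "\<forall>z\<in>A. loc_uniform_limit I
              (\<lambda>n t. voiculescu_ext (f n 0 t) z) (\<lambda>t. voiculescu_ext (f_lim 0 t) z)"
  have c4: "weakly_converges_loc_uniformly I \<eta> \<eta>_lim \<longleftrightarrow> (\<forall>t\<in>I. weakly_converges UNIV (\<lambda>n. \<eta> n t) (\<eta>_lim t))"
    using weakly_converges_loc_uniformly_if_pointwise[where \<gamma> = \<gamma> and \<eta> = \<eta>, OF generator_n L.generator_axioms]
      weakly_converges_pointwise_if_loc_uniformly[of I \<eta> \<eta>_lim] by blast
  have "?SQ \<Longrightarrow> ?c2" by (rule transforms_loc_uniform_if_generators_converge)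
  moreover have "?c2 \<Longrightarrow> ?c3"
  proof
    fix z assume c2: ?c2 and "z \<in> A"
    then have "z \<in> upper_half_plane" using assms(2) by blast
    from loc_uniform_limit_section[OF c2 this]
    show "loc_uniform_limit I (\<lambda>n t. voiculescu_ext (f n 0 t) z) (\<lambda>t. voiculescu_ext (f_lim 0 t) z)" by simp
  qed
  moreover have "?c3 \<Longrightarrow> ?SQ" by (rule generators_converge_if_transforms_converge_on[OF assms(2) \<xi>])
  ultimately have c2: "?c2 \<longleftrightarrow> ?SQ" and c3: "?c3 \<longleftrightarrow> ?SQ" by blast+
  show ?thesis
    unfolding Let_def hemigroups_converge_iff c2 c3 c4
      weakly_converges_space_time_iff[where \<gamma> = \<gamma> and \<eta> = \<eta>, OF generator_n L.generator_axioms, symmetric]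
      generators_converge_continuously_iff
    by blast
qed

end
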